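(* Assume that conditions (1)-(11) listed in the context are satisfied, and that $F_\lambda$ admits five derivatives in a neighborhood of zero. Then $\overline{\varphi_2}(h_2)$ is an asymptotically unbiased estimator of $\phi_2(a_2)$. More specifically, the following holds: $$\mathbb{E}\left[\overline{\varphi_2}(h_2)-\phi_2(a_2)\right]=-24\,d\,(d+4)\,\tau_6\,h_2^6\left(B_6-B_4^{3/2}\right)+O(h_2^2\,q_n)+o(h_2^6),$$ where $\tau_6=F_\lambda^{(6)}(0)/6!$ and $g_k=m_{K,d+k}/m_{K,d}$ (so $g_k=B_k$).
   Context: **Field and data.** $X_\lambda$ is a real-valued, zero-mean, weakly stationary, isotropic random field on $\mathbb{R}^d$ (not necessarily Gaussian) with semivariogram $F_\lambda(r)=\frac12\mathbb{E}[(X_\lambda(\mathbf{s})-X_\lambda(\mathbf{s}'))^2]$ for $\|\mathbf{s}-\mathbf{s}'\|=r$. The data $X^*_i=X^*(\mathbf{s}_i)$, $i=1,\dots,n$, are observed at random sampling points $\mathbf{s}_1,\dots,\mathbf{s}_n$ in a domain $\Omega_n\subset\mathbb{R}^d$ and are modeled as a sample of $X_\lambda$. $|\Omega_n|$ is the area (volume) enclosed by the convex hull of $\Omega_n$. Put $X^*_{i,j}=X^*_i-X^*_j$ and $s_{i,j}=\|\mathbf{s}_i-\mathbf{s}_j\|$. Write $\mathbf{s}_i=L_n\mathbf{U}_i$, with $L_n\propto|\Omega_n|^{1/d}$ and $\mathbf{U}_i$ a random vector in $[0,1]^d$; $\mathbf{U}_{i,j}=\mathbf{U}_i-\mathbf{U}_j$.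 The asymptotic limit is $n\to\infty$ with $1/|\Omega_n|\to0$. **Kernel.** $K$ is an isotropic, bounded, positive kernel, a function of distance with compact support $[0,R]$. Put $m_{K,j}=\int_0^R s^{j-1}K(s)\,ds$ and $B_p=m_{K,d+p}/m_{K,d}$. For a bandwidth $h>0$ and a pair function $A_{i,j}$, $$\langle A_{i,j}\rangle_h=\frac{\sum_{i\ne j}K(s_{i,j}/h)A_{i,j}}{\sum_{i\ne j}K(s_{i,j}/h)},\qquad \overline{f_X}(h)=\langle (X^*_{i,j})^2\rangle_h.$$ **Curvature constraints.** Let $c_d^{(1)}=2d$, $c_d^{(2)}=8d^2$, $c_d^{(3)}=4d(d-1)$. The stochastic constraint is $\phi_2(a)=c_d^{(2)}F_\lambda(a)-c_d^{(3)}F_\lambda(\sqrt2a)-c_d^{(1)}F_\lambda(2a)$. The sample constraint is $$\overline{\varphi_2}(h_2)=\tfrac12\left[c_d^{(2)}\mu_1(h_2)\overline{f_X}(h_2)-c_d^{(3)}\mu_2(h_2)\overline{f_X}(\sqrt2h_2)-c_d^{(1)}\overline{f_X}(2h_2)\right],$$ $$\mu_1(h_2)=\frac{c_d^{(3)}\mu_2(h_2)\langle s_{i,j}^2\rangle_{\sqrt2h_2}+c_d^{(1)}\langle s_{i,j}^2\rangle_{2h_2}}{c_d^{(2)}\langle s_{i,j}^2\rangle_{h_2}},$$ $$\mu_2(h_2)=\frac{[c_d^{(2)}+8c_d^{(1)}]\langle s_{i,j}^4\rangle_{h_2}+c_d^{(1)}\langle s_{i,j}^4\rangle_{h_2}\frac{\langle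 s_{i,j}^2\rangle_{2h_2}}{\langle s_{i,j}^2\rangle_{h_2}}-c_d^{(1)}\langle s_{i,j}^4\rangle_{2h_2}}{c_d^{(3)}\langle s_{i,j}^4\rangle_{\sqrt2h_2}-c_d^{(3)}\langle s_{i,j}^4\rangle_{h_2}\frac{\langle s_{i,j}^2\rangle_{\sqrt2h_2}}{\langle s_{i,j}^2\rangle_{h_2}}}.$$ The step $a_2$ and the bandwidth $h_2$ are linked by the consistency principle $a_2^4=\langle s_{i,j}^4\rangle_{h_2}$; powers of $h_2$ and $a_2$ are not distinguished from their stochastic moments. Put $q_n=h_2/L_n$. Expectations are over both the field values and the sampling positions. "Asymptotically unbiased" means that the bias tends to $0$ faster than each of the two compared quantities. **Conditions.** (1) $\mathbf{U}_1,\dots,\mathbf{U}_n$ are independent and identically distributed. (2) The pdf $f_1$ of $\mathbf{U}_{i,j}$ is continuously differentiable in a neighborhood of zero. (3) The joint pdfs $f_2$ of $(\mathbf{U}_{i,j},\mathbf{U}_{i,k})$ and $f_3$ of $(\mathbf{U}_{i,j},\mathbf{U}_{i,k},\mathbf{U}_{i,l})$ are continuously differentiable in a neighborhood of zero. (4) The conditional pdf of $\mathbf{U}_{i,j}$ given $\mathbf{U}_j=\mathbf{u}$ is uniformly bounded in $\mathbf{u}$. (5) The joint moments of $X^*$ are identical to those of $X_\lambda$; for example, the semivariogram of $X^*$ is $F_\lambda$. (6) $F_\lambda$ is continuous in a neighborhood of zero. (7) There is a continuous bounded function $\psi_\lambda$ such that $\mathrm{Cov}[(X^*_{i,j})^2,(X^*_{p,q})^2]=\psi_\lambda(s_{i,p},s_{j,q},s_{i,q},s_{j,p})$.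 (8) For $\epsilon\ll1$ there exist $c_1\ge1$ and continuous functions $g_1,g_2,g_3$ (distinct from the constants $g_k$ in the claim) such that, with $\xi>0$ the characteristic length: $\psi_\lambda(0,0,\epsilon s,\epsilon s)=g_1(s)(\epsilon/\xi)^{2c_1}+o((\epsilon/\xi)^{2c_1})$; $\psi_\lambda(\epsilon s_1,\epsilon s_2,0,\epsilon s_3)=g_2(s_1,s_2,s_3)(\epsilon/\xi)^{2c_1}+o((\epsilon/\xi)^{2c_1})$; and $\psi_\lambda(u_3,\|\epsilon\boldsymbol\omega_2+u_3\hat{\boldsymbol\omega}_3-\epsilon\boldsymbol\omega_1\|,\|u_3\hat{\boldsymbol\omega}_3+\epsilon\boldsymbol\omega_2\|,\|u_3\hat{\boldsymbol\omega}_3-\epsilon\boldsymbol\omega_1\|)=g_3(u_3,\omega_1,\omega_2,\boldsymbol\theta_1,\boldsymbol\theta_2,\boldsymbol\theta_3)(\epsilon/\xi)^{2c_1}+o((\epsilon/\xi)^{2c_1})$, where $\boldsymbol\omega_i=\omega_i\hat{\boldsymbol\omega}_i$ in spherical polar coordinates, $\omega_i=\|\boldsymbol\omega_i\|$, and $\boldsymbol\theta_i$ are the angles of the unit vector $\hat{\boldsymbol\omega}_i$. (9) The integral $\int du_3\,u_3^{d-1}g_3(u_3,\omega_1,\omega_2,\boldsymbol\theta_1,\boldsymbol\theta_2,\boldsymbol\theta_3)$ over $u_3\ge 0$ is bounded. (10) The bandwidths tend to $0$ as $n\to\infty$. (11) $|\Omega_n|/n\to0$ as $n\to\infty$.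
   Formalization: Needs d≥2. The estimator's random denominators can vanish, so the expectation is conditional on their being at least κ (any 0<κ<1) times their asymptotic values; the unconditional formula is claimed only if the error is integrable and negligible outside that event. *)

theory Defs
  imports "HOL-Probability.Probability" "HOL-Library.Landau_Symbols"
begin

text \<open>
  Points of \<open>d\<close>-dimensional space have type \<^typ>\<open>real ^ 'd\<close> with \<open>d = CARD('d)\<close>.  The field lives on a
  probability space \<open>N\<close>, the sampling positions on a probability space \<open>P\<close>; expectations over
  both are integrals over the product \<open>N \<Otimes>\<^sub>M P\<close>, so positions and field are independent.
  Sample indices run through \<open>{..<n}\<close>.
\<close>

definition stationary_isotropic_field :: "'w measure \<Rightarrow> (real ^ 'd \<Rightarrow> 'w \<Rightarrow> real) \<Rightarrow> bool" where
  "stationary_isotropic_field N X \<longleftrightarrow>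
     (\<forall>p. X p \<in> borel_measurable N \<and> integrable N (\<lambda>w. (X p w)\<^sup>2)) \<and>
     (\<forall>p. (\<integral>w. X p w \<partial>N) = 0) \<and>
     (\<exists>C :: real \<Rightarrow> real. \<forall>p q. (\<integral>w. X p w * X q w \<partial>N) = C (dist p q))"

definition is_semivariogram ::
  "'w measure \<Rightarrow> (real ^ 'd \<Rightarrow> 'w \<Rightarrow> real) \<Rightarrow> (real \<Rightarrow> real) \<Rightarrow> bool" where
  "is_semivariogram N X F \<longleftrightarrow> (\<forall>p q. F (dist p q) = (1/2) * (\<integral>w. (X p w - X q w)\<^sup>2 \<partial>N))"

definition same_joint_moments ::
  "'v measure \<Rightarrow> (real ^ 'd \<Rightarrow> 'v \<Rightarrow> real) \<Rightarrow> 'w measure \<Rightarrow> (real ^ 'd \<Rightarrow> 'w \<Rightarrow> real) \<Rightarrow> bool" where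
  "same_joint_moments N X N' X' \<longleftrightarrow>
     (\<forall>ps. (integrable N (\<lambda>w. \<Prod>p\<leftarrow>ps. X p w) \<longleftrightarrow> integrable N' (\<lambda>w. \<Prod>p\<leftarrow>ps. X' p w)) \<and>
           (\<integral>w. (\<Prod>p\<leftarrow>ps. X p w) \<partial>N) = (\<integral>w. (\<Prod>p\<leftarrow>ps. X' p w) \<partial>N'))"

definition cov :: "'w measure \<Rightarrow> ('w \<Rightarrow> real) \<Rightarrow> ('w \<Rightarrow> real) \<Rightarrow> real" where
  "cov N Y Z = (\<integral>w. (Y w - (\<integral>w. Y w \<partial>N)) * (Z w - (\<integral>w. Z w \<partial>N)) \<partial>N)"

text \<open>
  A semivariogram is a function of the lag \<open>r \<ge> 0\<close>; along a line through the origin it is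
  the even function \<open>r \<mapsto> F \<bar>r\<bar>\<close>, and derivatives at zero are derivatives of that function.
\<close>

definition even_ext :: "(real \<Rightarrow> real) \<Rightarrow> real \<Rightarrow> real" where
  "even_ext F r = F \<bar>r\<bar>"

definition differentiable_near_zero :: "nat \<Rightarrow> (real \<Rightarrow> real) \<Rightarrow> bool" where
  "differentiable_near_zero m f \<longleftrightarrow>
     (\<exists>\<epsilon>>0. \<forall>k<m. \<forall>x. \<bar>x\<bar> < \<epsilon> \<longrightarrow> (deriv ^^ k) f differentiable (at x))"

definition tau :: "(real \<Rightarrow> real) \<Rightarrow> nat \<Rightarrow> real" where
  "tau F m = (deriv ^^ m) (even_ext F) 0 / fact m"

definition C1_near_zero :: "('a :: real_normed_vector \<Rightarrow> real) \<Rightarrow> bool" where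
  "C1_near_zero f \<longleftrightarrow>
     (\<exists>S f'. open S \<and> 0 \<in> S \<and> (\<forall>x\<in>S. (f has_derivative blinfun_apply (f' x)) (at x)) \<and>
             continuous_on S f')"

text \<open>
  The short-lag expansions of the covariance \<open>\<psi>\<close> of squared increments.  Directions are
  represented by unit vectors \<open>\<theta>\<^sub>i\<close> rather than by tuples of angles.
\<close>

definition covariance_expansion ::
  "(real \<Rightarrow> real \<Rightarrow> real \<Rightarrow> real \<Rightarrow> real) \<Rightarrow> real \<Rightarrow> real \<Rightarrow> (real \<Rightarrow> real) \<Rightarrow> (real \<Rightarrow> real \<Rightarrow> real \<Rightarrow> real) \<Rightarrow>
   (real \<Rightarrow> real \<Rightarrow> real \<Rightarrow> real ^ 'd \<Rightarrow> real ^ 'd \<Rightarrow> real ^ 'd \<Rightarrow> real) \<Rightarrow> bool" where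
  "covariance_expansion \<psi> \<xi> c g1 g2 g3 \<longleftrightarrow>
     continuous_on {0..} g1 \<and>
     continuous_on ({0..} \<times> {0..} \<times> {0..}) (\<lambda>(r, s, t). g2 r s t) \<and>
     continuous_on ({0..} \<times> {0..} \<times> {0..} \<times> sphere 0 1 \<times> sphere 0 1 \<times> sphere 0 1)
       (\<lambda>(u, r1, r2, t1, t2, t3). g3 u r1 r2 t1 t2 t3) \<and>
     (\<forall>s\<ge>0. (\<lambda>\<epsilon>. \<psi> 0 0 (\<epsilon> * s) (\<epsilon> * s) - g1 s * (\<epsilon> / \<xi>) powr (2 * c))
        \<in> o[at_right 0](\<lambda>\<epsilon>. (\<epsilon> / \<xi>) powr (2 * c))) \<and>
     (\<forall>s1\<ge>0. \<forall>s2\<ge>0. \<forall>s3\<ge>0.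
        (\<lambda>\<epsilon>. \<psi> (\<epsilon> * s1) (\<epsilon> * s2) 0 (\<epsilon> * s3) - g2 s1 s2 s3 * (\<epsilon> / \<xi>) powr (2 * c))
        \<in> o[at_right 0](\<lambda>\<epsilon>. (\<epsilon> / \<xi>) powr (2 * c))) \<and>
     (\<forall>u\<ge>0. \<forall>r1\<ge>0. \<forall>r2\<ge>0. \<forall>t1 \<in> sphere 0 1. \<forall>t2 \<in> sphere 0 1. \<forall>t3 \<in> sphere 0 1.
        (\<lambda>\<epsilon>. \<psi> u
                (norm (\<epsilon> *\<^sub>R (r2 *\<^sub>R t2) + u *\<^sub>R t3 - \<epsilon> *\<^sub>R (r1 *\<^sub>R t1)))
                (norm (u *\<^sub>R t3 + \<epsilon> *\<^sub>R (r2 *\<^sub>R t2)))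
                (norm (u *\<^sub>R t3 - \<epsilon> *\<^sub>R (r1 *\<^sub>R t1)))
              - g3 u r1 r2 t1 t2 t3 * (\<epsilon> / \<xi>) powr (2 * c))
        \<in> o[at_right 0](\<lambda>\<epsilon>. (\<epsilon> / \<xi>) powr (2 * c)))"

text \<open>
  By the third expansion \<open>g3\<close> is homogeneous of degree \<open>2c\<close> in \<open>(r1, r2)\<close>, so its integral can
  only be bounded for \<open>r1\<close>, \<open>r2\<close> in a bounded set; the relevant one is the support of the kernel.
\<close>

definition bounded_radial_integral ::
  "real \<Rightarrow> (real \<Rightarrow> real \<Rightarrow> real \<Rightarrow> real ^ 'd \<Rightarrow> real ^ 'd \<Rightarrow> real ^ 'd \<Rightarrow> real) \<Rightarrow> bool" where
  "bounded_radial_integral R g3 \<longleftrightarrow>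
     (\<exists>C. \<forall>r1\<in>{0..R}. \<forall>r2\<in>{0..R}. \<forall>t1 \<in> sphere 0 1. \<forall>t2 \<in> sphere 0 1. \<forall>t3 \<in> sphere 0 1.
        set_integrable lborel {0..} (\<lambda>u. u ^ (CARD('d) - 1) * g3 u r1 r2 t1 t2 t3) \<and>
        \<bar>LBINT u:{0..}. u ^ (CARD('d) - 1) * g3 u r1 r2 t1 t2 t3\<bar> \<le> C)"

definition is_kernel :: "(real \<Rightarrow> real) \<Rightarrow> real \<Rightarrow> bool" where
  "is_kernel K R \<longleftrightarrow> K \<in> borel_measurable borel \<and> bounded (range K) \<and> 0 < R \<and>
     (\<forall>s. 0 \<le> s \<and> s < R \<longrightarrow> 0 < K s) \<and> 0 \<le> K R \<and> (\<forall>s>R. K s = 0)"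

definition kmom :: "(real \<Rightarrow> real) \<Rightarrow> real \<Rightarrow> nat \<Rightarrow> real" where
  "kmom K R j = (LBINT s:{0..R}. s ^ (j - 1) * K s)"

definition Bmom :: "(real \<Rightarrow> real) \<Rightarrow> real \<Rightarrow> nat \<Rightarrow> nat \<Rightarrow> real" where
  "Bmom K R d p = kmom K R (d + p) / kmom K R d"

definition kweight :: "(real \<Rightarrow> real) \<Rightarrow> nat \<Rightarrow> (nat \<Rightarrow> real ^ 'd) \<Rightarrow> real \<Rightarrow> (nat \<Rightarrow> nat \<Rightarrow> real) \<Rightarrow> real" where
  "kweight K n s h A =
     (\<Sum>(i, j) \<in> {(i, j). i < n \<and> j < n \<and> i \<noteq> j}. K (dist (s i) (s j) / h) * A i j)"

definition kavg :: "(real \<Rightarrow> real) \<Rightarrow> nat \<Rightarrow> (nat \<Rightarrow> real ^ 'd) \<Rightarrow> real \<Rightarrow> (nat \<Rightarrow> nat \<Rightarrow> real) \<Rightarrow> real" where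
  "kavg K n s h A = kweight K n s h A / kweight K n s h (\<lambda>_ _. 1)"

definition lag_mom :: "(real \<Rightarrow> real) \<Rightarrow> nat \<Rightarrow> (nat \<Rightarrow> real ^ 'd) \<Rightarrow> nat \<Rightarrow> real \<Rightarrow> real" where
  "lag_mom K n s p h = kavg K n s h (\<lambda>i j. dist (s i) (s j) ^ p)"

definition sq_incr :: "(real \<Rightarrow> real) \<Rightarrow> nat \<Rightarrow> (nat \<Rightarrow> real ^ 'd) \<Rightarrow> (nat \<Rightarrow> real) \<Rightarrow> real \<Rightarrow> real" where
  "sq_incr K n s x h = kavg K n s h (\<lambda>i j. (x i - x j)\<^sup>2)"

definition cd1 :: "nat \<Rightarrow> real" where "cd1 d = 2 * real d"
definition cd2 :: "nat \<Rightarrow> real" where "cd2 d = 8 * (real d)\<^sup>2"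
definition cd3 :: "nat \<Rightarrow> real" where "cd3 d = 4 * real d * (real d - 1)"

definition phi2 :: "nat \<Rightarrow> (real \<Rightarrow> real) \<Rightarrow> real \<Rightarrow> real" where
  "phi2 d F a = cd2 d * F a - cd3 d * F (sqrt 2 * a) - cd1 d * F (2 * a)"

definition mu2_num :: "(real \<Rightarrow> real) \<Rightarrow> nat \<Rightarrow> (nat \<Rightarrow> real ^ 'd) \<Rightarrow> real \<Rightarrow> real" where
  "mu2_num K n s h =
     (let d = CARD('d); m2 = lag_mom K n s 2; m4 = lag_mom K n s 4 in
      (cd2 d + 8 * cd1 d) * m4 h + cd1 d * m4 h * (m2 (2 * h) / m2 h) - cd1 d * m4 (2 * h))"

definition mu2_den :: "(real \<Rightarrow> real) \<Rightarrow> nat \<Rightarrow> (nat \<Rightarrow> real ^ 'd) \<Rightarrow> real \<Rightarrow> real" where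
  "mu2_den K n s h =
     (let d = CARD('d); m2 = lag_mom K n s 2; m4 = lag_mom K n s 4 in
      cd3 d * m4 (sqrt 2 * h) - cd3 d * m4 h * (m2 (sqrt 2 * h) / m2 h))"

definition mu2 :: "(real \<Rightarrow> real) \<Rightarrow> nat \<Rightarrow> (nat \<Rightarrow> real ^ 'd) \<Rightarrow> real \<Rightarrow> real" where
  "mu2 K n s h = mu2_num K n s h / mu2_den K n s h"

definition mu1 :: "(real \<Rightarrow> real) \<Rightarrow> nat \<Rightarrow> (nat \<Rightarrow> real ^ 'd) \<Rightarrow> real \<Rightarrow> real" where
  "mu1 K n s h =
     (let d = CARD('d); m2 = lag_mom K n s 2 in
      (cd3 d * mu2 K n s h * m2 (sqrt 2 * h) + cd1 d * m2 (2 * h)) / (cd2 d * m2 h))"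

definition phi2_bar ::
  "(real \<Rightarrow> real) \<Rightarrow> nat \<Rightarrow> (nat \<Rightarrow> real ^ 'd) \<Rightarrow> (nat \<Rightarrow> real) \<Rightarrow> real \<Rightarrow> real" where
  "phi2_bar K n s x h =
     (let d = CARD('d); f = sq_incr K n s x in
      (1/2) * (cd2 d * mu1 K n s h * f h - cd3 d * mu2 K n s h * f (sqrt 2 * h) - cd1 d * f (2 * h)))"

definition step2 :: "(real \<Rightarrow> real) \<Rightarrow> nat \<Rightarrow> (nat \<Rightarrow> real ^ 'd) \<Rightarrow> real \<Rightarrow> real" where
  "step2 K n s h = root 4 (lag_mom K n s 4 h)"

text \<open>
  The quotients above have random denominators, which vanish with positive probability (for
  instance if no two points are within distance \<open>R h\<close>) and have no integrable inverse in general.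
  A configuration is well conditioned if no denominator vanishes and those of \<open>\<mu>\<^sub>1\<close>, \<open>\<mu>\<^sub>2\<close> are at
  least the fraction \<open>\<kappa>\<close> of their asymptotic values, obtained by replacing \<open>\<langle>s\<^sup>p\<rangle>\<^sub>h\<close> by \<open>B\<^sub>p h\<^sup>p\<close>.
\<close>

definition well_conditioned ::
  "real \<Rightarrow> (real \<Rightarrow> real) \<Rightarrow> real \<Rightarrow> nat \<Rightarrow> (nat \<Rightarrow> real ^ 'd) \<Rightarrow> real \<Rightarrow> bool" where
  "well_conditioned \<kappa> K R n s h \<longleftrightarrow>
     (let d = CARD('d) in
      (\<forall>b \<in> {h, sqrt 2 * h, 2 * h}. 0 < kweight K n s b (\<lambda>_ _. 1)) \<and>
      \<kappa> * (Bmom K R d 2 * h\<^sup>2) \<le> lag_mom K n s 2 h \<and>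
      \<kappa> * (2 * cd3 d * Bmom K R d 4 * h ^ 4) \<le> mu2_den K n s h)"

definition sites :: "(nat \<Rightarrow> real) \<Rightarrow> (nat \<Rightarrow> 'v \<Rightarrow> real ^ 'd) \<Rightarrow> nat \<Rightarrow> 'v \<Rightarrow> nat \<Rightarrow> real ^ 'd" where
  "sites L U n v i = L n *\<^sub>R U i v"

definition estimator ::
  "(real \<Rightarrow> real) \<Rightarrow> (nat \<Rightarrow> real) \<Rightarrow> (nat \<Rightarrow> 'v \<Rightarrow> real ^ 'd) \<Rightarrow> (real ^ 'd \<Rightarrow> 'w \<Rightarrow> real) \<Rightarrow> (nat \<Rightarrow> real) \<Rightarrow>
   nat \<Rightarrow> 'w \<times> 'v \<Rightarrow> real" where
  "estimator K L U X h n = (\<lambda>(w, v).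
     phi2_bar K n (sites L U n v) (\<lambda>i. X (sites L U n v i) w) (h n))"

definition target ::
  "(real \<Rightarrow> real) \<Rightarrow> (nat \<Rightarrow> real) \<Rightarrow> (nat \<Rightarrow> 'v \<Rightarrow> real ^ 'd) \<Rightarrow> (real \<Rightarrow> real) \<Rightarrow> (nat \<Rightarrow> real) \<Rightarrow>
   nat \<Rightarrow> 'w \<times> 'v \<Rightarrow> real" where
  "target K L U F h n = (\<lambda>(w, v). phi2 CARD('d) F (step2 K n (sites L U n v) (h n)))"

definition good_event ::
  "'w measure \<Rightarrow> 'v measure \<Rightarrow> real \<Rightarrow> (real \<Rightarrow> real) \<Rightarrow> real \<Rightarrow> (nat \<Rightarrow> real) \<Rightarrow> (nat \<Rightarrow> 'v \<Rightarrow> real ^ 'd) \<Rightarrow>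
   (nat \<Rightarrow> real) \<Rightarrow> nat \<Rightarrow> ('w \<times> 'v) set" where
  "good_event N P \<kappa> K R L U h n =
     {(w, v) \<in> space (N \<Otimes>\<^sub>M P). well_conditioned \<kappa> K R n (sites L U n v) (h n)}"

text \<open>
  In the following \<open>Q n\<close> is the probability measure with respect to which the expectations for
  sample size \<open>n\<close> are taken.
\<close>

definition bias :: "(nat \<Rightarrow> 'z measure) \<Rightarrow> (nat \<Rightarrow> 'z \<Rightarrow> real) \<Rightarrow> (nat \<Rightarrow> 'z \<Rightarrow> real) \<Rightarrow> nat \<Rightarrow> real" where
  "bias Q est tgt n = (\<integral>z. est n z - tgt n z \<partial>Q n)"

definition asymptotically_unbiased ::
  "(nat \<Rightarrow> 'z measure) \<Rightarrow> (nat \<Rightarrow> 'z \<Rightarrow> real) \<Rightarrow> (nat \<Rightarrow> 'z \<Rightarrow> real) \<Rightarrow> bool" where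
  "asymptotically_unbiased Q est tgt \<longleftrightarrow>
     bias Q est tgt \<longlonglongrightarrow> 0 \<and>
     bias Q est tgt \<in> o(\<lambda>n. \<integral>z. est n z \<partial>Q n) \<and>
     bias Q est tgt \<in> o(\<lambda>n. \<integral>z. tgt n z \<partial>Q n)"

text \<open>\<open>x = y + O(r) + o(r')\<close> for sequences:\<close>

definition equal_up_to ::
  "(nat \<Rightarrow> real) \<Rightarrow> (nat \<Rightarrow> real) \<Rightarrow> (nat \<Rightarrow> real) \<Rightarrow> (nat \<Rightarrow> real) \<Rightarrow> bool" where
  "equal_up_to x y r r' \<longleftrightarrow> (\<exists>u \<in> O(r). \<exists>v \<in> o(r'). \<forall>n. x n = y n + u n + v n)"

text \<open>
  The contribution of the configurations outside \<open>G n\<close> to the expected error is negligible, both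
  relative to the target and relative to the remainder terms \<open>r\<close>, \<open>r'\<close>.
\<close>

definition negligible_outside ::
  "'z measure \<Rightarrow> (nat \<Rightarrow> 'z set) \<Rightarrow> (nat \<Rightarrow> 'z \<Rightarrow> real) \<Rightarrow> (nat \<Rightarrow> 'z \<Rightarrow> real) \<Rightarrow>
   (nat \<Rightarrow> real) \<Rightarrow> (nat \<Rightarrow> real) \<Rightarrow> bool" where
  "negligible_outside M G est tgt r r' \<longleftrightarrow>
     (\<forall>\<^sub>F n in sequentially. integrable M (\<lambda>z. est n z - tgt n z)) \<and>
     (let rest = (\<lambda>n. \<integral>z. \<bar>est n z - tgt n z\<bar> * indicator (space M - G n) z \<partial>M) in
      rest \<in> o(\<lambda>n. \<integral>z. tgt n z \<partial>M) \<and> equal_up_to rest (\<lambda>_. 0) r r')"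

end

theory Submission
  imports Defs
begin

text \<open>
  Given the positions, the estimator has mean equal to the same combination of kernel averages
  applied to \<open>F\<close> at the observed lags.  The weights \<open>\<mu>\<^sub>1\<close>, \<open>\<mu>\<^sub>2\<close> cancel the second-order Taylor term of
  \<open>F\<close> and reproduce the fourth-order term of the target exactly, so on well-conditioned
  configurations the conditional error is \<open>O(h\<^sup>6)\<close>, with sixth-order term proportional to \<open>\<tau>\<^sub>6\<close>.

  If \<open>n\<^sup>2 q\<^sup>d\<close> tends to infinity, second-moment bounds show that \<open>\<langle>s\<^sup>p\<rangle>\<^sub>b\<^sub>h / h\<^sup>p\<close> tends to \<open>b\<^sup>p B\<^sub>p\<close> in
  probability, which identifies the constant.  No rate is assumed for the bandwidth, so \<open>n\<^sup>2 q\<^sup>d\<close> may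
  also stay bounded; but then eventually \<open>h\<^sup>3 L < 1\<close>, and the whole error is already \<open>O(h\<^sup>2 q)\<close>.

  The target is of exact order \<open>h\<^sup>4\<close> unless \<open>\<tau>\<^sub>4 = 0\<close>.  In that case the second differences of the field
  along a line vanish in mean square, so \<open>F\<close> is identically zero and there is no error.
\<close>

section \<open>Taylor expansion of the semivariogram\<close>

text \<open>The constant is arithmetic of the curvature weights: once \<open>mu1\<close> and
  \<open>mu2\<close> tend to 1, a term \<open>r ^ 6\<close> enters with coefficient cd2 - 8 cd3 - 64
  cd1 = - 24 d (d + 4). The kernel average turns \<open>r ^ 6\<close> into B_6, whereas the target
  sees \<open>step2 ^ 6\<close>, the power 3/2 of the fourth lag moment; hence the difference of B_6
  and B_4 to the power 3/2.

  On a well-conditioned configuration the weights obey deterministic bounds, so the conditional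
  error is at most C h^6 pointwise. Probability enters only to identify the limit, and it is
  available only along those n with h^3 L \<ge> 1, a set that need be neither cofinite nor infinite.
  Limits are therefore taken along \<open>sequentially\<close> restricted to this set.

  The good event has no lower bound on its probability p outside that set. The error and the target
  are integrated over the same event, the error being at most C h^6 p and the target at least c h^4
  p in absolute value (if \<tau>_4 is nonzero), so p cancels in every comparison of the two.

  The laws of large numbers divide by a multiple of the density of an increment at zero. Its
  positivity is not a hypothesis; it follows from the positions lying in a cube.\<close>

lemma MVT_smallo_power:
  fixes g g' :: "real \<Rightarrow> real"
  assumes "0 < e" and der: "\<And>x. \<bar>x\<bar> < e \<Longrightarrow> (g has_real_derivative g' x) (at x)"
    and "g 0 = 0" and small: "g' \<in> o[at 0](\<lambda>x. x ^ m)"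
  shows "g \<in> o[at 0](\<lambda>x. x ^ Suc m)"
proof (rule landau_o.smallI)
  fix c :: real assume "0 < c"
  from landau_o.smallD[OF small this] obtain r where r: "0 < r"
    and bd: "\<And>x. x \<noteq> 0 \<Longrightarrow> \<bar>x\<bar> < r \<Longrightarrow> \<bar>g' x\<bar> \<le> c * \<bar>x ^ m\<bar>"
    by (auto simp: eventually_at dist_real_def)
  have "\<bar>g x\<bar> \<le> c * \<bar>x ^ Suc m\<bar>" if x: "x \<noteq> 0" "\<bar>x\<bar> < min e r" for x
  proof -
    \<comment> \<open>The mean value theorem gives g x = x g'(z) with z strictly between 0 and x.
      That z is nonzero matters, since the bound on g' holds only off zero.\<close>
    have "\<exists>z. z \<noteq> 0 \<and> \<bar>z\<bar> < \<bar>x\<bar> \<and> \<bar>g x\<bar> = \<bar>x\<bar> * \<bar>g' z\<bar>"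
    proof (cases "0 < x")
      case True
      obtain z where "0 < z" "z < x" "g x - g 0 = (x - 0) * g' z"
        using MVT2[OF True, of g g'] der x(2) True by (auto simp: abs_if split: if_splits)
      then show ?thesis using \<open>g 0 = 0\<close> True by (intro exI[of _ z]) (auto simp: abs_mult)
    next
      case False
      with x have neg: "x < 0" by simp
      obtain z where "x < z" "z < 0" "g 0 - g x = (0 - x) * g' z"
        using MVT2[OF neg, of g g'] der x(2) neg by (auto simp: abs_if split: if_splits)
      then have "z \<noteq> 0" "\<bar>z\<bar> < \<bar>x\<bar>" "g x = x * g' z" using \<open>g 0 = 0\<close> by (auto simp: abs_if)
      then show ?thesis by (intro exI[of _ z]) (auto simp: abs_mult)
    qed
    then obtain z where z: "z \<noteq> 0" "\<bar>z\<bar> < \<bar>x\<bar>" "\<bar>g x\<bar> = \<bar>x\<bar> * \<bar>g' z\<bar>" by blast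
    have "\<bar>g' z\<bar> \<le> c * \<bar>z ^ m\<bar>" using bd z x by auto
    also have "\<dots> \<le> c * \<bar>x\<bar> ^ m"
      using z \<open>0 < c\<close> by (auto simp: power_abs intro!: mult_left_mono power_mono)
    finally have "\<bar>x\<bar> * \<bar>g' z\<bar> \<le> \<bar>x\<bar> * (c * \<bar>x\<bar> ^ m)" by (intro mult_left_mono) auto
    then show ?thesis unfolding z(3) by (simp add: abs_mult power_abs mult_ac)
  qed
  then show "\<forall>\<^sub>F x in at 0. norm (g x) \<le> c * norm (x ^ Suc m)"
    unfolding eventually_at using \<open>0 < e\<close> r
    by (intro exI[of _ "min e r"]) (auto simp: dist_real_def)
qed

text \<open>The induction passes from f to \<open>deriv f\<close>, and
  \<open>MVT_smallo_power\<close> carries the remainder back; the base case is the definition of the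
  derivative. The Peano form asks for the highest derivative at the point zero alone, so five
  derivatives near zero and a sixth at zero give order six.\<close>

lemma taylor_peano:
  fixes f :: "real \<Rightarrow> real"
  assumes "differentiable_near_zero m f" and "(deriv ^^ m) f differentiable (at 0)"
  shows "(\<lambda>x. f x - (\<Sum>k\<le>Suc m. (deriv ^^ k) f 0 / fact k * x ^ k)) \<in> o[at 0](\<lambda>x. x ^ Suc m)"
  using assms
proof (induction m arbitrary: f)
  case 0
  then have "(f has_real_derivative deriv f 0) (at 0)"
    by (simp add: DERIV_deriv_iff_real_differentiable)
  then have "((\<lambda>x. (f x - f 0) / x - deriv f 0) \<longlongrightarrow> deriv f 0 - deriv f 0) (at 0)"
    unfolding DERIV_def by (intro tendsto_diff tendsto_const) simp_all
  moreover have "\<forall>\<^sub>F x in at 0. (f x - f 0) / x - deriv f 0 = (f x - (f 0 + deriv f 0 * x)) / x"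
    unfolding eventually_at_filter by (intro always_eventually) (auto simp: field_simps)
  ultimately have "((\<lambda>x. (f x - (f 0 + deriv f 0 * x)) / x) \<longlongrightarrow> 0) (at 0)"
    by (simp add: filterlim_cong)
  then show ?case
    by (intro smalloI_tendsto) (auto simp: eventually_at_filter)
next
  case (Suc m)
  obtain e where e: "0 < e"
    and diff: "\<And>k x. k < Suc m \<Longrightarrow> \<bar>x\<bar> < e \<Longrightarrow> (deriv ^^ k) f differentiable (at x)"
    using Suc.prems(1) unfolding differentiable_near_zero_def by blast
  have comp: "(deriv ^^ k) (deriv f) = (deriv ^^ Suc k) f" for k
    by (simp add: funpow_swap1)
  have "differentiable_near_zero m (deriv f)"
    unfolding differentiable_near_zero_def comp using e diff[of "Suc _"]
    by (intro exI[of _ e]) (auto simp del: funpow.simps)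
  then have IH: "(\<lambda>x. deriv f x - (\<Sum>k\<le>Suc m. (deriv ^^ Suc k) f 0 / fact k * x ^ k))
      \<in> o[at 0](\<lambda>x. x ^ Suc m)"
    using Suc.IH[of "deriv f"] Suc.prems(2) unfolding comp by simp
  show ?case
  proof (rule MVT_smallo_power[OF e _ _ IH])
    fix x :: real assume "\<bar>x\<bar> < e"
    then have f: "(f has_real_derivative deriv f x) (at x)"
      using diff[of 0 x] by (simp add: DERIV_deriv_iff_real_differentiable)
    have "((\<lambda>x. \<Sum>k\<le>Suc (Suc m). (deriv ^^ k) f 0 / fact k * x ^ k) has_real_derivative
        (\<Sum>k\<le>Suc (Suc m). (deriv ^^ k) f 0 / fact k * (real k * x ^ (k - 1)))) (at x)"
      by (intro DERIV_sum DERIV_cmult) (auto intro!: derivative_eq_intros)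
    also have "(\<Sum>k\<le>Suc (Suc m). (deriv ^^ k) f 0 / fact k * (real k * x ^ (k - 1)))
        = (\<Sum>k\<le>Suc m. (deriv ^^ Suc k) f 0 / fact k * x ^ k)"
    proof -
      have "a / fact (Suc k) * (real (Suc k) * y) = a / fact k * y" for a y :: real and k
        unfolding fact_Suc by (simp del: of_nat_Suc)
      then show ?thesis by (subst sum.atMost_Suc_shift) (simp del: of_nat_Suc fact_Suc funpow.simps)
    qed
    finally show "((\<lambda>x. f x - (\<Sum>k\<le>Suc (Suc m). (deriv ^^ k) f 0 / fact k * x ^ k))
        has_real_derivative deriv f x - (\<Sum>k\<le>Suc m. (deriv ^^ Suc k) f 0 / fact k * x ^ k)) (at x)"
      using f by (intro DERIV_diff)
  next
    have "(\<Sum>k\<le>Suc (Suc m). (deriv ^^ k) f 0 / fact k * 0 ^ k) = f 0"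
      by (subst sum.atMost_Suc_shift) simp
    then show "f 0 - (\<Sum>k\<le>Suc (Suc m). (deriv ^^ k) f 0 / fact k * 0 ^ k) = 0" by simp
  qed
qed

text \<open>Averaging the Taylor expansion over \<open>x\<close> and \<open>- x\<close> removes the odd orders.\<close>

lemma even_taylor:
  assumes "F 0 = 0" and "differentiable_near_zero 5 (even_ext F)"
    and "(deriv ^^ 5) (even_ext F) differentiable (at 0)"
  defines "\<rho> \<equiv> \<lambda>r. F r - (tau F 2 * r ^ 2 + tau F 4 * r ^ 4 + tau F 6 * r ^ 6)"
  assumes "0 < e"
  shows "\<exists>\<delta>>0. \<forall>r. 0 \<le> r \<and> r < \<delta> \<longrightarrow> \<bar>\<rho> r\<bar> \<le> e * r ^ 6"
proof -
  define T where "T x = (\<Sum>k\<le>6. (deriv ^^ k) (even_ext F) 0 / fact k * x ^ k)" for x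
  have "(\<lambda>x. even_ext F x - T x) \<in> o[at 0](\<lambda>x. x ^ 6)"
    using taylor_peano[OF assms(2,3)] unfolding T_def by (simp add: numeral_eq_Suc)
  from landau_o.smallD[OF this \<open>0 < e\<close>] obtain \<delta> where \<delta>: "0 < \<delta>"
    and bd: "\<And>x. x \<noteq> 0 \<Longrightarrow> \<bar>x\<bar> < \<delta> \<Longrightarrow> \<bar>even_ext F x - T x\<bar> \<le> e * \<bar>x ^ 6\<bar>"
    by (auto simp: eventually_at dist_real_def)
  have "\<bar>\<rho> r\<bar> \<le> e * r ^ 6" if r: "0 \<le> r" "r < \<delta>" for r
  proof (cases "r = 0")
    case False
    have "\<rho> r = ((even_ext F r - T r) + (even_ext F (- r) - T (- r))) / 2"
      using r \<open>F 0 = 0\<close>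
      by (simp add: \<rho>_def T_def tau_def even_ext_def numeral_eq_Suc field_simps)
    moreover have "\<bar>even_ext F r - T r\<bar> \<le> e * r ^ 6" "\<bar>even_ext F (- r) - T (- r)\<bar> \<le> e * r ^ 6"
      using bd[of r] bd[of "- r"] r False by auto
    ultimately show ?thesis unfolding abs_le_iff by (simp add: field_simps)
  qed (use \<open>F 0 = 0\<close> in \<open>simp add: \<rho>_def\<close>)
  with \<delta> show ?thesis by blast
qed

section \<open>Mean-square properties of stationary isotropic fields\<close>

lemma integrable_prod_of_squares:
  fixes f g :: "'a \<Rightarrow> real"
  assumes [measurable]: "f \<in> borel_measurable M" "g \<in> borel_measurable M"
    and "integrable M (\<lambda>x. (f x)\<^sup>2)" "integrable M (\<lambda>x. (g x)\<^sup>2)"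
  shows "integrable M (\<lambda>x. f x * g x)"
proof (rule Bochner_Integration.integrable_bound)
  show "integrable M (\<lambda>x. (f x)\<^sup>2 + (g x)\<^sup>2)" using assms by simp
  have "\<bar>a * b\<bar> \<le> a\<^sup>2 + b\<^sup>2" for a b :: real
    using sum_squares_bound[of "\<bar>a\<bar>" "\<bar>b\<bar>"] mult_nonneg_nonneg[of "\<bar>a\<bar>" "\<bar>b\<bar>"]
    unfolding abs_mult power2_abs by linarith
  then show "AE x in M. norm (f x * g x) \<le> norm ((f x)\<^sup>2 + (g x)\<^sup>2)" by simp
qed simp

lemma stationary_increment_integrable:
  assumes "stationary_isotropic_field N X"
  shows "integrable N (\<lambda>w. (X p w - X q w)\<^sup>2)"
proof -
  have "integrable N (\<lambda>w. (X p w)\<^sup>2 - 2 * (X p w * X q w) + (X q w)\<^sup>2)"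
    using assms integrable_prod_of_squares[of "X p" N "X q"]
    unfolding stationary_isotropic_field_def by simp
  then show ?thesis by (simp add: power2_diff algebra_simps)
qed

text \<open>Stationarity makes the second moment of the field a constant C 0, and (a - b)^2 \<le> 2
  a^2 + 2 b^2 then bounds F by 2 C 0. The bound provides integrability later, and it excludes
  quadratic growth of F in the degenerate case.\<close>

lemma semivariogram_bounded:
  fixes X :: "real ^ 'd \<Rightarrow> 'w \<Rightarrow> real"
  assumes st: "stationary_isotropic_field N X" and sv: "is_semivariogram N X F"
  shows "\<exists>C. \<forall>p q :: real ^ 'd. 0 \<le> F (dist p q) \<and> F (dist p q) \<le> C"
proof -
  obtain C where C: "(\<integral>w. X p w * X q w \<partial>N) = C (dist p q)" for p q
    using st unfolding stationary_isotropic_field_def by blast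
  have sq: "integrable N (\<lambda>w. (X p w)\<^sup>2)" for p
    using st unfolding stationary_isotropic_field_def by blast
  have "0 \<le> F (dist p q) \<and> F (dist p q) \<le> 2 * C 0" for p q :: "real ^ 'd"
  proof -
    have "(\<integral>w. (X p w - X q w)\<^sup>2 \<partial>N) \<le> (\<integral>w. 2 * (X p w)\<^sup>2 + 2 * (X q w)\<^sup>2 \<partial>N)"
    proof (intro integral_mono)
      have "(a - b)\<^sup>2 \<le> 2 * a\<^sup>2 + 2 * b\<^sup>2" for a b :: real
        using zero_le_power2[of "a + b"] by (simp add: power2_eq_square algebra_simps)
      then show "(X p w - X q w)\<^sup>2 \<le> 2 * (X p w)\<^sup>2 + 2 * (X q w)\<^sup>2" for w .
    qed (use sq stationary_increment_integrable[OF st] in auto)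
    also have "\<dots> = 4 * C 0" using sq C[of p p] C[of q q] by (simp add: power2_eq_square)
    finally have "(\<integral>w. (X p w - X q w)\<^sup>2 \<partial>N) \<le> 4 * C 0" .
    moreover have "0 \<le> (\<integral>w. (X p w - X q w)\<^sup>2 \<partial>N)" by simp
    ultimately show ?thesis using sv[unfolded is_semivariogram_def, rule_format, of p q] by linarith
  qed
  then show ?thesis by blast
qed

text \<open>
  The second differences of the field along a line have mean square \<open>8 F T - 2 F (2 T)\<close>, and a second
  difference at lag \<open>2 T\<close> is a combination of second differences at lag \<open>T\<close>.
\<close>

lemma semivariogram_second_difference:
  fixes X :: "real ^ 'd \<Rightarrow> 'w \<Rightarrow> real"
  assumes st: "stationary_isotropic_field N X" and sv: "is_semivariogram N X F" and T: "0 \<le> T"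
  shows "0 \<le> 8 * F T - 2 * F (2 * T)"
    and "8 * F (2 * T) - 2 * F (2 * (2 * T)) \<le> 16 * (8 * F T - 2 * F (2 * T))"
proof -
  \<comment> \<open>Equally spaced points on a coordinate axis. The points 0 to 4 are used, and only
    through F at the lags T, 2 T and 4 T.\<close>
  define x where "x k = X ((real k * T) *\<^sub>R axis undefined 1)" for k
  have D: "dist ((real k * T) *\<^sub>R axis undefined 1 :: real ^ 'd) ((real l * T) *\<^sub>R axis undefined 1)
      = \<bar>real k - real l\<bar> * T" for k l
    using T by (simp add: dist_norm scaleR_left_diff_distrib[symmetric] left_diff_distrib[symmetric]
        abs_mult norm_axis_1)
  have I: "(\<integral>w. (x k w - x l w)\<^sup>2 \<partial>N) = 2 * F (\<bar>real k - real l\<bar> * T)" for k l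
    using sv[unfolded is_semivariogram_def, rule_format,
        of "(real k * T) *\<^sub>R axis undefined 1" "(real l * T) *\<^sub>R axis undefined 1"]
    unfolding x_def D by simp
  have int: "integrable N (\<lambda>w. (x k w - x l w)\<^sup>2)" for k l
    unfolding x_def by (rule stationary_increment_integrable[OF st])
  \<comment> \<open>The parallelogram law writes a squared second difference through squared
    increments, whose means are the values of the semivariogram.\<close>
  have "0 \<le> (\<integral>w. (x 2 w - 2 * x 1 w + x 0 w)\<^sup>2 \<partial>N)" by simp
  also have "\<dots> = (\<integral>w. 2 * (x 2 w - x 1 w)\<^sup>2 + 2 * (x 1 w - x 0 w)\<^sup>2 - (x 2 w - x 0 w)\<^sup>2 \<partial>N)"
    by (rule Bochner_Integration.integral_cong) (auto simp: power2_eq_square algebra_simps)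
  also have "\<dots> = 8 * F T - 2 * F (2 * T)"
    using int by (simp add: I)
  finally show "0 \<le> 8 * F T - 2 * F (2 * T)" .
  have "(\<integral>w. 2 * (x 4 w - x 2 w)\<^sup>2 + 2 * (x 2 w - x 0 w)\<^sup>2 - (x 4 w - x 0 w)\<^sup>2 \<partial>N)
      \<le> (\<integral>w. 4 * ((2 * (x 4 w - x 3 w)\<^sup>2 + 2 * (x 3 w - x 2 w)\<^sup>2 - (x 4 w - x 2 w)\<^sup>2)
          + 2 * (2 * (x 3 w - x 2 w)\<^sup>2 + 2 * (x 2 w - x 1 w)\<^sup>2 - (x 3 w - x 1 w)\<^sup>2)
          + (2 * (x 2 w - x 1 w)\<^sup>2 + 2 * (x 1 w - x 0 w)\<^sup>2 - (x 2 w - x 0 w)\<^sup>2)) \<partial>N)"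
  proof (intro integral_mono)
    have par: "2 * (a - b)\<^sup>2 + 2 * (b - c)\<^sup>2 - (a - c)\<^sup>2 = (a - 2 * b + c)\<^sup>2" for a b c :: real
      by (simp add: power2_eq_square algebra_simps)
    \<comment> \<open>The second difference at lag 2 T is u + 2 v + w for three consecutive second
      differences at lag T. Cauchy-Schwarz with weights 1, 2, 1 gives the factor 4, and the weights
      sum to another 4 because the three have equal mean square: together 16.\<close>
    have tri: "(u + 2 * v + w)\<^sup>2 \<le> 4 * (u\<^sup>2 + 2 * v\<^sup>2 + w\<^sup>2)" for u v w :: real
      using zero_le_power2[of "u - v"] zero_le_power2[of "u - w"] zero_le_power2[of "v - w"]
      by (simp add: power2_eq_square algebra_simps)
    show "2 * (x 4 w - x 2 w)\<^sup>2 + 2 * (x 2 w - x 0 w)\<^sup>2 - (x 4 w - x 0 w)\<^sup>2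
        \<le> 4 * ((2 * (x 4 w - x 3 w)\<^sup>2 + 2 * (x 3 w - x 2 w)\<^sup>2 - (x 4 w - x 2 w)\<^sup>2)
          + 2 * (2 * (x 3 w - x 2 w)\<^sup>2 + 2 * (x 2 w - x 1 w)\<^sup>2 - (x 3 w - x 1 w)\<^sup>2)
          + (2 * (x 2 w - x 1 w)\<^sup>2 + 2 * (x 1 w - x 0 w)\<^sup>2 - (x 2 w - x 0 w)\<^sup>2))" for w
      unfolding par
      using tri[of "x 4 w - 2 * x 3 w + x 2 w" "x 3 w - 2 * x 2 w + x 1 w" "x 2 w - 2 * x 1 w + x 0 w"]
      by (simp add: algebra_simps)
  qed (use int in auto)
  then show "8 * F (2 * T) - 2 * F (2 * (2 * T)) \<le> 16 * (8 * F T - 2 * F (2 * T))"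
    using int by (simp add: I)
qed

text \<open>
  A field whose fourth-order coefficient vanishes has mean-square second differences of order
  \<open>o(T\<^sup>4)\<close>, hence zero; so it is affine along lines, and being bounded it is constant.
\<close>

lemma semivariogram_degenerate:
  fixes X :: "real ^ 'd \<Rightarrow> 'w \<Rightarrow> real"
  assumes st: "stationary_isotropic_field N X" and sv: "is_semivariogram N X F"
    and "0 < \<delta>" and exp: "\<And>r. 0 \<le> r \<Longrightarrow> r < \<delta> \<Longrightarrow> \<bar>F r - \<alpha> * r ^ 2\<bar> \<le> C * r ^ 6"
    and "0 \<le> T"
  shows "F T = 0"
proof -
  define D where "D T = 8 * F T - 2 * F (2 * T)" for T
  note D = semivariogram_second_difference[OF st sv, folded D_def]
  have "D T = 0" if "0 \<le> T" for T
  proof (rule ccontr)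
    assume "D T \<noteq> 0"
    then have pos: "0 < D T" using D(1)[OF that] by linarith
    \<comment> \<open>Halving the lag costs at most the factor 16 = 2^4, while a bound of sixth
      order gains 64. The net factor 1/4 per halving forces \<open>D T\<close> to vanish.\<close>
    have iter: "D T \<le> 16 ^ k * D (T / 2 ^ k)" for k
    proof (induction k)
      case (Suc k)
      have "D (T / 2 ^ k) \<le> 16 * D (T / 2 ^ Suc k)"
        using D(2)[of "T / 2 ^ Suc k"] that by simp
      then have "16 ^ k * D (T / 2 ^ k) \<le> 16 ^ Suc k * D (T / 2 ^ Suc k)" by simp
      with Suc show ?case by linarith
    qed simp
    have "(\<lambda>k. T * (1 / 2) ^ k) \<longlonglongrightarrow> T * 0" by (intro tendsto_intros LIMSEQ_realpow_zero) auto
    then have "\<forall>\<^sub>F k in sequentially. T * (1 / 2) ^ k < \<delta> / 2"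
      by (rule order_tendstoD) (use \<open>0 < \<delta>\<close> in auto)
    then have small: "\<forall>\<^sub>F k in sequentially. T / 2 ^ k < \<delta> / 2"
      by (simp add: power_one_over)
    have "\<forall>\<^sub>F k in sequentially. D T \<le> 136 * C * T ^ 6 * (1 / 4) ^ k"
    proof (rule eventually_mono[OF small])
      fix k assume k: "T / 2 ^ k < \<delta> / 2"
      define t where "t = T / 2 ^ k"
      have t0: "0 \<le> t" unfolding t_def using that by simp
      then have t: "0 \<le> t" "t < \<delta>" "2 * t < \<delta>" using k[folded t_def] by linarith+
      have "\<bar>F t - \<alpha> * t ^ 2\<bar> \<le> C * t ^ 6" "\<bar>F (2 * t) - \<alpha> * (2 * t) ^ 2\<bar> \<le> C * (2 * t) ^ 6"
        using exp[of t] exp[of "2 * t"] t by auto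
      then have "\<bar>F t - \<alpha> * t ^ 2\<bar> \<le> C * t ^ 6" "\<bar>F (2 * t) - 4 * (\<alpha> * t ^ 2)\<bar> \<le> 64 * (C * t ^ 6)"
        by (simp_all add: power_mult_distrib mult_ac)
      \<comment> \<open>The quadratic terms cancel, since 8 \<alpha> t^2 = 2 \<alpha> (2 t)^2, and
        136 = 8 + 2 * 64.\<close>
      then have "D t \<le> 136 * (C * t ^ 6)" unfolding D_def by linarith
      then have "16 ^ k * D t \<le> 16 ^ k * (136 * (C * t ^ 6))" by simp
      also have "\<dots> = 136 * C * T ^ 6 * (16 ^ k / (2 ^ k) ^ 6)" by (simp add: t_def power_divide)
      also have "(16 ^ k / (2 ^ k) ^ 6 :: real) = (16 / 2 ^ 6) ^ k"
        unfolding power_mult[symmetric] power_divide by (simp add: mult.commute power_mult)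
      also have "\<dots> = (1 / 4) ^ k" by simp
      finally show "D T \<le> 136 * C * T ^ 6 * (1 / 4) ^ k" using iter[of k] unfolding t_def by linarith
    qed
    moreover have "(\<lambda>k. 136 * C * T ^ 6 * (1 / 4) ^ k) \<longlonglongrightarrow> 136 * C * T ^ 6 * 0"
      by (intro tendsto_intros LIMSEQ_realpow_zero) auto
    ultimately have "D T \<le> 0"
      by (intro tendsto_le[OF _ _ tendsto_const]) auto
    with pos show False by simp
  qed
  then have double: "F (2 * T) = 4 * F T" if "0 \<le> T" for T
    using that unfolding D_def by fastforce
  \<comment> \<open>Along powers of two F grows like the square of the lag, which a bounded F can do
    only from the value zero.\<close>
  have "F T * 4 ^ k = F (T * 2 ^ k)" for k
  proof (induction k)
    case (Suc k)
    have "F (T * 2 ^ Suc k) = 4 * F (T * 2 ^ k)"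
      using double[of "T * 2 ^ k"] \<open>0 \<le> T\<close> by (simp add: mult_ac)
    with Suc show ?case by simp
  qed simp
  moreover obtain B where B: "0 \<le> F (dist p q)" "F (dist p q) \<le> B" for p q :: "real ^ 'd"
    using semivariogram_bounded[OF st sv] by blast
  have "0 \<le> F r \<and> F r \<le> B" if "0 \<le> r" for r
    using B[of "r *\<^sub>R axis undefined 1" 0] that by (simp add: norm_axis_1)
  ultimately have bd: "0 \<le> F T" "F T * 4 ^ k \<le> B" for k using \<open>0 \<le> T\<close> by auto
  have "F T \<le> B * (1 / 4) ^ k" for k
    using bd(2)[of k] by (simp add: power_one_over field_simps)
  moreover have "(\<lambda>k. B * (1 / 4) ^ k) \<longlonglongrightarrow> B * 0"
    by (intro tendsto_intros LIMSEQ_realpow_zero) auto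
  ultimately have "F T \<le> 0"
    by (intro tendsto_le[OF _ _ tendsto_const]) auto
  with bd(1) show "F T = 0" by simp
qed

section \<open>Kernel averages\<close>

lemma finite_pairs: "finite {(i, j). i < n \<and> j < n \<and> i \<noteq> (j :: nat)}"
  by (rule finite_subset[of _ "{..<n} \<times> {..<n}"]) auto

lemma kavg_add: "kavg K n s h (\<lambda>i j. A i j + B i j) = kavg K n s h A + kavg K n s h B"
  by (simp add: kavg_def kweight_def case_prod_unfold distrib_left sum.distrib add_divide_distrib)

lemma kavg_cmult: "kavg K n s h (\<lambda>i j. c * A i j) = c * kavg K n s h A"
  by (simp add: kavg_def kweight_def case_prod_unfold sum_distrib_left mult.left_commute)

lemma kernel_nonneg: "is_kernel K R \<Longrightarrow> 0 \<le> r \<Longrightarrow> 0 \<le> K r"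
  unfolding is_kernel_def by (metis less_eq_real_def linorder_neqE_linordered_idom)

lemma kernel_support: "is_kernel K R \<Longrightarrow> K r \<noteq> 0 \<Longrightarrow> r \<le> R"
  unfolding is_kernel_def by (meson not_le)

text \<open>Pairs farther apart than R h carry no weight. This locality is what converts the
  behaviour of F near zero into bounds on kernel averages.\<close>

lemma kweight_mono:
  assumes K: "is_kernel K R" and "0 < h"
    and le: "\<And>i j. i < n \<Longrightarrow> j < n \<Longrightarrow> dist (s i) (s j) \<le> R * h \<Longrightarrow> A i j \<le> B i j"
  shows "kweight K n s h A \<le> kweight K n s h B"
  unfolding kweight_def
proof (intro sum_mono, clarify)
  fix i j assume ij: "i < n" "j < n"
  show "K (dist (s i) (s j) / h) * A i j \<le> K (dist (s i) (s j) / h) * B i j"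
  proof (cases "K (dist (s i) (s j) / h) = 0")
    case False
    then have "dist (s i) (s j) \<le> R * h"
      using kernel_support[OF K False] \<open>0 < h\<close> by (simp add: divide_le_eq)
    then show ?thesis using le ij kernel_nonneg[OF K] \<open>0 < h\<close> by (intro mult_left_mono) auto
  qed simp
qed

lemma kweight_nonneg:
  assumes "is_kernel K R" "0 < h"
  shows "0 \<le> kweight K n s h (\<lambda>_ _. 1)"
  using kweight_mono[OF assms, of n s "\<lambda>_ _. 0" "\<lambda>_ _. 1"] by (simp add: kweight_def)

lemma kavg_mono:
  assumes "is_kernel K R" "0 < h"
    and "\<And>i j. i < n \<Longrightarrow> j < n \<Longrightarrow> dist (s i) (s j) \<le> R * h \<Longrightarrow> A i j \<le> B i j"
  shows "kavg K n s h A \<le> kavg K n s h B"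
  unfolding kavg_def
  by (intro divide_right_mono kweight_mono[OF assms(1,2)] kweight_nonneg[OF assms(1,2)] assms(3))

lemma kavg_const: "0 < kweight K n s h (\<lambda>_ _. 1) \<Longrightarrow> kavg K n s h (\<lambda>_ _. c) = c"
  using kavg_cmult[of K n s h c "\<lambda>_ _. 1"] by (simp add: kavg_def)

text \<open>If the total weight vanishes, the average is zero because \<open>x / 0 = 0\<close>.\<close>

lemma kavg_abs_le:
  assumes K: "is_kernel K R" "0 < h" and "0 \<le> C"
    and le: "\<And>i j. i < n \<Longrightarrow> j < n \<Longrightarrow> dist (s i) (s j) \<le> R * h \<Longrightarrow> \<bar>A i j\<bar> \<le> C"
  shows "\<bar>kavg K n s h A\<bar> \<le> C"
proof (cases "kweight K n s h (\<lambda>_ _. 1) = 0")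
  case False
  then have pos: "0 < kweight K n s h (\<lambda>_ _. 1)" using kweight_nonneg[OF K, of n s] by linarith
  have "kavg K n s h A \<le> C"
    using kavg_mono[OF K, of n s A "\<lambda>_ _. C"] le kavg_const[OF pos, of C] by (fastforce simp: abs_le_iff)
  moreover have "- C \<le> kavg K n s h A"
    using kavg_mono[OF K, of n s "\<lambda>_ _. - C" A] le kavg_const[OF pos, of "- C"]
    by (fastforce simp: abs_le_iff)
  ultimately show ?thesis by simp
qed (use \<open>0 \<le> C\<close> in \<open>simp add: kavg_def\<close>)

lemma lag_mom_bounds:
  assumes K: "is_kernel K R" and "0 < h"
  shows "0 \<le> lag_mom K n s p h" "lag_mom K n s p h \<le> (R * h) ^ p"
proof -
  have "0 < R" using K by (simp add: is_kernel_def)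
  then have "\<bar>lag_mom K n s p h\<bar> \<le> (R * h) ^ p"
    unfolding lag_mom_def using assms by (intro kavg_abs_le[of K R]) (auto intro: power_mono)
  then show "lag_mom K n s p h \<le> (R * h) ^ p" by simp
  show "0 \<le> lag_mom K n s p h"
    using kavg_mono[OF assms, of n s "\<lambda>_ _. 0" "\<lambda>i j. dist (s i) (s j) ^ p"] kavg_cmult[of K n s h 0]
    by (simp add: lag_mom_def)
qed

text \<open>Jensen's inequality: with m the second lag moment, the average of (s^2 - m)^2 is
  nonnegative. Positive total weight is what makes the average of a constant equal to it. The
  purpose is to bound the fourth moment, and through it the target, from below by the second
  moment.\<close>

lemma lag_mom_square_le:
  assumes K: "is_kernel K R" "0 < h" and pos: "0 < kweight K n s h (\<lambda>_ _. 1)"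
  shows "(lag_mom K n s 2 h)\<^sup>2 \<le> lag_mom K n s 4 h"
proof -
  define m where "m = lag_mom K n s 2 h"
  have "0 \<le> kavg K n s h (\<lambda>i j. dist (s i) (s j) ^ 4 + ((- 2 * m) * dist (s i) (s j) ^ 2 + m\<^sup>2))"
  proof -
    have "0 \<le> (x\<^sup>2 - m)\<^sup>2" for x by simp
    also have "(x\<^sup>2 - m)\<^sup>2 = x ^ 4 + ((- 2 * m) * x ^ 2 + m\<^sup>2)" for x
      by (simp add: power2_eq_square power4_eq_xxxx algebra_simps)
    finally show ?thesis
      using kavg_mono[OF K, of n s "\<lambda>_ _. 0"] kavg_const[OF pos, of 0] by simp
  qed
  also have "\<dots> = lag_mom K n s 4 h - 2 * m * m + m\<^sup>2"
    unfolding kavg_add kavg_cmult kavg_const[OF pos] lag_mom_def m_def by simp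
  finally show ?thesis by (simp add: m_def power2_eq_square)
qed

lemma step2_bounds:
  assumes "is_kernel K R" "0 < h"
  shows "0 \<le> step2 K n s h" "step2 K n s h \<le> R * h" "step2 K n s h ^ 4 = lag_mom K n s 4 h"
proof -
  have "0 < R" using assms(1) by (simp add: is_kernel_def)
  note L = lag_mom_bounds[OF assms, of n s 4]
  show "0 \<le> step2 K n s h" "step2 K n s h ^ 4 = lag_mom K n s 4 h"
    using L by (auto simp: step2_def)
  have "step2 K n s h \<le> root 4 ((R * h) ^ 4)" unfolding step2_def using L by simp
  also have "\<dots> = R * h" using \<open>0 < R\<close> \<open>0 < h\<close> by (simp add: real_root_power_cancel)
  finally show "step2 K n s h \<le> R * h" .
qed

text \<open>With the positions fixed, twice the sample constraint is a linear functional of the pair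
  function \<open>A\<close>. Squared increments, values of F at the lags and powers of the lags are
  all fed into it.\<close>

definition curv ::
  "(real \<Rightarrow> real) \<Rightarrow> nat \<Rightarrow> (nat \<Rightarrow> real ^ 'd) \<Rightarrow> real \<Rightarrow> (nat \<Rightarrow> nat \<Rightarrow> real) \<Rightarrow> real" where
  "curv K n s h A = cd2 CARD('d) * mu1 K n s h * kavg K n s h A
     - cd3 CARD('d) * mu2 K n s h * kavg K n s (sqrt 2 * h) A - cd1 CARD('d) * kavg K n s (2 * h) A"

lemma phi2_bar_eq_curv: "phi2_bar K n s x h = 1 / 2 * curv K n s h (\<lambda>i j. (x i - x j)\<^sup>2)"
  by (simp add: phi2_bar_def curv_def sq_incr_def Let_def)

lemma curv_add: "curv K n s h (\<lambda>i j. A i j + B i j) = curv K n s h A + curv K n s h B"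
  by (simp add: curv_def kavg_add algebra_simps)

lemma curv_cmult: "curv K n s h (\<lambda>i j. c * A i j) = c * curv K n s h A"
  by (simp add: curv_def kavg_cmult algebra_simps)

text \<open>The definition of \<open>mu1\<close> is the solution of this linear equation. The
  coefficient of a square in \<open>phi2\<close> is zero as well, since cd2 = 2 cd3 + 4 cd1.\<close>

lemma curv_lag2:
  fixes s :: "nat \<Rightarrow> real ^ 'd"
  assumes "lag_mom K n s 2 h \<noteq> 0"
  shows "curv K n s h (\<lambda>i j. dist (s i) (s j) ^ 2) = 0"
proof -
  have "cd2 CARD('d) \<noteq> 0" by (simp add: cd2_def)
  then show ?thesis using assms
    unfolding curv_def lag_mom_def[symmetric] mu1_def Let_def by (simp add: field_simps)
qed

text \<open>With \<open>mu1\<close> eliminated, the value at fourth powers is affine in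
  \<open>mu2\<close>, and \<open>mu2_num / mu2_den\<close> is the root of the resulting equation.
  The right-hand side is the fourth-order coefficient of \<open>phi2\<close> times the fourth lag
  moment, which is \<open>step2 ^ 4\<close>; so estimator and target agree in order four
  configuration by configuration.\<close>

lemma curv_lag4:
  fixes s :: "nat \<Rightarrow> real ^ 'd"
  assumes m2: "lag_mom K n s 2 h \<noteq> 0" and den: "mu2_den K n s h \<noteq> 0"
  shows "curv K n s h (\<lambda>i j. dist (s i) (s j) ^ 4)
    = - (cd2 CARD('d) + 8 * cd1 CARD('d)) * lag_mom K n s 4 h"
proof -
  define M2 M2s M2d M4 M4s M4d where M:
    "M2 = lag_mom K n s 2 h" "M2s = lag_mom K n s 2 (sqrt 2 * h)" "M2d = lag_mom K n s 2 (2 * h)"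
    "M4 = lag_mom K n s 4 h" "M4s = lag_mom K n s 4 (sqrt 2 * h)" "M4d = lag_mom K n s 4 (2 * h)"
  define c1 c2 c3 where c: "c1 = cd1 CARD('d)" "c2 = cd2 CARD('d)" "c3 = cd3 CARD('d)"
  define u where "u = mu2 K n s h"
  have nz: "c2 \<noteq> 0" by (simp add: c cd2_def)
  have M2: "M2 \<noteq> 0" using m2 M by simp
  have "u * mu2_den K n s h = mu2_num K n s h" unfolding u_def mu2_def using den by simp
  then have u: "u * (c3 * M4s - c3 * M4 * (M2s / M2))
      = (c2 + 8 * c1) * M4 + c1 * M4 * (M2d / M2) - c1 * M4d"
    by (simp add: mu2_den_def mu2_num_def Let_def M c)
  have mu1: "c2 * mu1 K n s h = c3 * u * (M2s / M2) + c1 * (M2d / M2)"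
    using nz M2 unfolding mu1_def Let_def M[symmetric] c[symmetric] u_def[symmetric]
    by (simp add: field_simps)
  have "curv K n s h (\<lambda>i j. dist (s i) (s j) ^ 4) = c2 * mu1 K n s h * M4 - c3 * u * M4s - c1 * M4d"
    by (simp add: curv_def lag_mom_def[symmetric] M c u_def)
  also have "\<dots> = - (u * (c3 * M4s - c3 * M4 * (M2s / M2))) + c1 * M4 * (M2d / M2) - c1 * M4d"
    unfolding mu1 by (simp add: algebra_simps)
  also have "\<dots> = - (c2 + 8 * c1) * M4" unfolding u by (simp add: algebra_simps)
  finally show ?thesis by (simp add: M c)
qed

text \<open>A power r^k enters with coefficient cd2 - 2^(k/2) cd3 - 2^k cd1, which for k = 2, 4, 6
  is 0, - (cd2 + 8 cd1) and - 24 d (d + 4).\<close>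

lemma phi2_expansion:
  assumes "0 \<le> a" and exp: "\<And>r. 0 \<le> r \<Longrightarrow> F r = \<alpha> * r ^ 2 + \<beta> * r ^ 4 + \<gamma> * r ^ 6 + \<rho> r"
  shows "phi2 d F a = - (cd2 d + 8 * cd1 d) * \<beta> * a ^ 4 - 24 * real d * (real d + 4) * \<gamma> * a ^ 6
    + phi2 d \<rho> a"
proof -
  have s: "(sqrt 2 * a) ^ 2 = 2 * a ^ 2" "(sqrt 2 * a) ^ 4 = 4 * a ^ 4" "(sqrt 2 * a) ^ 6 = 8 * a ^ 6"
    using power_mult[of "sqrt 2" 2 2] power_mult[of "sqrt 2" 2 3] by (simp_all add: power_mult_distrib)
  show ?thesis
    unfolding phi2_def using exp[of a] exp[of "sqrt 2 * a"] exp[of "2 * a"] \<open>0 \<le> a\<close>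
    unfolding s by (simp add: cd1_def cd2_def cd3_def power2_eq_square power_mult_distrib algebra_simps)
qed

text \<open>The error given the positions: averaging over the field replaces each squared increment
  by twice F, and the factor 1/2 of \<open>phi2_bar\<close> removes the two.\<close>

definition curv_err :: "(real \<Rightarrow> real) \<Rightarrow> nat \<Rightarrow> (nat \<Rightarrow> real ^ 'd) \<Rightarrow> real \<Rightarrow> (real \<Rightarrow> real) \<Rightarrow> real" where
  "curv_err K n s h F = curv K n s h (\<lambda>i j. F (dist (s i) (s j))) - phi2 CARD('d) F (step2 K n s h)"

text \<open>
  The weights \<open>\<mu>\<^sub>1\<close>, \<open>\<mu>\<^sub>2\<close> are designed to annihilate the second-order term and to reproduce the
  fourth-order term of \<^const>\<open>phi2\<close> exactly.
\<close>

lemma curv_err_expansion: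
  fixes s :: "nat \<Rightarrow> real ^ 'd"
  assumes "0 \<le> step2 K n s h" "step2 K n s h ^ 4 = lag_mom K n s 4 h"
    and "lag_mom K n s 2 h \<noteq> 0" "mu2_den K n s h \<noteq> 0"
    and exp: "\<And>r. 0 \<le> r \<Longrightarrow> F r = \<alpha> * r ^ 2 + \<beta> * r ^ 4 + \<gamma> * r ^ 6 + \<rho> r"
  shows "curv_err K n s h F = \<gamma> * (curv K n s h (\<lambda>i j. dist (s i) (s j) ^ 6)
      + 24 * real CARD('d) * (real CARD('d) + 4) * step2 K n s h ^ 6) + curv_err K n s h \<rho>"
proof -
  have "curv K n s h (\<lambda>i j. F (dist (s i) (s j))) = curv K n s h (\<lambda>i j. \<alpha> * dist (s i) (s j) ^ 2
      + \<beta> * dist (s i) (s j) ^ 4 + \<gamma> * dist (s i) (s j) ^ 6 + \<rho> (dist (s i) (s j)))"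
    using exp by simp
  moreover have "phi2 CARD('d) F (step2 K n s h) = - (cd2 CARD('d) + 8 * cd1 CARD('d)) * \<beta> * step2 K n s h ^ 4
      - 24 * real CARD('d) * (real CARD('d) + 4) * \<gamma> * step2 K n s h ^ 6 + phi2 CARD('d) \<rho> (step2 K n s h)"
    by (rule phi2_expansion[OF assms(1) exp])
  ultimately show ?thesis
    unfolding curv_err_def curv_add curv_cmult
      curv_lag2[OF assms(3)] curv_lag4[OF assms(3,4)] assms(2)
    by (simp add: algebra_simps)
qed

section \<open>Radial integrals\<close>

lemma lborel_integral_scale:
  fixes f :: "'a :: euclidean_space \<Rightarrow> real"
  assumes [measurable]: "f \<in> borel_measurable borel" and "0 < c"
  shows "(\<integral>x. f (x /\<^sub>R c) \<partial>lborel) = c ^ DIM('a) * (\<integral>x. f x \<partial>lborel)"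
proof -
  have "(\<integral>x. f (x /\<^sub>R c) \<partial>lborel)
      = (\<integral>x. f (x /\<^sub>R c) \<partial>density (distr lborel borel (\<lambda>x :: 'a. 0 + c *\<^sub>R x)) (\<lambda>_. ennreal (c ^ DIM('a))))"
    using lborel_affine[of c "0 :: 'a"] \<open>0 < c\<close> by (simp add: ennreal_power)
  also have "\<dots> = c ^ DIM('a) * (\<integral>x. f x \<partial>lborel)"
    using \<open>0 < c\<close> by (subst integral_real_density) (simp_all add: integral_distr)
  finally show ?thesis .
qed

text \<open>Both measures give \<open>{..a}\<close> the volume of the ball of radius a, the density
  on the right being the derivative of that volume in the radius. The half-lines generate the Borel
  sets, are stable under intersection and have finite mass.\<close>

lemma distr_norm_lborel:
  "distr lborel borel (norm :: 'a :: euclidean_space \<Rightarrow> real)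
    = density lborel (\<lambda>r. ennreal (unit_ball_vol (real DIM('a)) * (real DIM('a) * r ^ (DIM('a) - 1)) * indicator {0..} r))"
    (is "?L = density lborel (\<lambda>r. ennreal (?f r))")
proof (rule measure_eqI_generator_eq[where \<Omega> = UNIV and E = "range atMost" and A = "\<lambda>i. {..real i}"])
  let ?c = "unit_ball_vol (real DIM('a))"
  have [measurable]: "?f \<in> borel_measurable borel" by measurable
  have L: "emeasure ?L {..a} = (if 0 \<le> a then ennreal (?c * a ^ DIM('a)) else 0)" for a
  proof -
    have "norm -` {..a} = cball (0 :: 'a) a" by auto
    then show ?thesis by (auto simp: emeasure_distr emeasure_cball)
  qed
  have R: "emeasure (density lborel (\<lambda>r. ennreal (?f r))) {..a}
      = (if 0 \<le> a then ennreal (?c * a ^ DIM('a)) else 0)" for a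
  proof -
    have "emeasure (density lborel (\<lambda>r. ennreal (?f r))) {..a}
        = (\<integral>\<^sup>+r. ennreal (?c * (real DIM('a) * r ^ (DIM('a) - 1))) * indicator {0..a} r \<partial>lborel)"
      by (auto simp: emeasure_density intro!: nn_integral_cong split: split_indicator)
    also have "\<dots> = (if 0 \<le> a then ennreal (?c * a ^ DIM('a)) else 0)"
    proof (cases "0 \<le> a")
      case True
      have "(\<integral>\<^sup>+r. ennreal (?c * (real DIM('a) * r ^ (DIM('a) - 1))) * indicator {0..a} r \<partial>lborel)
          = ennreal (?c * a ^ DIM('a) - ?c * 0 ^ DIM('a))"
        by (rule nn_integral_FTC_Icc)
          (use True in \<open>auto intro!: derivative_eq_intros simp: unit_ball_vol_nonneg\<close>)
      then show ?thesis using True by (simp add: power_0_left)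
    qed simp
    finally show ?thesis .
  qed
  show "Int_stable (range atMost :: real set set)"
    by (auto simp: Int_stable_def)
  show "emeasure ?L X = emeasure (density lborel (\<lambda>r. ennreal (?f r))) X" if "X \<in> range atMost" for X
    using that L R by auto
  show "sets ?L = sigma_sets UNIV (range atMost)"
    "sets (density lborel (\<lambda>r. ennreal (?f r))) = sigma_sets UNIV (range atMost)"
    by (simp_all add: borel_eq_atMost)
  show "(\<Union>i. {..real i}) = UNIV" by (auto intro: real_arch_simple)
  show "emeasure ?L {..real i} \<noteq> \<infinity>" for i unfolding L by auto
qed auto

lemma lborel_integral_radial:
  assumes [measurable]: "G \<in> borel_measurable borel"
  shows "(\<integral>x. G (norm x) \<partial>(lborel :: 'a :: euclidean_space measure))
    = unit_ball_vol (real DIM('a)) * real DIM('a) * (LBINT r:{0..}. r ^ (DIM('a) - 1) * G r)"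
proof -
  have "(\<integral>x. G (norm x) \<partial>(lborel :: 'a measure)) = (\<integral>r. G r \<partial>distr lborel borel (norm :: 'a \<Rightarrow> real))"
    by (subst integral_distr) auto
  also have "\<dots> = (\<integral>r. unit_ball_vol (real DIM('a)) * (real DIM('a) * r ^ (DIM('a) - 1)) * indicator {0..} r * G r \<partial>lborel)"
    unfolding distr_norm_lborel
    by (subst integral_real_density) (auto simp: unit_ball_vol_nonneg split: split_indicator)
  also have "\<dots> = unit_ball_vol (real DIM('a)) * real DIM('a) * (LBINT r:{0..}. r ^ (DIM('a) - 1) * G r)"
    unfolding set_lebesgue_integral_def integral_mult_right_zero[symmetric]
    by (intro Bochner_Integration.integral_cong) (auto split: split_indicator)
  finally show ?thesis .
qed

text \<open>The summand of a lag moment with the lag measured in units of h; \<open>b\<close> is the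
  bandwidth divided by h, that is 1, \<open>sqrt 2\<close> or 2, and p = 0 gives the total
  weight.\<close>

definition lag_kernel :: "(real \<Rightarrow> real) \<Rightarrow> real \<Rightarrow> nat \<Rightarrow> real ^ 'd \<Rightarrow> real" where
  "lag_kernel K b p x = K (norm x / b) * norm x ^ p"

text \<open>Dividing by the case p = 0 cancels the surface constant and b^d and leaves
  \<open>b ^ p * Bmom K R d p\<close>, the limit of the normalised lag moments.\<close>

lemma lag_kernel_integral:
  fixes K :: "real \<Rightarrow> real"
  assumes K: "is_kernel K R" and "0 < b"
  shows "(\<integral>x. lag_kernel K b p (x :: real ^ 'd) \<partial>lborel)
    = unit_ball_vol (real CARD('d)) * real CARD('d) * (b ^ (CARD('d) + p) * kmom K R (CARD('d) + p))"
proof -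
  have [measurable]: "K \<in> borel_measurable borel" using K by (simp add: is_kernel_def)
  have "(\<integral>x. lag_kernel K b p (x :: real ^ 'd) \<partial>lborel)
      = (\<integral>x. b ^ p * (K (norm (x /\<^sub>R b)) * norm (x /\<^sub>R b) ^ p) \<partial>(lborel :: (real ^ 'd) measure))"
    using \<open>0 < b\<close> by (simp add: lag_kernel_def power_mult_distrib field_simps)
  also have "\<dots> = b ^ p * (b ^ CARD('d) * (\<integral>x. K (norm x) * norm x ^ p \<partial>(lborel :: (real ^ 'd) measure)))"
    using lborel_integral_scale[of "\<lambda>x :: real ^ 'd. K (norm x) * norm x ^ p" b] \<open>0 < b\<close> by simp
  also have "(\<integral>x. K (norm x) * norm x ^ p \<partial>(lborel :: (real ^ 'd) measure))
      = unit_ball_vol (real CARD('d)) * real CARD('d) * (LBINT r:{0..}. r ^ (CARD('d) - 1) * (K r * r ^ p))"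
    using lborel_integral_radial[of "\<lambda>r. K r * r ^ p", where 'a = "real ^ 'd"] by simp
  also have "(LBINT r:{0..}. r ^ (CARD('d) - 1) * (K r * r ^ p)) = kmom K R (CARD('d) + p)"
  proof -
    have e: "CARD('d) + p - 1 = (CARD('d) - 1) + p" using zero_less_card_finite[where 'a = 'd] by linarith
    have "K r = 0" if "R < r" for r using K that by (simp add: is_kernel_def)
    then show ?thesis
      unfolding kmom_def set_lebesgue_integral_def e power_add
      by (intro Bochner_Integration.integral_cong) (auto split: split_indicator)
  qed
  finally show ?thesis by (simp add: power_add mult_ac)
qed

text \<open>Positivity of the kernel on the open interval suffices: a vanishing integral of a
  nonnegative integrand would make \<open>{0<..<R}\<close> a null set. The argument is
  \<open>Suc j\<close> so that the truncated exponent in \<open>kmom\<close> is exactly j.\<close>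

lemma kmom_pos:
  assumes K: "is_kernel K R"
  shows "0 < kmom K R (Suc j)"
proof -
  have m[measurable]: "K \<in> borel_measurable borel" and R: "0 < R" using K by (simp_all add: is_kernel_def)
  obtain M where M: "\<And>s. \<bar>K s\<bar> \<le> M" using K by (auto simp: is_kernel_def bounded_iff)
  have nn: "0 \<le> K s" if "0 \<le> s" for s
    using K that by (rule kernel_nonneg)
  define u where "u s = indicator {0..R} s *\<^sub>R (s ^ j * K s)" for s
  have int: "integrable lborel u"
    unfolding u_def
  proof (rule Bochner_Integration.integrable_bound)
    show "integrable lborel (\<lambda>s. R ^ j * M * indicator {0..R} s)"
      using R by (intro integrable_mult_right) (simp add: integrable_indicator_iff)
    show "AE s in lborel. norm (indicator {0..R} s *\<^sub>R (s ^ j * K s)) \<le> norm (R ^ j * M * indicator {0..R} s)"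
      using M R by (auto split: split_indicator simp: abs_mult power_abs intro!: mult_mono power_mono order_trans[OF M abs_ge_self])
  qed measurable
  have nnu: "0 \<le> u s" for s using nn by (auto simp: u_def split: split_indicator)
  have "integral\<^sup>L lborel u \<noteq> 0"
  proof
    assume "integral\<^sup>L lborel u = 0"
    then have "AE s in lborel. u s = 0" using integral_nonneg_eq_0_iff_AE[OF int] nnu by simp
    then have "AE s in lborel. s \<notin> {0<..<R}"
    proof eventually_elim
      case (elim s)
      have "0 < K s" if "0 < s" "s < R" using K that by (simp add: is_kernel_def)
      then show ?case using elim by (auto simp: u_def)
    qed
    then have "emeasure lborel {0<..<R} = 0"
      by (subst (asm) AE_iff_measurable[where N = "{0<..<R}"]) auto
    then show False using R by simp
  qed
  moreover have "0 \<le> integral\<^sup>L lborel u" using nnu by simp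
  moreover have "kmom K R (Suc j) = integral\<^sup>L lborel u"
    by (simp add: kmom_def set_lebesgue_integral_def u_def[abs_def])
  ultimately show ?thesis by simp
qed

section \<open>Well-conditioned configurations\<close>

lemma Bmom_pos:
  assumes "is_kernel K R" "0 < d"
  shows "0 < Bmom K R d p"
proof -
  obtain d' where "d = Suc d'" using assms(2) gr0_implies_Suc by blast
  then show ?thesis unfolding Bmom_def using kmom_pos[OF assms(1)] by (simp add: divide_pos_pos)
qed

text \<open>This is where the dimension matters: for d = 1 the constant \<open>cd3\<close> is zero,
  and with it the denominator of \<open>mu2\<close>.\<close>

lemma cd_pos: "2 \<le> d \<Longrightarrow> 0 < cd1 d" "2 \<le> d \<Longrightarrow> 0 < cd2 d" "2 \<le> d \<Longrightarrow> 0 < cd3 d"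
  by (simp_all add: cd1_def cd2_def cd3_def)

text \<open>The support of the kernel bounds a lag moment of order p from above by a multiple of
  h^p, and well-conditioning bounds the two denominators from below by multiples of h^2 and h^4. All
  powers of h cancel, and the constant depends only on the kernel, the dimension and
  \<kappa>.\<close>

lemma weights_bounded:
  fixes K :: "real \<Rightarrow> real"
  assumes K: "is_kernel K R" and d: "2 \<le> CARD('d)" and \<kappa>: "0 < \<kappa>"
  obtains C where "0 < C"
    "\<And>n (s :: nat \<Rightarrow> real ^ 'd) h. 0 < h \<Longrightarrow> well_conditioned \<kappa> K R n s h \<Longrightarrow> \<bar>mu1 K n s h\<bar> \<le> C \<and> \<bar>mu2 K n s h\<bar> \<le> C"
proof -
  define c1 c2 c3 where c: "c1 = cd1 CARD('d)" "c2 = cd2 CARD('d)" "c3 = cd3 CARD('d)"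
  have cp: "0 < c1" "0 < c2" "0 < c3" using cd_pos[OF d] by (simp_all add: c)
  define b2 b4 where b: "b2 = \<kappa> * Bmom K R CARD('d) 2" "b4 = \<kappa> * (2 * c3 * Bmom K R CARD('d) 4)"
  have bp: "0 < b2" "0 < b4" using \<kappa> cp Bmom_pos[OF K, of "CARD('d)"] by (simp_all add: b)
  \<comment> \<open>\<open>b2\<close> and \<open>b4\<close> bound the denominators from below after
    division by h^2 and h^4, \<open>A\<close> bounds the numerator of \<open>mu2\<close> divided by
    h^4, and \<open>C2\<close>, \<open>C1\<close> are the resulting bounds of \<open>mu2\<close> and
    \<open>mu1\<close>.\<close>
  define A where "A = (c2 + 8 * c1) * R ^ 4 + c1 * R ^ 4 * ((2 * R) ^ 2 / b2) + c1 * (2 * R) ^ 4"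
  define C2 where "C2 = A / b4"
  define C1 where "C1 = (c3 * C2 * (sqrt 2 * R) ^ 2 + c1 * (2 * R) ^ 2) / (c2 * b2)"
  have R: "0 < R" using K by (simp add: is_kernel_def)
  have pos: "0 < A" "0 < C2" "0 < C1"
  proof -
    show "0 < A" unfolding A_def using cp bp R by (intro add_pos_pos mult_pos_pos divide_pos_pos) auto
    then show "0 < C2" unfolding C2_def using bp by simp
    then show "0 < C1" unfolding C1_def using cp bp R by (intro divide_pos_pos add_pos_pos mult_pos_pos) auto
  qed
  have "\<bar>mu1 K n s h\<bar> \<le> C1 \<and> \<bar>mu2 K n s h\<bar> \<le> C2"
    if h: "0 < h" and wc: "well_conditioned \<kappa> K R n s h" for n and s :: "nat \<Rightarrow> real ^ 'd" and h
  proof -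
    note lm = lag_mom_bounds[OF K, of _ n s]
    have m2: "b2 * h ^ 2 \<le> lag_mom K n s 2 h" and den: "b4 * h ^ 4 \<le> mu2_den K n s h"
      using wc by (simp_all add: well_conditioned_def Let_def b c mult_ac)
    have h2: "0 < b2 * h ^ 2" "0 < b4 * h ^ 4" using bp h by simp_all
    have ratio: "0 \<le> lag_mom K n s 2 (t * h) / lag_mom K n s 2 h" "lag_mom K n s 2 (t * h) / lag_mom K n s 2 h \<le> (t * R) ^ 2 / b2"
      if "0 < t" for t
    proof -
      have "lag_mom K n s 2 (t * h) / lag_mom K n s 2 h \<le> (R * (t * h)) ^ 2 / (b2 * h ^ 2)"
        by (rule frac_le) (use lm[of "t * h" 2] that h h2 m2 in auto)
      also have "\<dots> = (t * R) ^ 2 / b2" using h by (simp add: power_mult_distrib field_simps)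
      finally show "lag_mom K n s 2 (t * h) / lag_mom K n s 2 h \<le> (t * R) ^ 2 / b2" .
      show "0 \<le> lag_mom K n s 2 (t * h) / lag_mom K n s 2 h" using lm[of "t * h" 2] lm[of h 2] that h by simp
    qed
    have m4: "0 \<le> lag_mom K n s 4 h" "lag_mom K n s 4 h \<le> R ^ 4 * h ^ 4"
      "0 \<le> lag_mom K n s 4 (2 * h)" "lag_mom K n s 4 (2 * h) \<le> (2 * R) ^ 4 * h ^ 4"
      using lm[of h 4] lm[of "2 * h" 4] h by (simp_all add: power_mult_distrib mult_ac)
    have "\<bar>mu2_num K n s h\<bar> \<le> (c2 + 8 * c1) * lag_mom K n s 4 h
        + c1 * lag_mom K n s 4 h * (lag_mom K n s 2 (2 * h) / lag_mom K n s 2 h) + c1 * lag_mom K n s 4 (2 * h)"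
    proof -
      have "0 \<le> (c2 + 8 * c1) * lag_mom K n s 4 h" "0 \<le> c1 * lag_mom K n s 4 (2 * h)"
        "0 \<le> c1 * lag_mom K n s 4 h * (lag_mom K n s 2 (2 * h) / lag_mom K n s 2 h)"
        using m4 cp ratio(1)[of 2] by (auto simp del: times_divide_eq_right intro!: mult_nonneg_nonneg)
      moreover have "\<bar>x + y - z\<bar> \<le> x + y + z" if "0 \<le> x" "0 \<le> z" "0 \<le> y" for x y z :: real using that by linarith
      ultimately show ?thesis unfolding mu2_num_def Let_def c[symmetric] by blast
    qed
    also have "\<dots> \<le> (c2 + 8 * c1) * (R ^ 4 * h ^ 4) + c1 * (R ^ 4 * h ^ 4) * ((2 * R) ^ 2 / b2) + c1 * ((2 * R) ^ 4 * h ^ 4)"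
      using m4 cp ratio[of 2] by (intro add_mono mult_mono mult_left_mono) auto
    also have "\<dots> = A * h ^ 4" by (simp add: A_def algebra_simps)
    finally have num: "\<bar>mu2_num K n s h\<bar> \<le> A * h ^ 4" .
    have "\<bar>mu2 K n s h\<bar> = \<bar>mu2_num K n s h\<bar> / mu2_den K n s h"
      using den h2 by (simp add: mu2_def abs_divide)
    also have "\<dots> \<le> (A * h ^ 4) / (b4 * h ^ 4)" by (rule frac_le) (use num den h2 pos in auto)
    also have "\<dots> = C2" using h by (simp add: C2_def)
    finally have mu2: "\<bar>mu2 K n s h\<bar> \<le> C2" .
    have "\<bar>c3 * mu2 K n s h * (lag_mom K n s 2 (sqrt 2 * h) / lag_mom K n s 2 h)\<bar> \<le> c3 * C2 * ((sqrt 2 * R) ^ 2 / b2)"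
      unfolding abs_mult using mu2 cp ratio[of "sqrt 2"] by (intro mult_mono) auto
    moreover have "\<bar>c1 * (lag_mom K n s 2 (2 * h) / lag_mom K n s 2 h)\<bar> \<le> c1 * ((2 * R) ^ 2 / b2)"
      unfolding abs_mult using cp ratio[of 2] by (intro mult_mono) auto
    ultimately have "\<bar>c3 * mu2 K n s h * (lag_mom K n s 2 (sqrt 2 * h) / lag_mom K n s 2 h)
        + c1 * (lag_mom K n s 2 (2 * h) / lag_mom K n s 2 h)\<bar> \<le> c3 * C2 * ((sqrt 2 * R) ^ 2 / b2) + c1 * ((2 * R) ^ 2 / b2)"
      by linarith
    then have "\<bar>c3 * mu2 K n s h * (lag_mom K n s 2 (sqrt 2 * h) / lag_mom K n s 2 h)
        + c1 * (lag_mom K n s 2 (2 * h) / lag_mom K n s 2 h)\<bar> / c2 \<le> (c3 * C2 * ((sqrt 2 * R) ^ 2 / b2) + c1 * ((2 * R) ^ 2 / b2)) / c2"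
      using cp by (intro divide_right_mono) auto
    moreover have "mu1 K n s h = (c3 * mu2 K n s h * (lag_mom K n s 2 (sqrt 2 * h) / lag_mom K n s 2 h)
        + c1 * (lag_mom K n s 2 (2 * h) / lag_mom K n s 2 h)) / c2"
      by (simp add: mu1_def Let_def c add_divide_distrib mult_ac)
    moreover have "(c3 * C2 * ((sqrt 2 * R) ^ 2 / b2) + c1 * ((2 * R) ^ 2 / b2)) / c2 = C1"
      using cp bp by (simp add: C1_def field_simps)
    ultimately have "\<bar>mu1 K n s h\<bar> \<le> C1" using cp by (simp add: abs_divide)
    with mu2 show ?thesis by simp
  qed
  then show thesis using pos by (intro that[of "max C1 C2"]) (auto simp: le_max_iff_disj)
qed

text \<open>The averages see lags up to R times the largest bandwidth 2 h, and the target evaluates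
  its function at most at \<open>2 * step2\<close>, again at most 2 R h. A bound on this one
  interval therefore controls both parts of the error.\<close>

lemma curv_err_bounded:
  fixes K :: "real \<Rightarrow> real"
  assumes K: "is_kernel K R" and d: "2 \<le> CARD('d)" and \<kappa>: "0 < \<kappa>"
  obtains C where "0 < C"
    "\<And>n (s :: nat \<Rightarrow> real ^ 'd) h \<rho> b. 0 < h \<Longrightarrow> well_conditioned \<kappa> K R n s h \<Longrightarrow> 0 \<le> b \<Longrightarrow>
      \<forall>r. 0 \<le> r \<longrightarrow> r \<le> 2 * R * h \<longrightarrow> \<bar>\<rho> r\<bar> \<le> b \<Longrightarrow> \<bar>curv_err K n s h \<rho>\<bar> \<le> C * b"
    "\<And>n (s :: nat \<Rightarrow> real ^ 'd) h A b. 0 < h \<Longrightarrow> well_conditioned \<kappa> K R n s h \<Longrightarrow> 0 \<le> b \<Longrightarrow>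
      \<forall>i j. dist (s i) (s j) \<le> 2 * R * h \<longrightarrow> \<bar>A i j\<bar> \<le> b \<Longrightarrow> \<bar>curv K n s h A\<bar> \<le> C * b"
proof -
  obtain M where M: "0 < M" "\<And>n (s :: nat \<Rightarrow> real ^ 'd) h. 0 < h \<Longrightarrow> well_conditioned \<kappa> K R n s h \<Longrightarrow> \<bar>mu1 K n s h\<bar> \<le> M \<and> \<bar>mu2 K n s h\<bar> \<le> M"
    by (rule weights_bounded[OF K d \<kappa>]) (rule that, assumption+)
  define c1 c2 c3 where c: "c1 = cd1 CARD('d)" "c2 = cd2 CARD('d)" "c3 = cd3 CARD('d)"
  have cp: "0 < c1" "0 < c2" "0 < c3" using cd_pos[OF d] by (simp_all add: c)
  have R: "0 < R" using K by (simp add: is_kernel_def)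
  define C where "C = c2 * M + c3 * M + c1"
  have C: "0 < C" unfolding C_def using cp M by (intro add_pos_pos mult_pos_pos) auto
  have s2: "sqrt 2 \<le> 2" using sqrt2_less_2 by simp
  have curv: "\<bar>curv K n s h A\<bar> \<le> C * b"
    if h: "0 < h" and wc: "well_conditioned \<kappa> K R n s h" and b: "0 \<le> b"
      and le: "\<And>i j. dist (s i) (s j) \<le> 2 * R * h \<Longrightarrow> \<bar>A i j\<bar> \<le> b" for n and s :: "nat \<Rightarrow> real ^ 'd" and h A b
  proof -
    have av: "\<bar>kavg K n s (t * h) A\<bar> \<le> b" if t: "0 < t" "t \<le> 2" for t
    proof (rule kavg_abs_le[OF K _ b])
      fix i j assume *: "dist (s i) (s j) \<le> R * (t * h)"
      have "R * (t * h) \<le> 2 * R * h" using R h t by (simp add: mult_right_mono)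
      with * show "\<bar>A i j\<bar> \<le> b" by (intro le) linarith
    qed (use h t in auto)
    have "\<bar>c2 * mu1 K n s h * kavg K n s h A\<bar> \<le> c2 * M * b"
      unfolding abs_mult using M(2)[OF h wc] av[of 1] cp M(1) by (intro mult_mono) auto
    moreover have "\<bar>c3 * mu2 K n s h * kavg K n s (sqrt 2 * h) A\<bar> \<le> c3 * M * b"
      unfolding abs_mult using M(2)[OF h wc] av[of "sqrt 2"] s2 cp M(1) by (intro mult_mono) auto
    moreover have "\<bar>c1 * kavg K n s (2 * h) A\<bar> \<le> c1 * b"
      unfolding abs_mult using av[of 2] cp by (intro mult_mono) auto
    ultimately show ?thesis unfolding curv_def c[symmetric] C_def distrib_right by linarith
  qed
  have err: "\<bar>curv_err K n s h \<rho>\<bar> \<le> (C + (c2 + c3 + c1)) * b"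
    if h: "0 < h" and wc: "well_conditioned \<kappa> K R n s h" and b: "0 \<le> b"
      and le: "\<And>r. 0 \<le> r \<Longrightarrow> r \<le> 2 * R * h \<Longrightarrow> \<bar>\<rho> r\<bar> \<le> b" for n and s :: "nat \<Rightarrow> real ^ 'd" and h \<rho> b
  proof -
    have "\<bar>curv K n s h (\<lambda>i j. \<rho> (dist (s i) (s j)))\<bar> \<le> C * b"
      using h wc b by (rule curv) (use le in auto)
    moreover have "\<bar>\<rho> (t * step2 K n s h)\<bar> \<le> b" if t: "0 < t" "t \<le> 2" for t
    proof (rule le)
      note st = step2_bounds[OF K h, of n s]
      show "0 \<le> t * step2 K n s h" using st t by simp
      have "t * step2 K n s h \<le> 2 * (R * h)" using st t by (intro mult_mono) auto
      then show "t * step2 K n s h \<le> 2 * R * h" by simp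
    qed
    note this[of 1] this[of "sqrt 2"] this[of 2]
    then have "\<bar>c2 * \<rho> (step2 K n s h)\<bar> \<le> c2 * b" "\<bar>c3 * \<rho> (sqrt 2 * step2 K n s h)\<bar> \<le> c3 * b" "\<bar>c1 * \<rho> (2 * step2 K n s h)\<bar> \<le> c1 * b"
      unfolding abs_mult using cp s2 by (simp_all add: mult_left_mono)
    then have "\<bar>phi2 CARD('d) \<rho> (step2 K n s h)\<bar> \<le> (c2 + c3 + c1) * b"
      unfolding phi2_def c[symmetric] distrib_right by linarith
    ultimately show ?thesis unfolding curv_err_def distrib_right by linarith
  qed
  show thesis
  proof (rule that)
    show "0 < C + (c2 + c3 + c1)" using C cp by simp
    show "\<bar>curv_err K n s h \<rho>\<bar> \<le> (C + (c2 + c3 + c1)) * b"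
      if "0 < h" "well_conditioned \<kappa> K R n s h" "0 \<le> b" "\<forall>r. 0 \<le> r \<longrightarrow> r \<le> 2 * R * h \<longrightarrow> \<bar>\<rho> r\<bar> \<le> b"
      for n and s :: "nat \<Rightarrow> real ^ 'd" and h \<rho> b by (rule err) (use that in auto)
    show "\<bar>curv K n s h A\<bar> \<le> (C + (c2 + c3 + c1)) * b"
      if "0 < h" "well_conditioned \<kappa> K R n s h" "0 \<le> b" "\<forall>i j. dist (s i) (s j) \<le> 2 * R * h \<longrightarrow> \<bar>A i j\<bar> \<le> b"
      for n and s :: "nat \<Rightarrow> real ^ 'd" and h A b
    proof -
      have "\<bar>curv K n s h A\<bar> \<le> C * b" by (rule curv) (use that in auto)
      also have "\<dots> \<le> (C + (c2 + c3 + c1)) * b" using cp that(3) by (intro mult_right_mono) auto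
      finally show ?thesis .
    qed
  qed
qed

text \<open>A Taylor polynomial in even powers with Peano remainder, one-sided because lags are
  nonnegative and without constant term because F 0 = 0. The derivatives of F enter the estimates of
  the error only in this form.\<close>

definition order6_expansion :: "(real \<Rightarrow> real) \<Rightarrow> real \<Rightarrow> real \<Rightarrow> real \<Rightarrow> bool" where
  "order6_expansion F \<alpha> \<beta> \<gamma> \<longleftrightarrow>
     (\<forall>e>0. \<exists>\<delta>>0. \<forall>r. 0 \<le> r \<and> r < \<delta> \<longrightarrow> \<bar>F r - (\<alpha> * r ^ 2 + \<beta> * r ^ 4 + \<gamma> * r ^ 6)\<bar> \<le> e * r ^ 6)"

lemma well_conditioned_nonzero:
  fixes s :: "nat \<Rightarrow> real ^ 'd"
  assumes K: "is_kernel K R" and d: "2 \<le> CARD('d)" and "0 < \<kappa>" "0 < h" and wc: "well_conditioned \<kappa> K R n s h"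
  shows "lag_mom K n s 2 h \<noteq> 0" "mu2_den K n s h \<noteq> 0"
proof -
  have "0 < \<kappa> * (Bmom K R CARD('d) 2 * h\<^sup>2)" "0 < \<kappa> * (2 * cd3 CARD('d) * Bmom K R CARD('d) 4 * h ^ 4)"
    using assms(3,4) cd_pos(3)[OF d] Bmom_pos[OF K, of "CARD('d)"] by simp_all
  then show "lag_mom K n s 2 h \<noteq> 0" "mu2_den K n s h \<noteq> 0"
    using wc unfolding well_conditioned_def Let_def by linarith+
qed

lemma curv_err_split:
  fixes s :: "nat \<Rightarrow> real ^ 'd"
  assumes "is_kernel K R" "2 \<le> CARD('d)" "0 < \<kappa>" "0 < h" "well_conditioned \<kappa> K R n s h"
  shows "curv_err K n s h F = \<gamma> * (curv K n s h (\<lambda>i j. dist (s i) (s j) ^ 6)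
      + 24 * real CARD('d) * (real CARD('d) + 4) * step2 K n s h ^ 6)
      + curv_err K n s h (\<lambda>r. F r - (\<alpha> * r ^ 2 + \<beta> * r ^ 4 + \<gamma> * r ^ 6))"
  by (rule curv_err_expansion[where \<alpha> = \<alpha> and \<beta> = \<beta>])
    (use step2_bounds[OF assms(1,4)] well_conditioned_nonzero[OF assms] in simp_all)

text \<open>After the exact cancellation in orders two and four only the sixth-order term and the
  remainder are left, and both are at most a multiple of h^6 because lags do not exceed 2 R h and
  the step does not exceed R h. The bound holds for each well-conditioned configuration, however few
  pairs contribute.\<close>

lemma curv_err_order6:
  assumes K: "is_kernel K R" and d: "2 \<le> CARD('d)" and \<kappa>: "0 < \<kappa>" and F: "order6_expansion F \<alpha> \<beta> \<gamma>"
  obtains C \<delta> where "0 < C" "0 < \<delta>"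
    "\<And>n (s :: nat \<Rightarrow> real ^ 'd) h. 0 < h \<Longrightarrow> h < \<delta> \<Longrightarrow> well_conditioned \<kappa> K R n s h \<Longrightarrow> \<bar>curv_err K n s h F\<bar> \<le> C * h ^ 6"
proof -
  obtain C where "0 < C" and err0: "\<And>n (s :: nat \<Rightarrow> real ^ 'd) h \<rho> b. 0 < h \<Longrightarrow> well_conditioned \<kappa> K R n s h \<Longrightarrow> 0 \<le> b \<Longrightarrow>
      \<forall>r. 0 \<le> r \<longrightarrow> r \<le> 2 * R * h \<longrightarrow> \<bar>\<rho> r\<bar> \<le> b \<Longrightarrow> \<bar>curv_err K n s h \<rho>\<bar> \<le> C * b"
    and curv0: "\<And>n (s :: nat \<Rightarrow> real ^ 'd) h A b. 0 < h \<Longrightarrow> well_conditioned \<kappa> K R n s h \<Longrightarrow> 0 \<le> b \<Longrightarrow>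
      \<forall>i j. dist (s i) (s j) \<le> 2 * R * h \<longrightarrow> \<bar>A i j\<bar> \<le> b \<Longrightarrow> \<bar>curv K n s h A\<bar> \<le> C * b"
    by (rule curv_err_bounded[OF K d \<kappa>]) (rule that, assumption+)
  note err = err0[rule_format] and curv = curv0[rule_format]
  have R: "0 < R" using K by (simp add: is_kernel_def)
  obtain \<delta> where \<delta>: "0 < \<delta>" "\<And>r. 0 \<le> r \<Longrightarrow> r < \<delta> \<Longrightarrow> \<bar>F r - (\<alpha> * r ^ 2 + \<beta> * r ^ 4 + \<gamma> * r ^ 6)\<bar> \<le> 1 * r ^ 6"
    using F unfolding order6_expansion_def by (meson zero_less_one)
  define D where "D = 24 * real CARD('d) * (real CARD('d) + 4)"
  have "0 \<le> D" by (simp add: D_def)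
  define C' where "C' = \<bar>\<gamma>\<bar> * (C * (2 * R) ^ 6 + D * R ^ 6) + C * (2 * R) ^ 6"
  have "0 < C'" unfolding C'_def using \<open>0 < C\<close> R \<open>0 \<le> D\<close> by (intro add_nonneg_pos mult_nonneg_nonneg add_nonneg_nonneg) auto
  have "\<bar>curv_err K n s h F\<bar> \<le> C' * h ^ 6"
    \<comment> \<open>The threshold places every relevant lag, at most 2 R h, in the range of the
      expansion of F.\<close>
    if h: "0 < h" "h < \<delta> / (2 * R)" and wc: "well_conditioned \<kappa> K R n s h" for n and s :: "nat \<Rightarrow> real ^ 'd" and h
  proof -
    have hd: "2 * R * h < \<delta>" using h R by (simp add: field_simps)
    have "\<bar>curv_err K n s h (\<lambda>r. F r - (\<alpha> * r ^ 2 + \<beta> * r ^ 4 + \<gamma> * r ^ 6))\<bar> \<le> C * (2 * R * h) ^ 6"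
    proof (rule err[OF h(1) wc])
      fix r assume r: "0 \<le> r" "r \<le> 2 * R * h"
      have "\<bar>F r - (\<alpha> * r ^ 2 + \<beta> * r ^ 4 + \<gamma> * r ^ 6)\<bar> \<le> r ^ 6" using \<delta>(2)[of r] r hd by simp
      also have "\<dots> \<le> (2 * R * h) ^ 6" using r by (intro power_mono) auto
      finally show "\<bar>F r - (\<alpha> * r ^ 2 + \<beta> * r ^ 4 + \<gamma> * r ^ 6)\<bar> \<le> (2 * R * h) ^ 6" .
    qed (use h R in simp)
    moreover have "\<bar>\<gamma> * (curv K n s h (\<lambda>i j. dist (s i) (s j) ^ 6) + D * step2 K n s h ^ 6)\<bar>
        \<le> \<bar>\<gamma>\<bar> * (C * (2 * R * h) ^ 6 + D * (R * h) ^ 6)"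
    proof -
      have "\<bar>curv K n s h (\<lambda>i j. dist (s i) (s j) ^ 6)\<bar> \<le> C * (2 * R * h) ^ 6"
        by (rule curv[OF h(1) wc]) (use h R in \<open>auto intro: power_mono\<close>)
      moreover have "0 \<le> D * step2 K n s h ^ 6" "D * step2 K n s h ^ 6 \<le> D * (R * h) ^ 6"
        using step2_bounds[OF K h(1), of n s] \<open>0 \<le> D\<close> by (auto intro!: mult_left_mono power_mono)
      ultimately have "\<bar>curv K n s h (\<lambda>i j. dist (s i) (s j) ^ 6) + D * step2 K n s h ^ 6\<bar>
          \<le> C * (2 * R * h) ^ 6 + D * (R * h) ^ 6" by linarith
      then show ?thesis unfolding abs_mult[of \<gamma>] by (intro mult_left_mono) auto
    qed
    ultimately have "\<bar>curv_err K n s h F\<bar> \<le> \<bar>\<gamma>\<bar> * (C * (2 * R * h) ^ 6 + D * (R * h) ^ 6) + C * (2 * R * h) ^ 6"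
      unfolding curv_err_split[OF K d \<kappa> h(1) wc, of F \<gamma> \<alpha> \<beta>] D_def[symmetric] by linarith
    also have "\<dots> = C' * h ^ 6" by (simp add: C'_def power_mult_distrib algebra_simps)
    finally show ?thesis .
  qed
  moreover have "0 < \<delta> / (2 * R)" using \<delta> R by simp
  ultimately show thesis using \<open>0 < C'\<close> by (intro that[of C' "\<delta> / (2 * R)"])
qed

text \<open>The index set and the filter are arbitrary. Later the index is a pair of a sample size
  and an outcome, and a limit along a filter on such pairs is convergence uniform over events, so
  deterministic limits of quotients apply to random lag moments.\<close>

context
  fixes K :: "real \<Rightarrow> real" and R :: real and G :: "'i filter"
    and n :: "'i \<Rightarrow> nat" and s :: "'i \<Rightarrow> nat \<Rightarrow> real ^ 'd" and h :: "'i \<Rightarrow> real"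
  assumes K: "is_kernel K R" and d: "2 \<le> CARD('d)"
    and h: "\<forall>\<^sub>F i in G. 0 < h i"
    and lim: "\<And>b p. b \<in> {1, sqrt 2, 2} \<Longrightarrow> p \<in> {2, 4, 6} \<Longrightarrow>
      ((\<lambda>i. lag_mom K (n i) (s i) p (b * h i) / h i ^ p) \<longlongrightarrow> b ^ p * Bmom K R CARD('d) p) G"
begin

private definition "M b p i = lag_mom K (n i) (s i) p (b * h i) / h i ^ p"

private lemma Bp: "0 < Bmom K R CARD('d) p" by (rule Bmom_pos[OF K]) simp

private lemma M_lim:
  "(M 1 2 \<longlongrightarrow> Bmom K R CARD('d) 2) G" "(M (sqrt 2) 2 \<longlongrightarrow> 2 * Bmom K R CARD('d) 2) G" "(M 2 2 \<longlongrightarrow> 4 * Bmom K R CARD('d) 2) G"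
  "(M 1 4 \<longlongrightarrow> Bmom K R CARD('d) 4) G" "(M (sqrt 2) 4 \<longlongrightarrow> 4 * Bmom K R CARD('d) 4) G" "(M 2 4 \<longlongrightarrow> 16 * Bmom K R CARD('d) 4) G"
  "(M 1 6 \<longlongrightarrow> Bmom K R CARD('d) 6) G" "(M (sqrt 2) 6 \<longlongrightarrow> 8 * Bmom K R CARD('d) 6) G" "(M 2 6 \<longlongrightarrow> 64 * Bmom K R CARD('d) 6) G"
  using lim[of 1 2] lim[of "sqrt 2" 2] lim[of 2 2] lim[of 1 4] lim[of "sqrt 2" 4] lim[of 2 4]
    lim[of 1 6] lim[of "sqrt 2" 6] lim[of 2 6] power_mult[of "sqrt 2" 2 2] power_mult[of "sqrt 2" 2 3]
  unfolding M_def[abs_def] by simp_all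

private lemma lag_M: "0 < h i \<Longrightarrow> lag_mom K (n i) (s i) p (b * h i) = h i ^ p * M b p i"
  by (simp add: M_def)

private lemma lag_M1: "0 < h i \<Longrightarrow> lag_mom K (n i) (s i) p (h i) = h i ^ p * M 1 p i"
  by (simp add: M_def)

text \<open>At bandwidth \<open>sqrt 2 * h\<close> the normalised moments tend to 4 B_4 and 2 B_2,
  which leaves cd3 (4 - 2) B_4. It is the asymptotic value of which \<open>well_conditioned\<close>
  asks the fraction \<kappa>.\<close>

lemma mu2_den_limit: "((\<lambda>i. mu2_den K (n i) (s i) (h i) / h i ^ 4) \<longlongrightarrow> 2 * cd3 CARD('d) * Bmom K R CARD('d) 4) G"
proof -
  have "((\<lambda>i. cd3 CARD('d) * M (sqrt 2) 4 i - cd3 CARD('d) * M 1 4 i * (M (sqrt 2) 2 i / M 1 2 i))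
      \<longlongrightarrow> cd3 CARD('d) * (4 * Bmom K R CARD('d) 4) - cd3 CARD('d) * Bmom K R CARD('d) 4 * (2 * Bmom K R CARD('d) 2 / Bmom K R CARD('d) 2)) G"
    using Bp[of 2] by (intro tendsto_intros M_lim) auto
  also have "cd3 CARD('d) * (4 * Bmom K R CARD('d) 4) - cd3 CARD('d) * Bmom K R CARD('d) 4 * (2 * Bmom K R CARD('d) 2 / Bmom K R CARD('d) 2) = 2 * cd3 CARD('d) * Bmom K R CARD('d) 4"
    using Bp[of 2] by simp
  finally show ?thesis
  proof (rule Lim_transform_eventually)
    show "\<forall>\<^sub>F i in G. cd3 CARD('d) * M (sqrt 2) 4 i - cd3 CARD('d) * M 1 4 i * (M (sqrt 2) 2 i / M 1 2 i)
        = mu2_den K (n i) (s i) (h i) / h i ^ 4"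
      using h
    proof eventually_elim
      case (elim i)
      then show ?case unfolding mu2_den_def Let_def lag_M[OF elim] lag_M1[OF elim]
        by (simp add: field_simps)
    qed
  qed
qed

text \<open>Numerator and denominator have the same limit, since (cd2 + 8 cd1) + 4 cd1 - 16 cd1 = 2
  cd3.\<close>

lemma mu2_limit: "((\<lambda>i. mu2 K (n i) (s i) (h i)) \<longlongrightarrow> 1) G"
proof -
  let ?c1 = "cd1 CARD('d)" and ?c2 = "cd2 CARD('d)" and ?c3 = "cd3 CARD('d)"
  have "((\<lambda>i. (?c2 + 8 * ?c1) * M 1 4 i + ?c1 * M 1 4 i * (M 2 2 i / M 1 2 i) - ?c1 * M 2 4 i)
      \<longlongrightarrow> (?c2 + 8 * ?c1) * Bmom K R CARD('d) 4 + ?c1 * Bmom K R CARD('d) 4 * (4 * Bmom K R CARD('d) 2 / Bmom K R CARD('d) 2) - ?c1 * (16 * Bmom K R CARD('d) 4)) G"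
    using Bp[of 2] by (intro tendsto_intros M_lim) auto
  also have "(?c2 + 8 * ?c1) * Bmom K R CARD('d) 4 + ?c1 * Bmom K R CARD('d) 4 * (4 * Bmom K R CARD('d) 2 / Bmom K R CARD('d) 2) - ?c1 * (16 * Bmom K R CARD('d) 4) = 2 * ?c3 * Bmom K R CARD('d) 4"
    using Bp[of 2] by (simp add: cd1_def cd2_def cd3_def algebra_simps power2_eq_square)
  finally have num: "((\<lambda>i. mu2_num K (n i) (s i) (h i) / h i ^ 4) \<longlongrightarrow> 2 * ?c3 * Bmom K R CARD('d) 4) G"
  proof (rule Lim_transform_eventually)
    show "\<forall>\<^sub>F i in G. (?c2 + 8 * ?c1) * M 1 4 i + ?c1 * M 1 4 i * (M 2 2 i / M 1 2 i) - ?c1 * M 2 4 i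
        = mu2_num K (n i) (s i) (h i) / h i ^ 4"
      using h
    proof eventually_elim
      case (elim i)
      then show ?case unfolding mu2_num_def Let_def lag_M[OF elim] lag_M1[OF elim]
        by (simp add: field_simps)
    qed
  qed
  have nz: "2 * ?c3 * Bmom K R CARD('d) 4 \<noteq> 0" using cd_pos(3)[OF d] Bp[of 4] by simp
  have "((\<lambda>i. (mu2_num K (n i) (s i) (h i) / h i ^ 4) / (mu2_den K (n i) (s i) (h i) / h i ^ 4))
      \<longlongrightarrow> (2 * ?c3 * Bmom K R CARD('d) 4) / (2 * ?c3 * Bmom K R CARD('d) 4)) G"
    by (rule tendsto_divide[OF num mu2_den_limit nz])
  also have "(2 * ?c3 * Bmom K R CARD('d) 4) / (2 * ?c3 * Bmom K R CARD('d) 4) = 1" using nz by (rule divide_self)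
  finally show ?thesis
    by (rule Lim_transform_eventually) (use h in \<open>auto elim!: eventually_mono simp: mu2_def\<close>)
qed

text \<open>The identity behind this limit is 2 cd3 + 4 cd1 = cd2.\<close>

lemma mu1_limit: "((\<lambda>i. mu1 K (n i) (s i) (h i)) \<longlongrightarrow> 1) G"
proof -
  let ?c1 = "cd1 CARD('d)" and ?c2 = "cd2 CARD('d)" and ?c3 = "cd3 CARD('d)"
  have nz: "?c2 * Bmom K R CARD('d) 2 \<noteq> 0" using cd_pos(2)[OF d] Bp[of 2] by simp
  have "((\<lambda>i. (?c3 * mu2 K (n i) (s i) (h i) * M (sqrt 2) 2 i + ?c1 * M 2 2 i) / (?c2 * M 1 2 i))
      \<longlongrightarrow> (?c3 * 1 * (2 * Bmom K R CARD('d) 2) + ?c1 * (4 * Bmom K R CARD('d) 2)) / (?c2 * Bmom K R CARD('d) 2)) G"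
    by (intro tendsto_intros M_lim mu2_limit nz)
  also have "?c3 * 1 * (2 * Bmom K R CARD('d) 2) + ?c1 * (4 * Bmom K R CARD('d) 2) = ?c2 * Bmom K R CARD('d) 2"
    by (simp add: cd1_def cd2_def cd3_def algebra_simps power2_eq_square)
  also have "?c2 * Bmom K R CARD('d) 2 / (?c2 * Bmom K R CARD('d) 2) = 1" using nz by (rule divide_self)
  finally show ?thesis
  proof (rule Lim_transform_eventually)
    show "\<forall>\<^sub>F i in G. (?c3 * mu2 K (n i) (s i) (h i) * M (sqrt 2) 2 i + ?c1 * M 2 2 i) / (?c2 * M 1 2 i)
        = mu1 K (n i) (s i) (h i)"
      using h
    proof eventually_elim
      case (elim i)
      have "(a * (h i ^ 2 * x) + b * (h i ^ 2 * y)) / (c * (h i ^ 2 * z)) = (a * x + b * y) / (c * z)" for a b c x y z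
      proof -
        have "a * (h i ^ 2 * x) + b * (h i ^ 2 * y) = h i ^ 2 * (a * x + b * y)" "c * (h i ^ 2 * z) = h i ^ 2 * (c * z)"
          by (simp_all add: algebra_simps)
        then show ?thesis using elim by simp
      qed
      then show ?case unfolding mu1_def Let_def lag_M[OF elim] lag_M1[OF elim] by simp
    qed
  qed
qed

text \<open>The lower bounds on the denominators of the weights are \<kappa> times the limits of
  what they bound, so \<kappa> < 1 makes them strict in the limit and hence eventually true.\<close>

lemma well_conditioned_eventually:
  assumes "0 < \<kappa>" "\<kappa> < 1" and wt: "\<And>b. b \<in> {1, sqrt 2, 2} \<Longrightarrow> \<forall>\<^sub>F i in G. 0 < kweight K (n i) (s i) (b * h i) (\<lambda>_ _. 1)"
  shows "\<forall>\<^sub>F i in G. well_conditioned \<kappa> K R (n i) (s i) (h i)"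
proof -
  have "\<kappa> * Bmom K R CARD('d) 2 < Bmom K R CARD('d) 2" "\<kappa> * (2 * cd3 CARD('d) * Bmom K R CARD('d) 4) < 2 * cd3 CARD('d) * Bmom K R CARD('d) 4"
    using assms(1,2) Bp[of 2] Bp[of 4] cd_pos(3)[OF d] by simp_all
  then have "\<forall>\<^sub>F i in G. \<kappa> * Bmom K R CARD('d) 2 < M 1 2 i" "\<forall>\<^sub>F i in G. \<kappa> * (2 * cd3 CARD('d) * Bmom K R CARD('d) 4) < mu2_den K (n i) (s i) (h i) / h i ^ 4"
    by (auto intro: order_tendstoD M_lim mu2_den_limit)
  then show ?thesis
    using h wt[OF insertI1] wt[of "sqrt 2", simplified] wt[of 2, simplified]
  proof eventually_elim
    case (elim i)
    have "\<kappa> * (Bmom K R CARD('d) 2 * h i ^ 2) \<le> lag_mom K (n i) (s i) 2 (h i)"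
      unfolding lag_M1[OF elim(3)] using mult_right_mono[OF less_imp_le[OF elim(1)], of "h i ^ 2"] by (simp add: mult_ac)
    moreover have "\<kappa> * (2 * cd3 CARD('d) * Bmom K R CARD('d) 4 * h i ^ 4) \<le> mu2_den K (n i) (s i) (h i)"
      using elim(2,3) by (simp add: pos_less_divide_eq mult_ac less_imp_le)
    ultimately show ?case unfolding well_conditioned_def Let_def using elim(4-6) by simp
  qed
qed

text \<open>The averages of sixth powers contribute - 24 d (d + 4) B_6; subtracting the target
  returns the same factor times the limit of \<open>step2 ^ 6 / h ^ 6\<close>, the sixth power of
  the fourth root of B_4.\<close>

lemma curv_err_limit:
  assumes \<kappa>: "0 < \<kappa>" and wc: "\<forall>\<^sub>F i in G. well_conditioned \<kappa> K R (n i) (s i) (h i)" and h0: "(h \<longlongrightarrow> 0) G"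
    and F: "order6_expansion F \<alpha> \<beta> \<gamma>"
  shows "((\<lambda>i. curv_err K (n i) (s i) (h i) F / h i ^ 6)
    \<longlongrightarrow> - 24 * real CARD('d) * (real CARD('d) + 4) * \<gamma> * (Bmom K R CARD('d) 6 - Bmom K R CARD('d) 4 powr (3 / 2))) G"
proof -
  let ?c1 = "cd1 CARD('d)" and ?c2 = "cd2 CARD('d)" and ?c3 = "cd3 CARD('d)"
  define D where "D = 24 * real CARD('d) * (real CARD('d) + 4)"
  obtain C where "0 < C" and err0: "\<And>n (s :: nat \<Rightarrow> real ^ 'd) h \<rho> b. 0 < h \<Longrightarrow> well_conditioned \<kappa> K R n s h \<Longrightarrow> 0 \<le> b \<Longrightarrow>
      \<forall>r. 0 \<le> r \<longrightarrow> r \<le> 2 * R * h \<longrightarrow> \<bar>\<rho> r\<bar> \<le> b \<Longrightarrow> \<bar>curv_err K n s h \<rho>\<bar> \<le> C * b"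
    by (rule curv_err_bounded[OF K d \<kappa>]) (rule that, assumption+)
  note err = err0[rule_format]
  have R: "0 < R" using K by (simp add: is_kernel_def)
  define \<rho> where "\<rho> = (\<lambda>r. F r - (\<alpha> * r ^ 2 + \<beta> * r ^ 4 + \<gamma> * r ^ 6))"
  have rem: "((\<lambda>i. curv_err K (n i) (s i) (h i) \<rho> / h i ^ 6) \<longlongrightarrow> 0) G"
  proof (rule tendstoI)
    fix e :: real assume "0 < e"
    \<comment> \<open>Chosen so that C e' (2 R h)^6 is half of e h^6.\<close>
    define e' where "e' = e / (2 * C * (2 * R) ^ 6)"
    have e': "0 < e'" using \<open>0 < e\<close> \<open>0 < C\<close> R by (simp add: e'_def)
    obtain \<delta> where \<delta>: "0 < \<delta>" "\<And>r. 0 \<le> r \<Longrightarrow> r < \<delta> \<Longrightarrow> \<bar>\<rho> r\<bar> \<le> e' * r ^ 6"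
      using F e' unfolding order6_expansion_def \<rho>_def by meson
    have "\<forall>\<^sub>F i in G. h i < \<delta> / (2 * R)"
      by (rule order_tendstoD(2)[OF h0]) (use \<delta> R in simp)
    then show "\<forall>\<^sub>F i in G. dist (curv_err K (n i) (s i) (h i) \<rho> / h i ^ 6) 0 < e"
      using h wc
    proof eventually_elim
      case (elim i)
      have hd: "2 * R * h i < \<delta>" using elim(1) R by (simp add: field_simps)
      have "\<bar>curv_err K (n i) (s i) (h i) \<rho>\<bar> \<le> C * (e' * (2 * R * h i) ^ 6)"
      proof (rule err[OF elim(2,3)])
        fix r assume r: "0 \<le> r" "r \<le> 2 * R * h i"
        have "\<bar>\<rho> r\<bar> \<le> e' * r ^ 6" using \<delta>(2)[of r] r hd by simp
        also have "\<dots> \<le> e' * (2 * R * h i) ^ 6" using r e' by (intro mult_left_mono power_mono) auto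
        finally show "\<bar>\<rho> r\<bar> \<le> e' * (2 * R * h i) ^ 6" .
      qed (use elim R e' in simp)
      also have "\<dots> = (e / 2) * h i ^ 6" using \<open>0 < C\<close> R by (simp add: e'_def power_mult_distrib field_simps)
      also have "\<dots> < e * h i ^ 6" using \<open>0 < e\<close> elim(2) by simp
      finally show ?case using elim(2) by (simp add: pos_divide_less_eq)
    qed
  qed
  have curv: "((\<lambda>i. curv K (n i) (s i) (h i) (\<lambda>j k. dist (s i j) (s i k) ^ 6) / h i ^ 6) \<longlongrightarrow> - D * Bmom K R CARD('d) 6) G"
  proof -
    have "((\<lambda>i. ?c2 * mu1 K (n i) (s i) (h i) * M 1 6 i - ?c3 * mu2 K (n i) (s i) (h i) * M (sqrt 2) 6 i - ?c1 * M 2 6 i)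
        \<longlongrightarrow> ?c2 * 1 * Bmom K R CARD('d) 6 - ?c3 * 1 * (8 * Bmom K R CARD('d) 6) - ?c1 * (64 * Bmom K R CARD('d) 6)) G"
      by (intro tendsto_intros M_lim mu1_limit mu2_limit)
    also have "?c2 * 1 * Bmom K R CARD('d) 6 - ?c3 * 1 * (8 * Bmom K R CARD('d) 6) - ?c1 * (64 * Bmom K R CARD('d) 6) = - D * Bmom K R CARD('d) 6"
      by (simp add: cd1_def cd2_def cd3_def D_def algebra_simps power2_eq_square)
    finally show ?thesis
    proof (rule Lim_transform_eventually)
      show "\<forall>\<^sub>F i in G. ?c2 * mu1 K (n i) (s i) (h i) * M 1 6 i - ?c3 * mu2 K (n i) (s i) (h i) * M (sqrt 2) 6 i - ?c1 * M 2 6 i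
          = curv K (n i) (s i) (h i) (\<lambda>j k. dist (s i j) (s i k) ^ 6) / h i ^ 6"
        using h
      proof eventually_elim
        case (elim i)
        show ?case
          unfolding curv_def lag_mom_def[symmetric] lag_M[OF elim] lag_M1[OF elim]
          using elim by (simp add: field_simps)
      qed
    qed
  qed
  have step: "((\<lambda>i. step2 K (n i) (s i) (h i) ^ 6 / h i ^ 6) \<longlongrightarrow> Bmom K R CARD('d) 4 powr (3 / 2)) G"
  proof -
    have "((\<lambda>i. root 4 (M 1 4 i) ^ 6) \<longlongrightarrow> root 4 (Bmom K R CARD('d) 4) ^ 6) G"
      by (intro tendsto_intros M_lim)
    also have "root 4 (Bmom K R CARD('d) 4) ^ 6 = Bmom K R CARD('d) 4 powr (3 / 2)"
      using Bp[of 4] by (simp add: root_powr_inverse powr_power powr_powr flip: powr_realpow)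
    finally show ?thesis
    proof (rule Lim_transform_eventually)
      show "\<forall>\<^sub>F i in G. root 4 (M 1 4 i) ^ 6 = step2 K (n i) (s i) (h i) ^ 6 / h i ^ 6"
        using h
      proof eventually_elim
        case (elim i)
        then show ?case
          by (simp add: M_def step2_def real_root_divide real_root_power_cancel power_divide)
      qed
    qed
  qed
  have "((\<lambda>i. \<gamma> * (curv K (n i) (s i) (h i) (\<lambda>j k. dist (s i j) (s i k) ^ 6) / h i ^ 6 + D * (step2 K (n i) (s i) (h i) ^ 6 / h i ^ 6))
      + curv_err K (n i) (s i) (h i) \<rho> / h i ^ 6) \<longlongrightarrow> \<gamma> * (- D * Bmom K R CARD('d) 6 + D * Bmom K R CARD('d) 4 powr (3 / 2)) + 0) G"
    by (intro tendsto_intros curv step rem)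
  also have "\<gamma> * (- D * Bmom K R CARD('d) 6 + D * Bmom K R CARD('d) 4 powr (3 / 2)) + 0 = - 24 * real CARD('d) * (real CARD('d) + 4) * \<gamma> * (Bmom K R CARD('d) 6 - Bmom K R CARD('d) 4 powr (3 / 2))"
    by (simp add: D_def algebra_simps)
  finally show ?thesis
  proof (rule Lim_transform_eventually)
    show "\<forall>\<^sub>F i in G. \<gamma> * (curv K (n i) (s i) (h i) (\<lambda>j k. dist (s i j) (s i k) ^ 6) / h i ^ 6 + D * (step2 K (n i) (s i) (h i) ^ 6 / h i ^ 6))
        + curv_err K (n i) (s i) (h i) \<rho> / h i ^ 6 = curv_err K (n i) (s i) (h i) F / h i ^ 6"
      using h wc
    proof eventually_elim
      case (elim i)
      show ?case
        unfolding curv_err_split[OF K d \<kappa> elim, of F \<gamma> \<alpha> \<beta>] \<rho>_def[symmetric] D_def[symmetric]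
        by (simp add: add_divide_distrib distrib_left)
    qed
  qed
qed

end

section \<open>Independent sampling positions\<close>

lemma isCont_near_zero:
  fixes f :: "'b :: real_normed_vector \<Rightarrow> real"
  assumes "isCont f 0" "0 < e"
  shows "\<exists>\<delta>>0. \<forall>x. norm x < \<delta> \<longrightarrow> \<bar>f x - f 0\<bar> < e"
proof -
  obtain s where s: "0 < s" "\<And>x. x \<noteq> 0 \<Longrightarrow> norm x < s \<Longrightarrow> \<bar>f x - f 0\<bar> < e"
    using LIM_D[of f "f 0" 0 e] assms by (auto simp: isCont_def)
  have "\<bar>f x - f 0\<bar> < e" if "norm x < s" for x
    using s(2)[of x] that \<open>0 < e\<close> by (cases "x = 0") auto
  with s(1) show ?thesis by blast
qed

locale sampling = prob_space P for P :: "'v measure" +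
  fixes U :: "nat \<Rightarrow> 'v \<Rightarrow> real ^ 'd"
    and f1 :: "real ^ 'd \<Rightarrow> real" and f2 :: "(real ^ 'd) \<times> (real ^ 'd) \<Rightarrow> real"
  assumes indep: "indep_vars (\<lambda>_. borel) U UNIV"
    and ident: "\<And>i. distr P borel (U i) = distr P borel (U 0)"
    and cube: "\<And>i. AE v in P. \<forall>k. U i v $ k \<in> {0..1}"
    and f1_nonneg: "\<And>x. 0 \<le> f1 x"
    and f1_density: "\<And>i j. i \<noteq> j \<Longrightarrow> distributed P lborel (\<lambda>v. U i v - U j v) (\<lambda>x. ennreal (f1 x))"
    and f1_cont: "isCont f1 0"
    and f2_nonneg: "\<And>x. 0 \<le> f2 x"
    and f2_density: "\<And>i j k. distinct [i, j, k] \<Longrightarrow>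
      distributed P lborel (\<lambda>v. (U i v - U j v, U i v - U k v)) (\<lambda>x. ennreal (f2 x))"
    and f2_cont: "isCont f2 0"
begin

lemma U_measurable [measurable]: "U i \<in> borel_measurable P"
  using indep by (simp add: indep_vars_def)

lemma f1_measurable [measurable]: "f1 \<in> borel_measurable borel"
  using distributed_real_measurable[OF _ f1_density[of 0 1]] f1_nonneg by simp

lemma density_prob_le:
  fixes f :: "'b :: euclidean_space \<Rightarrow> real"
  assumes dens: "distributed P lborel Y (\<lambda>x. ennreal (f x))" and A: "A \<in> sets borel" "emeasure lborel A < \<infinity>"
    and C: "\<And>x. x \<in> A \<Longrightarrow> f x \<le> C" "0 \<le> C"
  shows "prob {v \<in> space P. Y v \<in> A} \<le> C * measure lborel A"
proof -
  have "emeasure P (Y -` A \<inter> space P) = (\<integral>\<^sup>+x. ennreal (f x) * indicator A x \<partial>lborel)"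
    using dens A by (intro distributed_emeasure) auto
  also have "\<dots> \<le> (\<integral>\<^sup>+x. ennreal C * indicator A x \<partial>lborel)"
    using C by (intro nn_integral_mono) (auto split: split_indicator intro: ennreal_leI)
  also have "\<dots> = ennreal (C * measure lborel A)"
    using A C by (simp add: nn_integral_cmult_indicator emeasure_eq_ennreal_measure ennreal_mult)
  finally have "ennreal (prob (Y -` A \<inter> space P)) \<le> ennreal (C * measure lborel A)"
    by (simp add: emeasure_eq_measure)
  moreover have "Y -` A \<inter> space P = {v \<in> space P. Y v \<in> A}" by auto
  ultimately show ?thesis using C by simp
qed

text \<open>Near zero each density is at most its value at zero plus one, so probabilities are
  bounded by volumes: one ball for an increment, a product of two balls for two increments that
  share a point. The exponents d and 2 d decide the variance of the pair sums.\<close>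

lemma pair_prob_le:
  assumes "0 < \<rho>"
  obtains C \<delta> where "0 < C" "0 < \<delta>"
    "\<And>q i j. 0 < q \<Longrightarrow> q < \<delta> \<Longrightarrow> i \<noteq> j \<Longrightarrow>
      prob {v \<in> space P. norm (U i v - U j v) \<le> \<rho> * q} \<le> C * q ^ CARD('d)"
    "\<And>q i j k. 0 < q \<Longrightarrow> q < \<delta> \<Longrightarrow> distinct [i, j, k] \<Longrightarrow>
      prob {v \<in> space P. norm (U i v - U j v) \<le> \<rho> * q \<and> norm (U i v - U k v) \<le> \<rho> * q} \<le> C * q ^ (2 * CARD('d))"
proof -
  obtain \<delta>1 where \<delta>1': "0 < \<delta>1" "\<And>x. norm x < \<delta>1 \<Longrightarrow> \<bar>f1 x - f1 0\<bar> < 1"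
    using isCont_near_zero[OF f1_cont zero_less_one] by blast
  have \<delta>1: "f1 x \<le> f1 0 + 1" if "norm x < \<delta>1" for x
    using \<delta>1'(2)[OF that] by linarith
  obtain \<delta>2 where \<delta>2': "0 < \<delta>2" "\<And>x. norm x < \<delta>2 \<Longrightarrow> \<bar>f2 x - f2 0\<bar> < 1"
    using isCont_near_zero[OF f2_cont zero_less_one] by blast
  have \<delta>2: "f2 x \<le> f2 0 + 1" if "norm x < \<delta>2" for x
    using \<delta>2'(2)[OF that] by linarith
  define V where "V = unit_ball_vol (real CARD('d)) * \<rho> ^ CARD('d)"
  have V: "measure lborel (cball (0 :: real ^ 'd) (\<rho> * q)) = V * q ^ CARD('d)" if "0 < q" for q
    using that \<open>0 < \<rho>\<close> by (simp add: content_cball V_def power_mult_distrib)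
  have "0 \<le> V" using \<open>0 < \<rho>\<close> by (simp add: V_def unit_ball_vol_nonneg)
  define C where "C = (f1 0 + 1) * V + (f2 0 + 1) * (V * V) + 1"
  \<comment> \<open>The norm of a pair is at most the sum of the norms of its components, hence the
    factor 2 in the second bound.\<close>
  define \<delta> where "\<delta> = min (\<delta>1 / \<rho>) (\<delta>2 / (2 * \<rho>))"
  have nn: "0 \<le> (f1 0 + 1) * V" "0 \<le> (f2 0 + 1) * (V * V)"
    using f1_nonneg[of 0] f2_nonneg[of 0] \<open>0 \<le> V\<close> by auto
  have 1: "prob {v \<in> space P. norm (U i v - U j v) \<le> \<rho> * q} \<le> C * q ^ CARD('d)"
    if q: "0 < q" "q < \<delta>" and "i \<noteq> j" for q i j
  proof -
    have sm: "\<rho> * q < \<delta>1" using q \<open>0 < \<rho>\<close> by (simp add: \<delta>_def field_simps)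
    have "prob {v \<in> space P. U i v - U j v \<in> cball 0 (\<rho> * q)} \<le> (f1 0 + 1) * measure lborel (cball (0 :: real ^ 'd) (\<rho> * q))"
      using f1_nonneg[of 0] sm
      by (intro density_prob_le[OF f1_density[OF \<open>i \<noteq> j\<close>]] \<delta>1) (auto simp: emeasure_lborel_cball_finite[unfolded infinity_ennreal_def])
    also have "\<dots> = ((f1 0 + 1) * V) * q ^ CARD('d)" using V q by simp
    also have "\<dots> \<le> C * q ^ CARD('d)" using q nn by (intro mult_right_mono) (auto simp: C_def)
    finally show ?thesis by simp
  qed
  have 2: "prob {v \<in> space P. norm (U i v - U j v) \<le> \<rho> * q \<and> norm (U i v - U k v) \<le> \<rho> * q} \<le> C * q ^ (2 * CARD('d))"
    if q: "0 < q" "q < \<delta>" and "distinct [i, j, k]" for q i j k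
  proof -
    let ?B = "cball (0 :: real ^ 'd) (\<rho> * q)"
    have sm: "2 * (\<rho> * q) < \<delta>2" using q \<open>0 < \<rho>\<close> by (simp add: \<delta>_def field_simps)
    have em: "emeasure lborel (?B \<times> ?B) = emeasure lborel ?B * emeasure lborel ?B"
      unfolding lborel_prod[symmetric] by (rule lborel.emeasure_pair_measure_Times) auto
    have "prob {v \<in> space P. (U i v - U j v, U i v - U k v) \<in> ?B \<times> ?B} \<le> (f2 0 + 1) * measure lborel (?B \<times> ?B)"
    proof (intro density_prob_le[OF f2_density[OF that(3)]] \<delta>2)
      fix x assume "x \<in> ?B \<times> ?B"
      then show "norm x < \<delta>2"
        using norm_Pair_le[of "fst x" "snd x"] sm by (auto simp: mem_Times_iff)
    next
      show "emeasure lborel (?B \<times> ?B) < \<infinity>"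
        unfolding em using emeasure_lborel_cball_finite[of "0 :: real ^ 'd" "\<rho> * q"] by (simp add: ennreal_mult_less_top)
    qed (use f2_nonneg[of 0] in \<open>auto simp: closed_Times\<close>)
    also have "measure lborel (?B \<times> ?B) = (V * q ^ CARD('d)) * (V * q ^ CARD('d))"
      unfolding V[OF q(1), symmetric] measure_def em by (simp add: enn2real_mult)
    also have "(f2 0 + 1) * ((V * q ^ CARD('d)) * (V * q ^ CARD('d))) = ((f2 0 + 1) * (V * V)) * q ^ (2 * CARD('d))"
      by (simp add: mult_2 power_add)
    also have "\<dots> \<le> C * q ^ (2 * CARD('d))" using q nn by (intro mult_right_mono) (auto simp: C_def)
    finally show ?thesis by simp
  qed
  have "0 < C" "0 < \<delta>" using nn \<delta>1'(1) \<delta>2'(1) \<open>0 < \<rho>\<close> by (simp_all add: C_def \<delta>_def)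
  then show thesis using 1 2 by (rule that)
qed

text \<open>Substituting x = q y turns the quotient into the integral of f1 (q y) g y. As q tends to
  zero, f1 (q y) tends to \<open>f1 0\<close> uniformly on the bounded support of g.\<close>

lemma lag_expectation_limit:
  fixes g :: "real ^ 'd \<Rightarrow> real"
  assumes g[measurable]: "g \<in> borel_measurable borel" and M: "\<And>x. \<bar>g x\<bar> \<le> M"
    and supp: "\<And>x. \<rho> < norm x \<Longrightarrow> g x = 0" and "0 < \<rho>" and "i \<noteq> j"
  shows "((\<lambda>q. expectation (\<lambda>v. g ((U i v - U j v) /\<^sub>R q)) / q ^ CARD('d)) \<longlongrightarrow> f1 0 * (\<integral>x. g x \<partial>lborel)) (at_right 0)"
proof (rule tendstoI)
  fix e :: real assume "0 < e"
  have "0 \<le> M" using M[of 0] by linarith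
  define V where "V = measure lborel (cball (0 :: real ^ 'd) \<rho>)"
  have "0 \<le> V" by (simp add: V_def)
  \<comment> \<open>The summand 1 guards against M V = 0; the integral of the deviation is then at
    most \<eta> M V < e.\<close>
  define \<eta> where "\<eta> = e / (2 * (M * V + 1))"
  have \<eta>: "0 < \<eta>" "\<eta> * (M * V) < e"
    using \<open>0 < e\<close> \<open>0 \<le> M\<close> \<open>0 \<le> V\<close> by (auto simp: \<eta>_def field_simps add_pos_nonneg intro!: add_nonneg_pos)
  obtain \<delta> where \<delta>: "0 < \<delta>" "\<And>x. norm x < \<delta> \<Longrightarrow> \<bar>f1 x - f1 0\<bar> < \<eta>"
    using isCont_near_zero[OF f1_cont \<eta>(1)] by blast
  have intB: "integrable lborel (indicat_real (cball (0 :: real ^ 'd) \<rho>))"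
    using emeasure_lborel_cball_finite[of "0 :: real ^ 'd" \<rho>] by simp
  have bound: "integrable lborel u" if [measurable]: "u \<in> borel_measurable borel" and "\<And>x. \<bar>u x\<bar> \<le> c * indicator (cball 0 \<rho>) x"
    for u :: "real ^ 'd \<Rightarrow> real" and c
    by (rule Bochner_Integration.integrable_bound[OF integrable_mult_right[OF intB, of c]]) (use that in \<open>auto intro: order_trans[OF _ abs_ge_self]\<close>)
  have gi: "integrable lborel g"
    by (rule bound[of g M]) (use M supp in \<open>auto split: split_indicator simp: not_le\<close>)
  have "\<bar>expectation (\<lambda>v. g ((U i v - U j v) /\<^sub>R q)) / q ^ CARD('d) - f1 0 * (\<integral>x. g x \<partial>lborel)\<bar> < e"
    if q: "0 < q" "q < \<delta> / \<rho>" for q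
  proof -
    have close: "\<bar>(f1 (q *\<^sub>R y) - f1 0) * g y\<bar> \<le> (\<eta> * M) * indicator (cball 0 \<rho>) y" for y
    proof (cases "norm y \<le> \<rho>")
      case True
      have "q * norm y \<le> q * \<rho>" using True q by simp
      also have "\<dots> < \<delta>" using q \<open>0 < \<rho>\<close> by (simp add: field_simps)
      finally have "\<bar>f1 (q *\<^sub>R y) - f1 0\<bar> \<le> \<eta>" using \<delta>(2)[of "q *\<^sub>R y"] q by simp
      then show ?thesis using True M[of y] \<eta> by (simp add: abs_mult mult_mono)
    qed (use supp in \<open>simp add: not_le\<close>)
    have di: "integrable lborel (\<lambda>y. (f1 (q *\<^sub>R y) - f1 0) * g y)"
      by (rule bound[OF _ close]) simp
    have "expectation (\<lambda>v. g ((U i v - U j v) /\<^sub>R q)) = (\<integral>x. f1 x * g (x /\<^sub>R q) \<partial>lborel)"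
      by (rule distributed_integral[OF f1_density[OF \<open>i \<noteq> j\<close>], symmetric]) (auto simp: f1_nonneg)
    also have "\<dots> = (\<integral>x. (\<lambda>y. f1 (q *\<^sub>R y) * g y) (x /\<^sub>R q) \<partial>lborel)" using q by simp
    also have "\<dots> = q ^ CARD('d) * (\<integral>y. f1 (q *\<^sub>R y) * g y \<partial>lborel)"
      using lborel_integral_scale[of "\<lambda>y. f1 (q *\<^sub>R y) * g y" q] q by simp
    also have "(\<integral>y. f1 (q *\<^sub>R y) * g y \<partial>lborel) = (\<integral>y. (f1 (q *\<^sub>R y) - f1 0) * g y + f1 0 * g y \<partial>lborel)"
      by (simp add: algebra_simps)
    also have "\<dots> = (\<integral>y. (f1 (q *\<^sub>R y) - f1 0) * g y \<partial>lborel) + f1 0 * (\<integral>x. g x \<partial>lborel)"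
      using di gi by simp
    finally have "expectation (\<lambda>v. g ((U i v - U j v) /\<^sub>R q)) / q ^ CARD('d) - f1 0 * (\<integral>x. g x \<partial>lborel)
        = (\<integral>y. (f1 (q *\<^sub>R y) - f1 0) * g y \<partial>lborel)"
      using q by simp
    moreover have "\<bar>\<integral>y. (f1 (q *\<^sub>R y) - f1 0) * g y \<partial>lborel\<bar> \<le> (\<integral>y. (\<eta> * M) * indicator (cball (0 :: real ^ 'd) \<rho>) y \<partial>lborel)"
      by (rule order_trans[OF integral_abs_bound integral_mono]) (use di close intB in auto)
    moreover have "\<dots> = \<eta> * (M * V)" by (simp add: V_def)
    ultimately show ?thesis using \<eta>(2) by linarith
  qed
  then show "\<forall>\<^sub>F q in at_right 0. dist (expectation (\<lambda>v. g ((U i v - U j v) /\<^sub>R q)) / q ^ CARD('d)) (f1 0 * (\<integral>x. g x \<partial>lborel)) < e"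
    unfolding eventually_at_right_field dist_real_def using \<delta> \<open>0 < \<rho>\<close>
    by (intro exI[of _ "\<delta> / \<rho>"]) auto
qed


text \<open>
  Pigeonhole: two independent points of the unit cube lie in the same cell of a partition into
  \<open>(m + 1)\<^sup>d\<close> cells of side \<open>1 / m\<close> with probability at least \<open>(m + 1)\<^sup>-\<^sup>d\<close>.
\<close>

lemma same_cell_prob:
  assumes "0 < m"
  shows "1 / real (m + 1) ^ CARD('d) \<le> prob {v \<in> space P. norm (U 0 v - U 1 v) \<le> real CARD('d) / real m}"
proof -
  define c where "c x = (\<lambda>k. \<lfloor>real m * (x $ k)\<rfloor>)" for x :: "real ^ 'd"
  \<comment> \<open>A coordinate equal to 1 has floor m, so each axis carries m + 1 cells rather
    than m.\<close>
  define T where "T = PiE (UNIV :: 'd set) (\<lambda>_. {0..int m})"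
  have T: "finite T" "card T = (m + 1) ^ CARD('d)"
    by (simp_all add: T_def finite_PiE card_PiE nat_add_distrib)
  define E where "E t = {x :: real ^ 'd. c x = t}" for t
  have [measurable]: "E t \<in> sets borel" for t
  proof -
    have "E t = {x. \<forall>k. \<lfloor>real m * (x $ k)\<rfloor> = t k}" by (auto simp: E_def c_def)
    also have "\<dots> \<in> sets borel" by measurable
    finally show ?thesis .
  qed
  define p where "p t = prob (U 0 -` E t \<inter> space P)" for t
  have p: "prob (U i -` E t \<inter> space P) = p t" for i t
    using arg_cong[OF ident[of i], of "\<lambda>M. measure M (E t)"] by (simp add: measure_distr p_def)
  have inT: "AE v in P. c (U i v) \<in> T" for i
    using cube[of i]
  proof eventually_elim
    case (elim v)
    then have "0 \<le> real m * (U i v $ k)" "real m * (U i v $ k) \<le> real m" for k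
      by (auto simp: mult_left_le)
    moreover from this(2) have "real m * (U i v $ k) < real m + 1" for k
      by (rule order_le_less_trans) simp
    ultimately show ?case by (auto simp: T_def c_def PiE_def floor_le_iff le_floor_iff)
  qed
  have disj: "disjoint_family_on (\<lambda>t. U 0 -` E t \<inter> space P) T"
    by (auto simp: disjoint_family_on_def E_def)
  have "(\<Sum>t\<in>T. p t) = prob (\<Union>t\<in>T. U 0 -` E t \<inter> space P)"
    unfolding p_def using T disj by (intro finite_measure_finite_Union[symmetric]) auto
  also have "\<dots> = 1"
  proof (subst prob_eq_1)
    show "(\<Union>t\<in>T. U 0 -` E t \<inter> space P) \<in> events" using T(1) by (intro sets.finite_UN) auto
    show "AE v in P. v \<in> (\<Union>t\<in>T. U 0 -` E t \<inter> space P)"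
      using inT[of 0] AE_space by eventually_elim (auto simp: E_def)
  qed
  finally have sum_p: "(\<Sum>t\<in>T. p t) = 1" .
  have ind: "prob ((U 0 -` E t \<inter> space P) \<inter> (U 1 -` E t \<inter> space P)) = p t * p t" for t
  proof -
    have "indep_sets (\<lambda>i. {U i -` A \<inter> space P |A. A \<in> sets borel}) UNIV"
      using indep by (simp add: indep_vars_def2)
    then have "prob (\<Inter>i\<in>{0, 1}. U i -` E t \<inter> space P) = (\<Prod>i\<in>{0, 1}. prob (U i -` E t \<inter> space P))"
      by (rule indep_setsD) (auto intro!: exI[of _ "E t"])
    then show ?thesis by (simp add: p)
  qed
  \<comment> \<open>Cauchy-Schwarz against the constant 1: cell probabilities with sum 1 have
    squares with sum at least 1 over the number of cells.\<close>
  have "(\<Sum>t\<in>T. 1 * p t)\<^sup>2 \<le> (\<Sum>t\<in>T. 1\<^sup>2) * (\<Sum>t\<in>T. (p t)\<^sup>2)" by (rule Cauchy_Schwarz_ineq_sum)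
  then have "1 \<le> real (m + 1) ^ CARD('d) * (\<Sum>t\<in>T. (p t)\<^sup>2)" using sum_p T by simp
  then have "1 / real (m + 1) ^ CARD('d) \<le> (\<Sum>t\<in>T. (p t)\<^sup>2)" by (simp add: divide_le_eq mult.commute)
  also have "\<dots> = (\<Sum>t\<in>T. prob ((U 0 -` E t \<inter> space P) \<inter> (U 1 -` E t \<inter> space P)))"
    by (simp only: ind power2_eq_square)
  also have "\<dots> = prob (\<Union>t\<in>T. (U 0 -` E t \<inter> space P) \<inter> (U 1 -` E t \<inter> space P))"
  proof (rule finite_measure_finite_Union[symmetric])
    have "(U 0 -` E t \<inter> space P) \<inter> (U 1 -` E t \<inter> space P) \<in> events" for t by measurable
    then show "(\<lambda>t. (U 0 -` E t \<inter> space P) \<inter> (U 1 -` E t \<inter> space P)) ` T \<subseteq> events" by blast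
    show "disjoint_family_on (\<lambda>t. (U 0 -` E t \<inter> space P) \<inter> (U 1 -` E t \<inter> space P)) T"
      by (auto simp: disjoint_family_on_def E_def)
  qed (rule T(1))
  also have "\<dots> \<le> prob {v \<in> space P. norm (U 0 v - U 1 v) \<le> real CARD('d) / real m}"
  proof (rule finite_measure_mono)
    show "(\<Union>t\<in>T. (U 0 -` E t \<inter> space P) \<inter> (U 1 -` E t \<inter> space P))
        \<subseteq> {v \<in> space P. norm (U 0 v - U 1 v) \<le> real CARD('d) / real m}"
    proof clarify
      fix v t assume "v \<in> space P" "U 0 v \<in> E t" "U 1 v \<in> E t"
      then have eq: "\<lfloor>real m * (U 0 v $ k)\<rfloor> = \<lfloor>real m * (U 1 v $ k)\<rfloor>" for k
        by (auto simp: E_def c_def fun_eq_iff)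
      have "\<bar>real m * (U 0 v $ k) - real m * (U 1 v $ k)\<bar> \<le> 1" for k
        using eq[of k] floor_correct[of "real m * (U 0 v $ k)"] floor_correct[of "real m * (U 1 v $ k)"]
        by linarith
      then have "\<bar>(U 0 v - U 1 v) $ k\<bar> \<le> 1 / real m" for k
        using \<open>0 < m\<close> by (simp add: right_diff_distrib[symmetric] abs_mult pos_le_divide_eq mult.commute)
      then have "(\<Sum>k\<in>UNIV. \<bar>(U 0 v - U 1 v) $ k\<bar>) \<le> (\<Sum>k\<in>(UNIV :: 'd set). 1 / real m)"
        by (intro sum_mono) auto
      then show "norm (U 0 v - U 1 v) \<le> real CARD('d) / real m"
        using norm_le_l1_cart[of "U 0 v - U 1 v"] by simp
    qed
  qed measurable
  finally show ?thesis .
qed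

text \<open>A continuous density vanishing at zero would give two points within d / m of each other
  a probability of order o(m^(-d)), against the lower bound (m + 1)^(-d) of
  \<open>same_cell_prob\<close>. The value \<open>f1 0\<close> is a factor of every limit of a pair
  mean and has to cancel in the lag moments.\<close>

lemma f1_pos: "0 < f1 0"
proof (rule ccontr)
  assume "\<not> 0 < f1 0"
  with f1_nonneg[of 0] have z: "f1 0 = 0" by simp
  define W where "W = unit_ball_vol (real CARD('d)) * real CARD('d) ^ CARD('d)"
  have "0 \<le> W" by (simp add: W_def unit_ball_vol_nonneg)
  \<comment> \<open>The factor 2^d pays for (m + 1)^d \<le> (2 m)^d; the contradiction is then 1
    \<le> W / (2 (W + 1)).\<close>
  define \<eta> where "\<eta> = 1 / (2 * (W + 1) * 2 ^ CARD('d))"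
  have \<eta>: "0 < \<eta>" using \<open>0 \<le> W\<close> by (simp add: \<eta>_def)
  obtain \<delta> where \<delta>: "0 < \<delta>" "\<And>x. norm x < \<delta> \<Longrightarrow> \<bar>f1 x - f1 0\<bar> < \<eta>"
    using isCont_near_zero[OF f1_cont \<eta>] by blast
  then have \<delta>: "0 < \<delta>" "\<And>x. norm x < \<delta> \<Longrightarrow> f1 x < \<eta>"
    using z by (auto simp: abs_less_iff)
  obtain m where m: "real CARD('d) / \<delta> < real m" using reals_Archimedean2 by blast
  have "0 \<le> real CARD('d) / \<delta>" using \<delta>(1) by simp
  then have "0 < real m" using m by linarith
  then have m0: "0 < m" by simp
  have sm: "real CARD('d) / real m < \<delta>" using m m0 \<delta> by (simp add: field_simps)
  have "1 / real (m + 1) ^ CARD('d) \<le> prob {v \<in> space P. U 0 v - U 1 v \<in> cball 0 (real CARD('d) / real m)}"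
    using same_cell_prob[OF m0] by simp
  also have "\<dots> \<le> \<eta> * measure lborel (cball (0 :: real ^ 'd) (real CARD('d) / real m))"
    using sm \<eta> by (intro density_prob_le[OF f1_density] less_imp_le[OF \<delta>(2)]) (auto simp: emeasure_lborel_cball_finite[unfolded infinity_ennreal_def])
  also have "\<dots> = \<eta> * W / real m ^ CARD('d)"
    by (simp add: content_cball W_def power_divide)
  finally have "1 / real (m + 1) ^ CARD('d) \<le> \<eta> * W / real m ^ CARD('d)" .
  moreover have "real (m + 1) ^ CARD('d) \<le> (2 * real m) ^ CARD('d)"
    using m0 by (intro power_mono) auto
  then have "1 / (2 * real m) ^ CARD('d) \<le> 1 / real (m + 1) ^ CARD('d)"
    by (intro divide_left_mono) (use m0 in auto)
  ultimately have "1 / (2 * real m) ^ CARD('d) \<le> \<eta> * W / real m ^ CARD('d)" by linarith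
  then have "1 \<le> \<eta> * W * 2 ^ CARD('d)"
    using m0 by (simp add: field_simps)
  moreover have "\<eta> * W * 2 ^ CARD('d) = W / (2 * (W + 1))" unfolding \<eta>_def by simp
  moreover have "W / (2 * (W + 1)) < 1" using \<open>0 \<le> W\<close> by (simp add: field_simps)
  ultimately show False by simp
qed


section \<open>Variance of sums over pairs of positions\<close>

lemma increments_uncorrelated:
  fixes g :: "real ^ 'd \<Rightarrow> real"
  assumes g[measurable]: "g \<in> borel_measurable borel" and M: "\<And>x. \<bar>g x\<bar> \<le> M"
    and disj: "{i, j} \<inter> {k, l} = {}"
  shows "expectation (\<lambda>v. g (U i v - U j v) * g (U k v - U l v))
    = expectation (\<lambda>v. g (U i v - U j v)) * expectation (\<lambda>v. g (U k v - U l v))"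
proof -
  have "indep_var (PiM {i, j} (\<lambda>_. borel)) (\<lambda>v. restrict (\<lambda>i. U i v) {i, j})
      (PiM {k, l} (\<lambda>_. borel)) (\<lambda>v. restrict (\<lambda>i. U i v) {k, l})"
    using disj by (intro indep_var_restrict[OF indep]) auto
  then have "indep_var borel ((\<lambda>x. g (x i - x j)) \<circ> (\<lambda>v. restrict (\<lambda>i. U i v) {i, j}))
      borel ((\<lambda>x. g (x k - x l)) \<circ> (\<lambda>v. restrict (\<lambda>i. U i v) {k, l}))"
    by (rule indep_var_compose) measurable
  then have "indep_var borel (\<lambda>v. g (U i v - U j v)) borel (\<lambda>v. g (U k v - U l v))"
    by (simp add: comp_def)
  moreover have "integrable P (\<lambda>v. g (U i v - U j v))" for i j
    using M by (intro integrable_const_bound[of _ M]) auto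
  ultimately show ?thesis by (intro indep_var_lebesgue_integral) auto
qed

text \<open>For a fixed pair, each of the four ways to share an index leaves n partners, and each of
  the two ways to coincide, equal or swapped, leaves one. The summands are nonnegative, so the count
  may run over the full square including the diagonal.\<close>

lemma pair_sum_bound:
  fixes a b :: real
  assumes "0 \<le> a" "0 \<le> b"
  shows "(\<Sum>(i, j) \<in> {(i, j). i < n \<and> j < n \<and> i \<noteq> j}. \<Sum>(k, l) \<in> {(k, l). k < n \<and> l < n \<and> k \<noteq> l}.
      a * (of_bool (i = k) + of_bool (i = l) + of_bool (j = k) + of_bool (j = l))
      + b * (of_bool (i = k \<and> j = l) + of_bool (i = l \<and> j = k)))
    \<le> 4 * a * real n ^ 3 + 2 * b * real n ^ 2"
proof -
  let ?A = "{(i, j). i < n \<and> j < n \<and> i \<noteq> (j :: nat)}" and ?S = "{..<n} \<times> {..<n}"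
  define f :: "nat \<times> nat \<Rightarrow> nat \<times> nat \<Rightarrow> real" where
    "f x y = a * (of_bool (fst x = fst y) + of_bool (fst x = snd y) + of_bool (snd x = fst y) + of_bool (snd x = snd y))
      + b * (of_bool (fst x = fst y \<and> snd x = snd y) + of_bool (fst x = snd y \<and> snd x = fst y))" for x y
  have delta: "(\<Sum>k<n. of_bool (i = k)) = (1 :: real)" if "i < n" for i
  proof -
    have "{..<n} \<inter> {k. i = k} = {i}" using that by auto
    then show ?thesis by simp
  qed
  have prod: "(\<Sum>y\<in>?S. u (fst y) * w (snd y)) = sum u {..<n} * sum w {..<n}" for u w :: "nat \<Rightarrow> real"
    unfolding sum_product sum.cartesian_product by (simp add: case_prod_unfold)
  have prod1: "(\<Sum>y\<in>?S. u (fst y)) = sum u {..<n} * real n" "(\<Sum>y\<in>?S. u (snd y)) = real n * sum u {..<n}"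
    for u :: "nat \<Rightarrow> real"
    using prod[of u "\<lambda>_. 1"] prod[of "\<lambda>_. 1" u] by simp_all
  have "(\<Sum>y\<in>?S. f x y) = 4 * a * real n + 2 * b" if "x \<in> ?S" for x
  proof -
    have x: "fst x < n" "snd x < n" using that by auto
    define u v :: "nat \<Rightarrow> real" where "u k = of_bool (fst x = k)" and "v k = of_bool (snd x = k)" for k
    have s: "sum u {..<n} = 1" "sum v {..<n} = 1" unfolding u_def v_def using delta x by auto
    have "(\<Sum>y\<in>?S. f x y) = (\<Sum>y\<in>?S. a * (u (fst y) + u (snd y) + v (fst y) + v (snd y))
        + b * (u (fst y) * v (snd y) + v (fst y) * u (snd y)))"
      unfolding f_def u_def v_def of_bool_conj by (simp add: mult.commute)
    also have "\<dots> = a * (real n + real n + real n + real n) + b * (1 + 1)"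
      unfolding sum.distrib sum_distrib_left[symmetric] prod prod1 s by simp
    finally show ?thesis by simp
  qed
  then have full: "(\<Sum>x\<in>?S. \<Sum>y\<in>?S. f x y) = (\<Sum>x\<in>?S. 4 * a * real n + 2 * b)"
    by (rule sum.cong[OF refl])
  have nn: "0 \<le> f x y" for x y
    unfolding f_def by (intro add_nonneg_nonneg mult_nonneg_nonneg assms) simp_all
  have sub: "?A \<subseteq> ?S" by auto
  have "(\<Sum>x\<in>?A. \<Sum>y\<in>?A. f x y) \<le> (\<Sum>x\<in>?A. \<Sum>y\<in>?S. f x y)"
    by (rule sum_mono, rule sum_mono2[OF _ sub nn]) simp
  also have "\<dots> \<le> (\<Sum>x\<in>?S. \<Sum>y\<in>?S. f x y)"
    by (rule sum_mono2[OF _ sub sum_nonneg[OF nn]]) simp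
  also have "\<dots> = 4 * a * real n ^ 3 + 2 * b * real n ^ 2"
    unfolding full by (simp add: power3_eq_cube power2_eq_square algebra_simps)
  finally show ?thesis unfolding f_def case_prod_unfold .
qed


text \<open>Covariances of disjoint pairs vanish by independence. Pairs sharing one index force two
  increments to be short, of probability O(q^(2 d)), and there are O(n^3) of them; equal or swapped
  pairs contribute O(q^d) each, with O(n^2) of them.\<close>

lemma pair_sum_variance:
  fixes g :: "real ^ 'd \<Rightarrow> real"
  assumes g[measurable]: "g \<in> borel_measurable borel" and M: "\<And>x. \<bar>g x\<bar> \<le> M"
    and supp: "\<And>x. \<rho> < norm x \<Longrightarrow> g x = 0" and "0 < \<rho>" and even: "\<And>x. g (- x) = g x"
  shows "\<exists>C>0. \<exists>\<delta>>0. \<forall>q n. 0 < q \<and> q < \<delta> \<longrightarrow>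
    expectation (\<lambda>v. ((\<Sum>(i, j) \<in> {(i, j). i < n \<and> j < n \<and> i \<noteq> j}. g ((U i v - U j v) /\<^sub>R q)
      - expectation (\<lambda>v. g ((U 0 v - U 1 v) /\<^sub>R q))))\<^sup>2)
    \<le> C * (real n ^ 3 * q ^ (2 * CARD('d)) + real n ^ 2 * q ^ CARD('d))"
proof -
  obtain C \<delta> where "0 < C" "0 < \<delta>"
    and one: "\<And>q i j. 0 < q \<Longrightarrow> q < \<delta> \<Longrightarrow> i \<noteq> j \<Longrightarrow> prob {v \<in> space P. norm (U i v - U j v) \<le> \<rho> * q} \<le> C * q ^ CARD('d)"
    and two: "\<And>q i j k. 0 < q \<Longrightarrow> q < \<delta> \<Longrightarrow> distinct [i, j, k] \<Longrightarrow>
      prob {v \<in> space P. norm (U i v - U j v) \<le> \<rho> * q \<and> norm (U i v - U k v) \<le> \<rho> * q} \<le> C * q ^ (2 * CARD('d))"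
    by (rule pair_prob_le[OF \<open>0 < \<rho>\<close>]) (rule that, assumption+)
  have "0 \<le> M" using M[of 0] by linarith
  define C' where "C' = 4 * (M\<^sup>2 * C) + 1"
  have "0 < C'" using \<open>0 < C\<close> by (simp add: C'_def add_nonneg_pos)
  have "expectation (\<lambda>v. ((\<Sum>(i, j) \<in> {(i, j). i < n \<and> j < n \<and> i \<noteq> j}. g ((U i v - U j v) /\<^sub>R q)
      - expectation (\<lambda>v. g ((U 0 v - U 1 v) /\<^sub>R q))))\<^sup>2)
    \<le> C' * (real n ^ 3 * q ^ (2 * CARD('d)) + real n ^ 2 * q ^ CARD('d))" if q: "0 < q" "q < \<delta>" for q n
  proof -
    define G where "G i j v = g ((U i v - U j v) /\<^sub>R q)" for i j v
    define m where "m = expectation (G 0 1)"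
    have Gm[measurable]: "G i j \<in> borel_measurable P" for i j unfolding G_def by measurable
    have GM: "\<bar>G i j v\<bar> \<le> M" for i j v by (simp add: G_def M)
    \<comment> \<open>Since g is even, the indices within a pair may be exchanged, so a shared index
      can be moved to the front of both pairs.\<close>
    have sym: "G i j = G j i" for i j
    proof
      fix v show "G i j v = G j i v"
        using even[of "(U j v - U i v) /\<^sub>R q"] unfolding G_def scaleR_minus_right[symmetric] minus_diff_eq .
    qed
    have Gi: "integrable P (G i j)" for i j by (rule integrable_const_bound[of _ M]) (use GM in auto)
    have GGi: "integrable P (\<lambda>v. G i j v * G k l v)" for i j k l
      by (rule integrable_const_bound[of _ "M * M"]) (use GM \<open>0 \<le> M\<close> in \<open>auto simp: abs_mult mult_mono\<close>)
    have mean: "expectation (G i j) = m" if "i \<noteq> j" for i j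
    proof -
      have "(\<integral>x. f1 x * g (x /\<^sub>R q) \<partial>lborel) = expectation (G i j)" if "i \<noteq> j" for i j
        unfolding G_def by (rule distributed_integral[OF f1_density[OF that]]) (auto simp: f1_nonneg)
      from this[OF that] this[of 0 1] show ?thesis unfolding m_def by simp
    qed
    have support: "G i j v \<noteq> 0 \<Longrightarrow> norm (U i v - U j v) \<le> \<rho> * q" for i j v
    proof (rule ccontr)
      assume nz: "G i j v \<noteq> 0" and "\<not> norm (U i v - U j v) \<le> \<rho> * q"
      then have "\<rho> < norm (U i v - U j v) / q" using q by (simp add: pos_less_divide_eq)
      then have "\<rho> < norm ((U i v - U j v) /\<^sub>R q)" using q by (simp add: divide_inverse mult.commute)
      then show False using supp nz unfolding G_def by blast
    qed
    have prod_le: "expectation (\<lambda>v. G i j v * G k l v) \<le> M\<^sup>2 * prob {v \<in> space P. norm (U i v - U j v) \<le> \<rho> * q \<and> norm (U k v - U l v) \<le> \<rho> * q}"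
      for i j k l
    proof -
      let ?S = "{v \<in> space P. norm (U i v - U j v) \<le> \<rho> * q \<and> norm (U k v - U l v) \<le> \<rho> * q}"
      have S[measurable]: "?S \<in> events" by measurable
      have "expectation (\<lambda>v. G i j v * G k l v) \<le> expectation (\<lambda>v. M\<^sup>2 * indicator ?S v)"
      proof (rule integral_mono[OF GGi])
        fix v assume "v \<in> space P"
        show "G i j v * G k l v \<le> M\<^sup>2 * indicator ?S v"
        proof (cases "v \<in> ?S")
          case True
          have "G i j v * G k l v \<le> \<bar>G i j v\<bar> * \<bar>G k l v\<bar>" by (simp flip: abs_mult)
          also have "\<dots> \<le> M * M" using GM \<open>0 \<le> M\<close> by (intro mult_mono) auto
          finally show ?thesis using True by (simp add: power2_eq_square)
        next
          case False
          then have "G i j v = 0 \<or> G k l v = 0" using support[of i j v] support[of k l v] \<open>v \<in> space P\<close> by blast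
          then show ?thesis using False by auto
        qed
      qed (use S in \<open>auto intro!: integrable_mult_right simp: integrable_indicator_iff less_top[symmetric]\<close>)
      also have "\<dots> = M\<^sup>2 * prob ?S" by simp
      finally show ?thesis .
    qed
    define a b where "a = M\<^sup>2 * (C * q ^ (2 * CARD('d)))" and "b = M\<^sup>2 * (C * q ^ CARD('d))"
    have ab: "0 \<le> a" "0 \<le> b" using q \<open>0 < C\<close> by (simp_all add: a_def b_def)
    have shared: "expectation (\<lambda>v. G i j v * G i l v) \<le> a" if "distinct [i, j, l]" for i j l
      using prod_le[of i j i l] mult_left_mono[OF two[OF q that], of "M\<^sup>2"] unfolding a_def by simp
    have same: "expectation (\<lambda>v. G i j v * G i j v) \<le> b" if "i \<noteq> j" for i j
      using prod_le[of i j i j] mult_left_mono[OF one[OF q that], of "M\<^sup>2"] unfolding b_def by simp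
    have cov: "expectation (\<lambda>v. (G i j v - m) * (G k l v - m))
        \<le> a * (of_bool (i = k) + of_bool (i = l) + of_bool (j = k) + of_bool (j = l))
          + b * (of_bool (i = k \<and> j = l) + of_bool (i = l \<and> j = k))" if ij: "i \<noteq> j" and kl: "k \<noteq> l" for i j k l
    proof -
      have "expectation (\<lambda>v. (G i j v - m) * (G k l v - m))
          = expectation (\<lambda>v. G i j v * G k l v - m * G i j v - m * G k l v + m * m)"
        by (rule arg_cong[where f = expectation]) (auto simp: algebra_simps fun_eq_iff)
      also have "\<dots> = expectation (\<lambda>v. G i j v * G k l v) - m * m"
        using GGi Gi mean[OF ij] mean[OF kl] by (simp add: prob_space)
      finally have eq: "expectation (\<lambda>v. (G i j v - m) * (G k l v - m)) = expectation (\<lambda>v. G i j v * G k l v) - m * m" .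
      have mm: "0 \<le> m * m" by simp
      define s1 s2 :: real where "s1 = of_bool (i = k) + of_bool (i = l) + of_bool (j = k) + of_bool (j = l)"
        and "s2 = of_bool (i = k \<and> j = l) + of_bool (i = l \<and> j = k)"
      have ob: "0 \<le> (of_bool p :: real)" "p \<Longrightarrow> of_bool p = (1 :: real)" for p by simp_all
      have s0: "0 \<le> s1" "0 \<le> s2" unfolding s1_def s2_def by (intro add_nonneg_nonneg ob(1))+
      have s: "0 \<le> a * s1" "0 \<le> b * s2" "1 \<le> s1 \<Longrightarrow> a \<le> a * s1" "1 \<le> s2 \<Longrightarrow> b \<le> b * s2"
        using s0 ab mult_left_mono[of 1 s1 a] mult_left_mono[of 1 s2 b] by auto
      have one: "1 \<le> s1" if "i = k \<or> i = l \<or> j = k \<or> j = l"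
        using that ob(1)[of "i = k"] ob(1)[of "i = l"] ob(1)[of "j = k"] ob(1)[of "j = l"]
          ob(2)[of "i = k"] ob(2)[of "i = l"] ob(2)[of "j = k"] ob(2)[of "j = l"] unfolding s1_def by linarith
      have two: "1 \<le> s2" if "i = k \<and> j = l \<or> i = l \<and> j = k"
        using that ob(1)[of "i = k \<and> j = l"] ob(1)[of "i = l \<and> j = k"]
          ob(2)[of "i = k \<and> j = l"] ob(2)[of "i = l \<and> j = k"] unfolding s2_def by linarith
      have "{i, j} \<inter> {k, l} = {} \<or> (i = k \<and> j = l) \<or> (i = l \<and> j = k) \<or> (i = k \<and> j \<noteq> l) \<or> (i = l \<and> j \<noteq> k)
          \<or> (j = k \<and> i \<noteq> l) \<or> (j = l \<and> i \<noteq> k)"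
        by auto
      then consider "{i, j} \<inter> {k, l} = {}" | "i = k" "j = l" | "i = l" "j = k" | "i = k" "j \<noteq> l" | "i = l" "j \<noteq> k"
        | "j = k" "i \<noteq> l" | "j = l" "i \<noteq> k" by (elim disjE conjE) simp_all
      \<comment> \<open>For disjoint pairs the term m * m is exact and cancels the subtracted square
        of the mean; for overlapping pairs it is nonnegative slack.\<close>
      then have "expectation (\<lambda>v. G i j v * G k l v) \<le> m * m + a * s1 + b * s2"
      proof cases
        case 1
        have "expectation (\<lambda>v. G i j v * G k l v) = expectation (G i j) * expectation (G k l)"
          unfolding G_def by (rule increments_uncorrelated[where g = "\<lambda>x. g (x /\<^sub>R q)"]) (measurable, rule M, rule 1)
        also have "\<dots> = m * m" unfolding mean[OF ij] mean[OF kl] ..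
        finally have "expectation (\<lambda>v. G i j v * G k l v) = m * m" .
        then show ?thesis using s(1,2) by linarith
      next
        case 2
        then have "expectation (\<lambda>v. G i j v * G k l v) \<le> b" using same[OF ij] by simp
        then show ?thesis using s(1) s(4)[OF two] mm 2 by linarith
      next
        case 3
        then have "expectation (\<lambda>v. G i j v * G k l v) \<le> b" using same[OF ij] sym[of j i] by simp
        then show ?thesis using s(1) s(4)[OF two] mm 3 by linarith
      next
        case 4
        then have "expectation (\<lambda>v. G i j v * G k l v) \<le> a" using shared[of i j l] ij kl by simp
        then show ?thesis using s(2) s(3)[OF one] mm 4 by linarith
      next
        case 5
        then have "expectation (\<lambda>v. G i j v * G k l v) \<le> a" using shared[of i j k] sym[of k i] ij kl by simp
        then show ?thesis using s(2) s(3)[OF one] mm 5 by linarith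
      next
        case 6
        then have "expectation (\<lambda>v. G i j v * G k l v) \<le> a" using shared[of j i l] sym[of i j] ij kl by simp
        then show ?thesis using s(2) s(3)[OF one] mm 6 by linarith
      next
        case 7
        then have "expectation (\<lambda>v. G i j v * G k l v) \<le> a" using shared[of j i k] sym[of i j] sym[of k j] ij kl by simp
        then show ?thesis using s(2) s(3)[OF one] mm 7 by linarith
      qed
      then show ?thesis unfolding eq s1_def s2_def by linarith
    qed
    let ?A = "{(i, j). i < n \<and> j < n \<and> i \<noteq> (j :: nat)}"
    have ci: "integrable P (\<lambda>v. (G i j v - m) * (G k l v - m))" for i j k l
    proof -
      have "integrable P (\<lambda>v. G i j v * G k l v - m * G i j v - m * G k l v + m * m)" using GGi Gi by simp
      then show ?thesis by (simp add: algebra_simps)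
    qed
    have "expectation (\<lambda>v. (\<Sum>(i, j)\<in>?A. G i j v - m)\<^sup>2)
        = expectation (\<lambda>v. \<Sum>(i, j)\<in>?A. \<Sum>(k, l)\<in>?A. (G i j v - m) * (G k l v - m))"
      unfolding power2_eq_square sum_product case_prod_unfold ..
    also have "\<dots> = (\<Sum>(i, j)\<in>?A. \<Sum>(k, l)\<in>?A. expectation (\<lambda>v. (G i j v - m) * (G k l v - m)))"
      unfolding case_prod_unfold
      by (subst Bochner_Integration.integral_sum, (intro Bochner_Integration.integrable_sum ci)[1])
        (intro sum.cong refl Bochner_Integration.integral_sum ci)
    also have "\<dots> \<le> (\<Sum>(i, j)\<in>?A. \<Sum>(k, l)\<in>?A.
        a * (of_bool (i = k) + of_bool (i = l) + of_bool (j = k) + of_bool (j = l))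
          + b * (of_bool (i = k \<and> j = l) + of_bool (i = l \<and> j = k)))"
      unfolding case_prod_unfold by (intro sum_mono cov) auto
    also have "\<dots> \<le> 4 * a * real n ^ 3 + 2 * b * real n ^ 2" by (rule pair_sum_bound[OF ab])
    also have "\<dots> \<le> C' * (real n ^ 3 * q ^ (2 * CARD('d)) + real n ^ 2 * q ^ CARD('d))"
    proof -
      let ?x = "real n ^ 3 * q ^ (2 * CARD('d))" and ?y = "real n ^ 2 * q ^ CARD('d)"
      have "4 * a * real n ^ 3 = 4 * (M\<^sup>2 * C) * ?x" "2 * b * real n ^ 2 = 2 * (M\<^sup>2 * C) * ?y"
        by (simp_all add: a_def b_def)
      moreover have nn: "0 \<le> ?x" "0 \<le> ?y" "0 \<le> M\<^sup>2 * C" using q \<open>0 < C\<close> by auto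
      have "4 * (M\<^sup>2 * C) \<le> C'" "2 * (M\<^sup>2 * C) \<le> C'" using nn(3) unfolding C'_def by linarith+
      then have "4 * (M\<^sup>2 * C) * ?x \<le> C' * ?x" "2 * (M\<^sup>2 * C) * ?y \<le> C' * ?y"
        using nn by (auto intro: mult_right_mono)
      ultimately show ?thesis unfolding distrib_left by linarith
    qed
    finally show ?thesis by (simp only: m_def G_def[abs_def])
  qed
  then show ?thesis using \<open>0 < C'\<close> \<open>0 < \<delta>\<close> by blast
qed


text \<open>Mean square error is variance plus squared bias. Divided by the square of n^2 q^d, the
  variance bound becomes 1 / n + 1 / (n^2 q^d), so it suffices that the expected number of close
  pairs tends to infinity, while n q^d may tend to zero.\<close>

lemma pair_sum_L2_limit:
  fixes g :: "real ^ 'd \<Rightarrow> real" and q :: "nat \<Rightarrow> real"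
  assumes g[measurable]: "g \<in> borel_measurable borel" and M: "\<And>x. \<bar>g x\<bar> \<le> M"
    and supp: "\<And>x. \<rho> < norm x \<Longrightarrow> g x = 0" and "0 < \<rho>" and even: "\<And>x. g (- x) = g x"
    and Fl: "Fl \<le> sequentially" and q: "filterlim q (at_right 0) Fl"
    and dense: "((\<lambda>n. 1 / (real n ^ 2 * q n ^ CARD('d))) \<longlongrightarrow> 0) Fl"
  shows "((\<lambda>n. expectation (\<lambda>v. ((\<Sum>(i, j) \<in> {(i, j). i < n \<and> j < n \<and> i \<noteq> j}. g ((U i v - U j v) /\<^sub>R q n))
      / (real n ^ 2 * q n ^ CARD('d)) - f1 0 * (\<integral>x. g x \<partial>lborel))\<^sup>2)) \<longlongrightarrow> 0) Fl"
proof -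
  obtain C \<delta> where "0 < C" "0 < \<delta>"
    and var: "\<And>q n. 0 < q \<Longrightarrow> q < \<delta> \<Longrightarrow>
      expectation (\<lambda>v. ((\<Sum>(i, j) \<in> {(i, j). i < n \<and> j < n \<and> i \<noteq> j}. g ((U i v - U j v) /\<^sub>R q)
        - expectation (\<lambda>v. g ((U 0 v - U 1 v) /\<^sub>R q))))\<^sup>2)
      \<le> C * (real n ^ 3 * q ^ (2 * CARD('d)) + real n ^ 2 * q ^ CARD('d))"
    using pair_sum_variance[OF g M supp \<open>0 < \<rho>\<close> even] by blast
  define \<mu> where "\<mu> = f1 0 * (\<integral>x. g x \<partial>lborel)"
  define m where "m n = expectation (\<lambda>v. g ((U 0 v - U 1 v) /\<^sub>R q n))" for n
  define S where "S n v = (\<Sum>(i, j) \<in> {(i, j). i < n \<and> j < n \<and> i \<noteq> j}. g ((U i v - U j v) /\<^sub>R q n))" for n v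
  define W where "W n = real n ^ 2 * q n ^ CARD('d)" for n
  have inv: "((\<lambda>n. 1 / real n) \<longlongrightarrow> 0) Fl"
    using lim_1_over_n Fl by (rule tendsto_mono[rotated])
  have m: "((\<lambda>n. m n / q n ^ CARD('d)) \<longlongrightarrow> \<mu>) Fl"
    unfolding m_def \<mu>_def by (rule filterlim_compose[OF lag_expectation_limit[OF g M supp \<open>0 < \<rho>\<close>] q]) auto
  have ev: "\<forall>\<^sub>F n in Fl. 0 < q n \<and> q n < \<delta>"
    using q \<open>0 < \<delta>\<close> by (auto simp: filterlim_at_right_to_0 filterlim_at eventually_conj_iff
        intro!: order_tendstoD(2)[of q 0] elim: eventually_mono)
  have ev2: "\<forall>\<^sub>F n in Fl. 2 \<le> n"
    using Fl eventually_ge_at_top[of 2] by (auto simp: le_filter_def)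
  \<comment> \<open>Twice the bound on the variance plus twice the squared bias. The factor 1 - 1 /
    n comes from counting n^2 - n ordered pairs but normalising by n^2.\<close>
  define bd where "bd n = 2 * (C * (1 / real n) + C * (1 / W n)) + 2 * ((1 - 1 / real n) * (m n / q n ^ CARD('d)) - \<mu>)\<^sup>2" for n
  have "(bd \<longlongrightarrow> 2 * (C * 0 + C * 0) + 2 * ((1 - 0) * \<mu> - \<mu>)\<^sup>2) Fl"
    unfolding bd_def using dense by (intro tendsto_intros inv m) (simp add: W_def)
  then have bd: "(bd \<longlongrightarrow> 0) Fl" by simp
  have "\<forall>\<^sub>F n in Fl. expectation (\<lambda>v. (S n v / W n - \<mu>)\<^sup>2) \<le> bd n"
    using ev ev2
  proof eventually_elim
    case (elim n)
    then have n: "0 < real n" and qn: "0 < q n" "q n < \<delta>" by auto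
    have W: "0 < W n" using n qn by (simp add: W_def)
    let ?A = "{(i, j). i < n \<and> j < n \<and> i \<noteq> (j :: nat)}"
    have "?A = {..<n} \<times> {..<n} - (\<lambda>i. (i, i)) ` {..<n}" by auto
    also have "card \<dots> = card ({..<n} \<times> {..<n}) - card ((\<lambda>i. (i, i)) ` {..<n})"
      by (rule card_Diff_subset) auto
    also have "\<dots> = n * n - n" by (simp add: card_image inj_on_def)
    finally have cA: "real (card ?A) = real n * real n - real n" using n by (simp add: of_nat_diff)
    have Sm[measurable]: "S n \<in> borel_measurable P" unfolding S_def case_prod_unfold by measurable
    have Sb: "\<bar>S n v\<bar> \<le> real (card ?A) * M" for v
      unfolding S_def by (rule order_trans[OF sum_abs sum_bounded_above]) (use M in auto)
    have "0 \<le> M" using M[of 0] by linarith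
    have split: "(\<Sum>(i, j) \<in> ?A. g ((U i v - U j v) /\<^sub>R q n) - m n) = S n v - real (card ?A) * m n" for v
      by (simp add: S_def case_prod_unfold sum_subtractf)
    define t where "t = real (card ?A) * m n"
    have V: "expectation (\<lambda>v. (S n v - t)\<^sup>2) \<le> C * (real n ^ 3 * q n ^ (2 * CARD('d)) + real n ^ 2 * q n ^ CARD('d))"
      using var[OF qn, of n] unfolding m_def[symmetric] split t_def .
    have int: "integrable P (\<lambda>v. (S n v - t)\<^sup>2)"
    proof (rule integrable_const_bound[of _ "(real (card ?A) * M + \<bar>t\<bar>)\<^sup>2"])
      show "AE v in P. norm ((S n v - t)\<^sup>2) \<le> (real (card ?A) * M + \<bar>t\<bar>)\<^sup>2"
      proof (rule AE_I2)
        fix v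
        have "\<bar>S n v - t\<bar> \<le> real (card ?A) * M + \<bar>t\<bar>" using Sb[of v] by linarith
        then show "norm ((S n v - t)\<^sup>2) \<le> (real (card ?A) * M + \<bar>t\<bar>)\<^sup>2"
          using power_mono[of "\<bar>S n v - t\<bar>" _ 2] by simp
      qed
    qed simp
    have "expectation (\<lambda>v. (S n v / W n - \<mu>)\<^sup>2) \<le> expectation (\<lambda>v. 2 / (W n)\<^sup>2 * (S n v - t)\<^sup>2 + 2 * (t / W n - \<mu>)\<^sup>2)"
    proof (rule integral_mono')
      show "integrable P (\<lambda>v. 2 / (W n)\<^sup>2 * (S n v - t)\<^sup>2 + 2 * (t / W n - \<mu>)\<^sup>2)" using int by simp
      fix v
      have "(x + y)\<^sup>2 \<le> 2 * x\<^sup>2 + 2 * y\<^sup>2" for x y :: real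
        using zero_le_power2[of "x - y"] by (simp add: power2_eq_square algebra_simps)
      moreover have "(S n v - t) / W n + (t / W n - \<mu>) = S n v / W n - \<mu>" by (simp add: diff_divide_distrib)
      ultimately have "(S n v / W n - \<mu>)\<^sup>2 \<le> 2 * ((S n v - t) / W n)\<^sup>2 + 2 * (t / W n - \<mu>)\<^sup>2" by metis
      then show "(S n v / W n - \<mu>)\<^sup>2 \<le> 2 / (W n)\<^sup>2 * (S n v - t)\<^sup>2 + 2 * (t / W n - \<mu>)\<^sup>2"
        unfolding power_divide by simp
    qed simp
    also have "\<dots> = 2 / (W n)\<^sup>2 * expectation (\<lambda>v. (S n v - t)\<^sup>2) + 2 * (t / W n - \<mu>)\<^sup>2"
      using int by (simp add: prob_space)
    also have "\<dots> \<le> 2 / (W n)\<^sup>2 * (C * (real n ^ 3 * q n ^ (2 * CARD('d)) + real n ^ 2 * q n ^ CARD('d))) + 2 * (t / W n - \<mu>)\<^sup>2"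
      using V by (intro add_right_mono mult_left_mono) auto
    also have "2 / (W n)\<^sup>2 * (C * (real n ^ 3 * q n ^ (2 * CARD('d)) + real n ^ 2 * q n ^ CARD('d))) = 2 * (C * (1 / real n) + C * (1 / W n))"
    proof -
      have "real n ^ 3 * q n ^ (2 * CARD('d)) = (W n)\<^sup>2 / real n"
        using n by (simp add: W_def power_mult_distrib power_mult mult.commute[of 2] field_simps eval_nat_numeral power_add)
      note e1 = this
      have e2: "real n ^ 2 * q n ^ CARD('d) = (W n)\<^sup>2 / W n"
        using W unfolding W_def[symmetric] by (simp add: power2_eq_square)
      show ?thesis unfolding e1 e2 using W n by (simp add: field_simps)
    qed
    also have "t / W n = (1 - 1 / real n) * (m n / q n ^ CARD('d))"
      using n qn unfolding t_def cA W_def by (simp add: field_simps power2_eq_square)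
    finally show ?case by (simp add: bd_def)
  qed
  then show ?thesis
    unfolding S_def W_def \<mu>_def
    by (intro tendsto_sandwich[OF _ _ tendsto_const bd]) (auto intro!: always_eventually)
qed

end

section \<open>Law of large numbers for the lag moments\<close>

lemma lag_kernel_bounds:
  fixes K :: "real \<Rightarrow> real"
  assumes K: "is_kernel K R" and "0 < b"
  obtains M where "\<And>x :: real ^ 'd. \<bar>lag_kernel K b p x\<bar> \<le> M"
    "\<And>x :: real ^ 'd. b * R < norm x \<Longrightarrow> lag_kernel K b p x = 0"
proof -
  obtain M where M: "\<And>s. \<bar>K s\<bar> \<le> M" using K by (auto simp: is_kernel_def bounded_iff)
  have "0 \<le> M" using M[of 0] by linarith
  have R: "0 < R" using K by (simp add: is_kernel_def)
  have z: "lag_kernel K b p x = 0" if "b * R < norm x" for x :: "real ^ 'd"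
  proof -
    have "R < norm x / b" using that \<open>0 < b\<close> by (simp add: pos_less_divide_eq mult.commute)
    then show ?thesis using K by (simp add: lag_kernel_def is_kernel_def)
  qed
  have "\<bar>lag_kernel K b p x\<bar> \<le> M * (b * R) ^ p" for x :: "real ^ 'd"
  proof (cases "b * R < norm x")
    case False
    then show ?thesis unfolding lag_kernel_def abs_mult using M \<open>0 \<le> M\<close>
      by (intro mult_mono) (auto intro: power_mono)
  qed (use z \<open>0 \<le> M\<close> \<open>0 < b\<close> R in simp)
  with z show thesis using that by blast
qed

lemma lag_kernel_measurable:
  assumes "is_kernel K R"
  shows "lag_kernel K b p \<in> borel_measurable borel"
proof -
  have [measurable]: "K \<in> borel_measurable borel" using assms by (simp add: is_kernel_def)
  show ?thesis unfolding lag_kernel_def[abs_def] by measurable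
qed

text \<open>The normaliser n^2 q^d is, up to a constant, the expected number of pairs at distance of
  order q in the unit cube. With positions scaled by l and q = h / l, the quotient of the values at
  p and at 0 is a normalised lag moment.\<close>

definition pair_mean :: "(real \<Rightarrow> real) \<Rightarrow> nat \<Rightarrow> real \<Rightarrow> (nat \<Rightarrow> real ^ 'd) \<Rightarrow> real \<Rightarrow> nat \<Rightarrow> real" where
  "pair_mean K n q u b p = (\<Sum>(i, j) \<in> {(i, j). i < n \<and> j < n \<and> i \<noteq> j}. lag_kernel K b p ((u i - u j) /\<^sub>R q))
     / (real n ^ 2 * q ^ CARD('d))"

lemma kweight_eq_pair_mean:
  fixes u :: "nat \<Rightarrow> real ^ 'd"
  assumes "0 < l" "0 < h" "0 < n"
  shows "kweight K n (\<lambda>i. l *\<^sub>R u i) (b * h) (\<lambda>i j. dist (l *\<^sub>R u i) (l *\<^sub>R u j) ^ p)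
    = h ^ p * (real n ^ 2 * (h / l) ^ CARD('d)) * pair_mean K n (h / l) u b p"
proof -
  have "K (dist (l *\<^sub>R u i) (l *\<^sub>R u j) / (b * h)) * dist (l *\<^sub>R u i) (l *\<^sub>R u j) ^ p
      = h ^ p * lag_kernel K b p ((u i - u j) /\<^sub>R (h / l))" for i j
  proof -
    have n: "norm ((u i - u j) /\<^sub>R (h / l)) = dist (l *\<^sub>R u i) (l *\<^sub>R u j) / h"
      using assms by (simp add: dist_norm scaleR_diff_right[symmetric] divide_inverse mult_ac)
    show ?thesis unfolding lag_kernel_def n using assms
      by (simp add: power_divide mult.commute[of b h])
  qed
  then have "kweight K n (\<lambda>i. l *\<^sub>R u i) (b * h) (\<lambda>i j. dist (l *\<^sub>R u i) (l *\<^sub>R u j) ^ p)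
      = h ^ p * (\<Sum>(i, j) \<in> {(i, j). i < n \<and> j < n \<and> i \<noteq> j}. lag_kernel K b p ((u i - u j) /\<^sub>R (h / l)))"
    unfolding kweight_def case_prod_unfold sum_distrib_left by (simp only:)
  then show ?thesis using assms unfolding pair_mean_def by simp
qed

lemma lag_mom_eq_pair_mean:
  fixes u :: "nat \<Rightarrow> real ^ 'd"
  assumes "0 < l" "0 < h" "0 < n"
  shows "lag_mom K n (\<lambda>i. l *\<^sub>R u i) p (b * h) / h ^ p = pair_mean K n (h / l) u b p / pair_mean K n (h / l) u b 0"
  using kweight_eq_pair_mean[OF assms, of K u b p] kweight_eq_pair_mean[OF assms, of K u b 0] assms
  unfolding lag_mom_def kavg_def by simp

context sampling
begin

text \<open>Markov's inequality at the level \<open>sqrt (D n)\<close>, where D dominates the mean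
  of the summed squared deviations, has failure probability at most \<open>sqrt (D n)\<close> and
  leaves deviations that tend to zero uniformly on the event. The uniformity is encoded as a limit
  along the filter of pairs (n, v) with v in \<open>A n\<close>.\<close>

lemma uniform_convergence_events:
  fixes Z :: "'c \<Rightarrow> nat \<Rightarrow> 'v \<Rightarrow> real" and \<mu> :: "'c \<Rightarrow> real"
  assumes "finite I" and Zm[measurable]: "\<And>c n. Z c n \<in> borel_measurable P"
    and Zi: "\<And>c n. integrable P (\<lambda>v. (Z c n v - \<mu> c)\<^sup>2)"
    and lim: "\<And>c. c \<in> I \<Longrightarrow> ((\<lambda>n. expectation (\<lambda>v. (Z c n v - \<mu> c)\<^sup>2)) \<longlongrightarrow> 0) Fl" and Fl: "Fl \<le> sequentially"
  obtains A where "\<And>n. A n \<in> events" "((\<lambda>n. prob (A n)) \<longlongrightarrow> 1) Fl"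
    "\<And>c. c \<in> I \<Longrightarrow> ((\<lambda>x. Z c (fst x) (snd x)) \<longlongrightarrow> \<mu> c) (inf (filtercomap fst Fl) (principal {x. snd x \<in> A (fst x)}))"
proof -
  define Y where "Y n v = (\<Sum>c\<in>I. (Z c n v - \<mu> c)\<^sup>2)" for n v
  have [measurable]: "Y n \<in> borel_measurable P" for n unfolding Y_def by measurable
  have Yi: "integrable P (Y n)" for n unfolding Y_def using Zi by (intro Bochner_Integration.integrable_sum) auto
  have Y0: "0 \<le> Y n v" for n v unfolding Y_def by (intro sum_nonneg) auto
  \<comment> \<open>The summand 1 / (n + 1) keeps D positive, so that division by
    \<open>sqrt (D n)\<close> is legitimate even where all deviations vanish.\<close>
  define D where "D n = expectation (Y n) + 1 / (real n + 1)" for n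
  have D0: "0 < D n" for n unfolding D_def using Y0 by (intro add_nonneg_pos) auto
  have "((\<lambda>n. (\<Sum>c\<in>I. expectation (\<lambda>v. (Z c n v - \<mu> c)\<^sup>2)) + 1 / (real n + 1)) \<longlongrightarrow> (\<Sum>c\<in>I. 0) + 0) Fl"
  proof (intro tendsto_add tendsto_sum lim)
    have "(\<lambda>n. 1 / (real n + 1)) \<longlonglongrightarrow> 0" using LIMSEQ_inverse_real_of_nat by (simp add: inverse_eq_divide add.commute)
    then show "((\<lambda>n. 1 / (real n + 1)) \<longlongrightarrow> 0) Fl" by (rule tendsto_mono[OF Fl])
  qed
  then have D: "(D \<longlongrightarrow> 0) Fl"
    unfolding D_def Y_def using Zi by simp
  define A where "A n = {v \<in> space P. Y n v < sqrt (D n)}" for n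
  have A[measurable]: "A n \<in> events" for n unfolding A_def by measurable
  have sD: "((\<lambda>n. sqrt (D n)) \<longlongrightarrow> 0) Fl" using tendsto_real_sqrt[OF D] by simp
  have ge: "1 - sqrt (D n) \<le> prob (A n)" for n
  proof -
    have "prob {v \<in> space P. sqrt (D n) \<le> Y n v} \<le> expectation (Y n) / sqrt (D n)"
      by (rule integral_Markov_inequality_measure[OF Yi sets.empty_sets]) (use Y0 D0[of n] in auto)
    also have "\<dots> \<le> D n / sqrt (D n)" using D0[of n] by (intro divide_right_mono) (simp_all add: D_def)
    also have "\<dots> = sqrt (D n)" using D0[of n] by (simp add: real_div_sqrt)
    finally have "prob {v \<in> space P. sqrt (D n) \<le> Y n v} \<le> sqrt (D n)" .
    moreover have "prob (A n) = 1 - prob {v \<in> space P. sqrt (D n) \<le> Y n v}"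
    proof -
      have "A n = space P - {v \<in> space P. sqrt (D n) \<le> Y n v}" by (auto simp: A_def)
      then show ?thesis by (simp add: prob_compl)
    qed
    ultimately show ?thesis by simp
  qed
  have pA: "((\<lambda>n. prob (A n)) \<longlongrightarrow> 1) Fl"
  proof (rule tendsto_sandwich[where h = "\<lambda>_. 1" and f = "\<lambda>n. 1 - sqrt (D n)"])
    show "((\<lambda>n. 1 - sqrt (D n)) \<longlongrightarrow> 1) Fl" using tendsto_diff[OF tendsto_const sD, of 1] by simp
  qed (use ge in auto)
  have "((\<lambda>x. Z c (fst x) (snd x)) \<longlongrightarrow> \<mu> c) (inf (filtercomap fst Fl) (principal {x. snd x \<in> A (fst x)}))"
    if "c \<in> I" for c
  proof (rule tendstoI)
    fix e :: real assume "0 < e"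
    have "\<forall>\<^sub>F n in Fl. sqrt (D n) < e\<^sup>2" by (rule order_tendstoD(2)[OF sD]) (use \<open>0 < e\<close> in simp)
    then have "\<forall>\<^sub>F x in filtercomap fst Fl. sqrt (D (fst (x :: nat \<times> 'v))) < e\<^sup>2" by (rule eventually_filtercomapI)
    then show "\<forall>\<^sub>F x in inf (filtercomap fst Fl) (principal {x. snd x \<in> A (fst x)}). dist (Z c (fst x) (snd x)) (\<mu> c) < e"
      unfolding eventually_inf_principal
    proof eventually_elim
      case (elim x)
      show ?case
      proof
        assume "x \<in> {x. snd x \<in> A (fst x)}"
        then have "Y (fst x) (snd x) < e\<^sup>2" using elim by (simp add: A_def)
        moreover have "(Z c (fst x) (snd x) - \<mu> c)\<^sup>2 \<le> Y (fst x) (snd x)"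
          unfolding Y_def by (rule member_le_sum[OF that]) (use \<open>finite I\<close> in auto)
        ultimately have "\<bar>Z c (fst x) (snd x) - \<mu> c\<bar>\<^sup>2 < e\<^sup>2" by simp
        then show "dist (Z c (fst x) (snd x)) (\<mu> c) < e"
          unfolding dist_real_def
          using power2_less_imp_less[of "\<bar>Z c (fst x) (snd x) - \<mu> c\<bar>" e] \<open>0 < e\<close> by linarith
      qed
    qed
  qed
  with A pA show thesis by (rule that[of A])
qed

text \<open>One sequence of events serves all three bandwidths and all powers 0, 2, 4, 6, the power
  0 being the total weight in the denominators. Along the filter of pairs (n, v) the deterministic
  limit applies, and it unfolds to a statement uniform over \<open>A n\<close>.\<close>

lemma curv_err_uniform_limit:
  fixes K :: "real \<Rightarrow> real" and l h :: "nat \<Rightarrow> real"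
  assumes K: "is_kernel K R" and d: "2 \<le> CARD('d)" and \<kappa>: "0 < \<kappa>" "\<kappa> < 1"
    and F: "order6_expansion F \<alpha> \<beta> \<gamma>"
    and Fl: "Fl \<le> sequentially" and h: "\<And>n. 0 < h n" "(h \<longlongrightarrow> 0) Fl" and l: "\<forall>\<^sub>F n in Fl. 0 < l n"
    and q: "((\<lambda>n. h n / l n) \<longlongrightarrow> 0) Fl"
    and dense: "((\<lambda>n. 1 / (real n ^ 2 * (h n / l n) ^ CARD('d))) \<longlongrightarrow> 0) Fl"
  obtains A where "\<And>n. A n \<in> events" "((\<lambda>n. prob (A n)) \<longlongrightarrow> 1) Fl"
    "\<And>e. 0 < e \<Longrightarrow> \<forall>\<^sub>F n in Fl. \<forall>v\<in>A n. well_conditioned \<kappa> K R n (\<lambda>i. l n *\<^sub>R U i v) (h n) \<and>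
      \<bar>curv_err K n (\<lambda>i. l n *\<^sub>R U i v) (h n) F / h n ^ 6
        - (- 24 * real CARD('d) * (real CARD('d) + 4) * \<gamma> * (Bmom K R CARD('d) 6 - Bmom K R CARD('d) 4 powr (3 / 2)))\<bar> < e"
proof -
  define I where "I = {1, sqrt 2, 2 :: real} \<times> {0, 2, 4, 6 :: nat}"
  define Z where "Z c n v = pair_mean K n (h n / l n) (\<lambda>i. U i v) (fst c) (snd c)" for c :: "real \<times> nat" and n v
  define \<mu> where "\<mu> c = f1 0 * (\<integral>x. lag_kernel K (fst c) (snd c) (x :: real ^ 'd) \<partial>lborel)" for c :: "real \<times> nat"
  have R: "0 < R" using K by (simp add: is_kernel_def)
  have [measurable]: "K \<in> borel_measurable borel" using K by (simp add: is_kernel_def)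
  have lm[measurable]: "(lag_kernel K b p :: real ^ 'd \<Rightarrow> real) \<in> borel_measurable borel" for b p using K by (rule lag_kernel_measurable)
  have bpos: "0 < b" if "b \<in> {1, sqrt 2, 2 :: real}" for b using that by auto
  have Ipos: "0 < fst c" if "c \<in> I" for c
    using that bpos[of "fst c"] unfolding I_def by (metis mem_Sigma_iff prod.collapse)
  have \<mu>: "\<mu> (b, p) = f1 0 * (unit_ball_vol (real CARD('d)) * real CARD('d) * (b ^ (CARD('d) + p) * kmom K R (CARD('d) + p)))"
    if "0 < b" for b p
    using lag_kernel_integral[OF K that, of p, where 'd = 'd] by (simp add: \<mu>_def)
  have kp: "0 < kmom K R (CARD('d) + p)" for p
  proof -
    have "CARD('d) + p = Suc (CARD('d) + p - 1)" using zero_less_card_finite[where 'a = 'd] by linarith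
    with kmom_pos[OF K, of "CARD('d) + p - 1"] show ?thesis by (simp only:)
  qed
  have V: "0 < unit_ball_vol (real CARD('d)) * real CARD('d)" by (simp add: unit_ball_vol_pos)
  have q0: "filterlim (\<lambda>n. h n / l n) (at_right 0) Fl"
    unfolding filterlim_at
  proof
    show "\<forall>\<^sub>F n in Fl. h n / l n \<in> {0<..} \<and> h n / l n \<noteq> 0"
      using l by eventually_elim (use h(1) in \<open>simp add: less_imp_neq[symmetric] less_imp_neq\<close>)
  qed (rule q)
  have Zm: "Z c n \<in> borel_measurable P" for c n
    unfolding Z_def[abs_def] pair_mean_def case_prod_unfold by measurable
  obtain A where A: "\<And>n. A n \<in> events" "((\<lambda>n. prob (A n)) \<longlongrightarrow> 1) Fl"
    and unif: "\<And>c. c \<in> I \<Longrightarrow> ((\<lambda>x. Z c (fst x) (snd x)) \<longlongrightarrow> \<mu> c) (inf (filtercomap fst Fl) (principal {x. snd x \<in> A (fst x)}))"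
  \<comment> \<open>For nonpositive b the family takes its limit as default value, because
    measurability and integrability are asked for all indices while kernel bounds are available for
    positive b.\<close>
  proof (rule uniform_convergence_events[of I "\<lambda>c n v. if 0 < fst c then Z c n v else \<mu> c" \<mu> Fl])
    show "finite I" by (simp add: I_def)
    show "Fl \<le> sequentially" by (rule Fl)
    show "(\<lambda>v. if 0 < fst c then Z c n v else \<mu> c) \<in> borel_measurable P" for c n using Zm by simp
    show "integrable P (\<lambda>v. ((if 0 < fst c then Z c n v else \<mu> c) - \<mu> c)\<^sup>2)" for c n
    proof (cases "0 < fst c")
      case True
      obtain M where M: "\<And>x :: real ^ 'd. \<bar>lag_kernel K (fst c) (snd c) x\<bar> \<le> M" using lag_kernel_bounds[OF K True] by metis
      define m where "m = real (card {(i, j). i < n \<and> j < n \<and> i \<noteq> j}) * M / \<bar>real n ^ 2 * (h n / l n) ^ CARD('d)\<bar>"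
      have Zb: "\<bar>Z c n v\<bar> \<le> m" for v
        unfolding Z_def pair_mean_def m_def abs_divide
        by (intro divide_right_mono order_trans[OF sum_abs sum_bounded_above]) (use M in auto)
      have "integrable P (\<lambda>v. (Z c n v - \<mu> c)\<^sup>2)"
      proof (rule integrable_const_bound[of _ "(m + \<bar>\<mu> c\<bar>)\<^sup>2"])
        show "AE v in P. norm ((Z c n v - \<mu> c)\<^sup>2) \<le> (m + \<bar>\<mu> c\<bar>)\<^sup>2"
        proof (rule AE_I2)
          fix v
          have "\<bar>Z c n v - \<mu> c\<bar> \<le> m + \<bar>\<mu> c\<bar>" using Zb[of v] by linarith
          then show "norm ((Z c n v - \<mu> c)\<^sup>2) \<le> (m + \<bar>\<mu> c\<bar>)\<^sup>2"
            using power_mono[of "\<bar>Z c n v - \<mu> c\<bar>" _ 2] by simp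
        qed
      qed (use Zm in simp)
      with True show ?thesis by simp
    qed simp
    show "((\<lambda>n. expectation (\<lambda>v. ((if 0 < fst c then Z c n v else \<mu> c) - \<mu> c)\<^sup>2)) \<longlongrightarrow> 0) Fl" if "c \<in> I" for c
    proof -
      have b: "0 < fst c" using that by (rule Ipos)
      obtain M where M: "\<And>x :: real ^ 'd. \<bar>lag_kernel K (fst c) (snd c) x\<bar> \<le> M"
        "\<And>x :: real ^ 'd. fst c * R < norm x \<Longrightarrow> lag_kernel K (fst c) (snd c) x = 0"
        by (rule lag_kernel_bounds[OF K b]) (rule that, assumption+)
      have "((\<lambda>n. expectation (\<lambda>v. (Z c n v - \<mu> c)\<^sup>2)) \<longlongrightarrow> 0) Fl"
        unfolding Z_def \<mu>_def pair_mean_def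
      proof (rule pair_sum_L2_limit[OF lm[of "fst c" "snd c"] M _ _ Fl q0 dense])
        show "0 < fst c * R" using b R by simp
        show "lag_kernel K (fst c) (snd c) (- x) = lag_kernel K (fst c) (snd c) x" for x :: "real ^ 'd"
          by (simp add: lag_kernel_def)
      qed
      with b show ?thesis by simp
    qed
    fix A assume *: "\<And>n. A n \<in> events" "((\<lambda>n. prob (A n)) \<longlongrightarrow> 1) Fl"
      "\<And>c. c \<in> I \<Longrightarrow> ((\<lambda>x. if 0 < fst c then Z c (fst x) (snd x) else \<mu> c) \<longlongrightarrow> \<mu> c) (inf (filtercomap fst Fl) (principal {x. snd x \<in> A (fst x)}))"
    have "((\<lambda>x. Z c (fst x) (snd x)) \<longlongrightarrow> \<mu> c) (inf (filtercomap fst Fl) (principal {x. snd x \<in> A (fst x)}))" if "c \<in> I" for c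
      using *(3)[OF that] Ipos[OF that] by simp
    with *(1,2) show thesis by (rule that[of A])
  qed
  define G where "G = inf (filtercomap fst Fl) (principal {x. snd x \<in> A (fst x)})"
  have lift: "\<forall>\<^sub>F x in G. Q (fst x)" if "\<forall>\<^sub>F n in Fl. Q n" for Q
    unfolding G_def eventually_inf_principal using eventually_filtercomapI[OF that, of fst] by (rule eventually_mono) simp
  have unif: "((\<lambda>x. pair_mean K (fst x) (h (fst x) / l (fst x)) (\<lambda>i. U i (snd x)) b p) \<longlongrightarrow> \<mu> (b, p)) G"
    if "b \<in> {1, sqrt 2, 2}" "p \<in> {0, 2, 4, 6}" for b p
    using unif[of "(b, p)", unfolded I_def, OF SigmaI[OF that]] unfolding Z_def G_def fst_conv snd_conv .
  have "\<forall>\<^sub>F n in Fl. 0 < n" using Fl eventually_gt_at_top[of 0] by (auto simp: le_filter_def)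
  with l have good: "\<forall>\<^sub>F x in G. 0 < l (fst x) \<and> 0 < fst x" using lift[of "\<lambda>n. 0 < l n \<and> 0 < n"] by (simp add: eventually_conj)
  have hG: "\<forall>\<^sub>F x in G. 0 < h (fst x)" using h by simp
  have \<mu>0: "0 < \<mu> (b, 0)" if "b \<in> {1, sqrt 2, 2}" for b
    using \<mu>[OF bpos[OF that], of 0] kp[of 0] V f1_pos bpos[OF that] by simp
  have ratio: "((\<lambda>x. lag_mom K (fst x) (\<lambda>i. l (fst x) *\<^sub>R U i (snd x)) p (b * h (fst x)) / h (fst x) ^ p)
      \<longlongrightarrow> b ^ p * Bmom K R CARD('d) p) G" if b: "b \<in> {1, sqrt 2, 2}" and p: "p \<in> {2, 4, 6}" for b p
  proof -
    have "((\<lambda>x. pair_mean K (fst x) (h (fst x) / l (fst x)) (\<lambda>i. U i (snd x)) b p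
        / pair_mean K (fst x) (h (fst x) / l (fst x)) (\<lambda>i. U i (snd x)) b 0) \<longlongrightarrow> \<mu> (b, p) / \<mu> (b, 0)) G"
      using unif[OF b] p \<mu>0[OF b] by (intro tendsto_divide) auto
    also have "\<mu> (b, p) / \<mu> (b, 0) = b ^ p * Bmom K R CARD('d) p"
      using kp[of 0] V[THEN less_imp_neq] f1_pos bpos[OF b] unfolding \<mu>[OF bpos[OF b]] Bmom_def
      by (simp add: power_add field_simps)
    finally show ?thesis
      by (rule Lim_transform_eventually) (use good in \<open>auto elim!: eventually_mono simp: lag_mom_eq_pair_mean[OF _ h(1)]\<close>)
  qed
  have weight: "\<forall>\<^sub>F x in G. 0 < kweight K (fst x) (\<lambda>i. l (fst x) *\<^sub>R U i (snd x)) (b * h (fst x)) (\<lambda>_ _. 1)"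
    if b: "b \<in> {1, sqrt 2, 2}" for b
  proof -
    have "\<forall>\<^sub>F x in G. 0 < pair_mean K (fst x) (h (fst x) / l (fst x)) (\<lambda>i. U i (snd x)) b 0"
      by (rule order_tendstoD(1)[OF unif[OF b]]) (use \<mu>0[OF b] in auto)
    then show ?thesis using good
    proof eventually_elim
      case (elim x)
      then show ?case
        using kweight_eq_pair_mean[of "l (fst x)" "h (fst x)" "fst x" K "\<lambda>i. U i (snd x)" b 0] h(1)[of "fst x"] by simp
    qed
  qed
  note wc = well_conditioned_eventually[OF K d hG ratio \<kappa> weight, simplified]
  have h0: "((\<lambda>x. h (fst x)) \<longlongrightarrow> 0) G"
    by (rule tendstoI) (use lift tendstoD[OF h(2)] in auto)
  note lim = curv_err_limit[OF K d hG ratio \<kappa>(1) wc h0 F]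
  show thesis
  proof (rule that[of A, OF A])
    fix e :: real assume "0 < e"
    from eventually_conj[OF wc tendstoD[OF lim this]]
    show "\<forall>\<^sub>F n in Fl. \<forall>v\<in>A n. well_conditioned \<kappa> K R n (\<lambda>i. l n *\<^sub>R U i v) (h n) \<and>
      \<bar>curv_err K n (\<lambda>i. l n *\<^sub>R U i v) (h n) F / h n ^ 6
        - (- 24 * real CARD('d) * (real CARD('d) + 4) * \<gamma> * (Bmom K R CARD('d) 6 - Bmom K R CARD('d) 4 powr (3 / 2)))\<bar> < e"
      unfolding G_def eventually_inf_principal eventually_filtercomap dist_real_def
      by (auto elim!: eventually_mono)
  qed
qed

end

section \<open>Integration over field and positions\<close>

lemma curv_sum: "finite I \<Longrightarrow> curv K n s h (\<lambda>i j. \<Sum>k\<in>I. A k i j) = (\<Sum>k\<in>I. curv K n s h (A k))"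
proof (induction I rule: finite_induct)
  case empty
  then show ?case using curv_cmult[of K n s h 0 "\<lambda>_ _. 0"] by simp
next
  case (insert k I)
  then show ?case using curv_add[of K n s h "A k"] by simp
qed

lemma curv_cong:
  assumes "\<And>i j. i < n \<Longrightarrow> j < n \<Longrightarrow> i \<noteq> j \<Longrightarrow> A i j = B i j"
  shows "curv K n s h A = curv K n s h B"
proof -
  have "kweight K n s b A = kweight K n s b B" for b
    unfolding kweight_def by (rule sum.cong[OF refl]) (use assms in auto)
  then show ?thesis unfolding curv_def kavg_def by simp
qed

text \<open>The weight that \<open>curv\<close> gives to a single ordered pair. It depends on the
  positions alone, so the estimator is a finite sum of products of a function of the positions and a
  squared increment of the field.\<close>

definition curv_coeff :: "(real \<Rightarrow> real) \<Rightarrow> nat \<Rightarrow> (nat \<Rightarrow> real ^ 'd) \<Rightarrow> real \<Rightarrow> nat \<times> nat \<Rightarrow> real" where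
  "curv_coeff K n s h p = curv K n s h (\<lambda>i j. of_bool ((i, j) = p))"

lemma curv_eq_sum:
  "curv K n s h A = (\<Sum>(i, j) \<in> {(i, j). i < n \<and> j < n \<and> i \<noteq> j}. curv_coeff K n s h (i, j) * A i j)"
proof -
  let ?I = "{(i, j). i < n \<and> j < n \<and> i \<noteq> j}"
  have "curv K n s h A = curv K n s h (\<lambda>i j. \<Sum>p\<in>?I. A (fst p) (snd p) * of_bool ((i, j) = p))"
  proof (rule curv_cong)
    fix i j assume "i < n" "j < n" "i \<noteq> j"
    then have "?I \<inter> {p. (i, j) = p} = {(i, j)}" by auto
    then show "A i j = (\<Sum>p\<in>?I. A (fst p) (snd p) * of_bool ((i, j) = p))"
      by (simp add: finite_pairs)
  qed
  also have "\<dots> = (\<Sum>p\<in>?I. A (fst p) (snd p) * curv_coeff K n s h p)"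
    unfolding curv_sum[OF finite_pairs] curv_cmult curv_coeff_def ..
  finally show ?thesis by (simp add: case_prod_unfold mult.commute)
qed

lemma curv_coeff_bounded:
  fixes K :: "real \<Rightarrow> real"
  assumes K: "is_kernel K R" and d: "2 \<le> CARD('d)" and \<kappa>: "0 < \<kappa>"
  obtains C where "\<And>n (s :: nat \<Rightarrow> real ^ 'd) h p. 0 < h \<Longrightarrow> well_conditioned \<kappa> K R n s h \<Longrightarrow> \<bar>curv_coeff K n s h p\<bar> \<le> C"
proof (rule curv_err_bounded[OF K d \<kappa>])
  fix C assume *: "\<And>n (s :: nat \<Rightarrow> real ^ 'd) h A b. 0 < h \<Longrightarrow> well_conditioned \<kappa> K R n s h \<Longrightarrow> 0 \<le> b \<Longrightarrow>
      \<forall>i j. dist (s i) (s j) \<le> 2 * R * h \<longrightarrow> \<bar>A i j\<bar> \<le> b \<Longrightarrow> \<bar>curv K n s h A\<bar> \<le> C * b"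
  have "\<bar>curv_coeff K n s h p\<bar> \<le> C" if "0 < h" "well_conditioned \<kappa> K R n s h" for n and s :: "nat \<Rightarrow> real ^ 'd" and h p
    using *[OF that, of 1 "\<lambda>i j. of_bool ((i, j) = p)"] unfolding curv_coeff_def by simp
  then show thesis by (rule that)
qed

section \<open>Measurability in the positions\<close>

context
  fixes K :: "real \<Rightarrow> real" and R :: real and P :: "'v measure" and s :: "'v \<Rightarrow> nat \<Rightarrow> real ^ 'd"
  assumes K: "is_kernel K R" and s[measurable]: "\<And>i. (\<lambda>v. s v i) \<in> borel_measurable P"
begin

lemma kweight_measurable:
  assumes [measurable]: "\<And>i j. (\<lambda>v. A v i j) \<in> borel_measurable P"
  shows "(\<lambda>v. kweight K n (s v) h (A v)) \<in> borel_measurable P"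
proof -
  have [measurable]: "K \<in> borel_measurable borel" using K by (simp add: is_kernel_def)
  show ?thesis unfolding kweight_def case_prod_unfold by measurable
qed

lemma kavg_measurable:
  assumes "\<And>i j. (\<lambda>v. A v i j) \<in> borel_measurable P"
  shows "(\<lambda>v. kavg K n (s v) h (A v)) \<in> borel_measurable P"
  unfolding kavg_def using assms by (intro borel_measurable_divide kweight_measurable) auto

lemma lag_mom_measurable: "(\<lambda>v. lag_mom K n (s v) p h) \<in> borel_measurable P"
  unfolding lag_mom_def by (rule kavg_measurable) measurable

lemma mu2_den_measurable: "(\<lambda>v. mu2_den K n (s v) h) \<in> borel_measurable P"
  unfolding mu2_den_def Let_def using lag_mom_measurable by measurable

lemma curv_measurable:
  assumes A: "\<And>i j. (\<lambda>v. A v i j) \<in> borel_measurable P"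
  shows "(\<lambda>v. curv K n (s v) h (A v)) \<in> borel_measurable P"
proof -
  note [measurable] = lag_mom_measurable mu2_den_measurable kavg_measurable[OF A]
  have [measurable]: "(\<lambda>v. mu2 K n (s v) h) \<in> borel_measurable P"
    unfolding mu2_def mu2_num_def Let_def by measurable
  have [measurable]: "(\<lambda>v. mu1 K n (s v) h) \<in> borel_measurable P"
    unfolding mu1_def Let_def by measurable
  show ?thesis unfolding curv_def by measurable
qed

lemma well_conditioned_measurable: "{v \<in> space P. well_conditioned \<kappa> K R n (s v) h} \<in> sets P"
proof -
  note [measurable] = lag_mom_measurable mu2_den_measurable
  have [measurable]: "(\<lambda>v. kweight K n (s v) b (\<lambda>_ _. 1)) \<in> borel_measurable P" for b
    by (rule kweight_measurable) simp
  show ?thesis unfolding well_conditioned_def Let_def by measurable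
qed

lemma step2_measurable: "(\<lambda>v. step2 K n (s v) h) \<in> borel_measurable P"
proof -
  have "root 4 \<in> borel_measurable borel"
    by (intro borel_measurable_continuous_onI continuous_on_real_root continuous_on_id)
  then show ?thesis unfolding step2_def using lag_mom_measurable by measurable
qed

end

text \<open>Joint measurability of the field makes its values at random positions measurable. Bound
  and continuity concern nonnegative lags, where the field determines F.\<close>

locale sampled_field = N: prob_space N + P: prob_space P
  for N :: "'w measure" and P :: "'v measure" +
  fixes X :: "real ^ 'd \<Rightarrow> 'w \<Rightarrow> real" and F :: "real \<Rightarrow> real" and b \<epsilon> :: real
  assumes X_measurable: "(\<lambda>(p, w). X p w) \<in> borel_measurable (borel \<Otimes>\<^sub>M N)"
    and incr_integrable: "\<And>p q. integrable N (\<lambda>w. (X p w - X q w)\<^sup>2)"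
    and incr_integral: "\<And>p q. (\<integral>w. (X p w - X q w)\<^sup>2 \<partial>N) = 2 * F (dist p q)"
    and F_bounded: "\<And>r. 0 \<le> r \<Longrightarrow> 0 \<le> F r \<and> F r \<le> b"
    and \<epsilon>: "0 < \<epsilon>" and F_continuous: "continuous_on {0..<\<epsilon>} F"
begin

sublocale NP: pair_prob_space N P ..
sublocale PN: pair_prob_space P N ..

text \<open>Fubini with the field integrated first: for fixed positions the mean of the squared
  increment is 2 F of the lag, and boundedness of a and of F gives integrability over the
  positions.\<close>

lemma weighted_increment:
  assumes a[measurable]: "a \<in> borel_measurable P" and C: "\<And>v. v \<in> space P \<Longrightarrow> \<bar>a v\<bar> \<le> C"
    and p[measurable]: "p \<in> borel_measurable P" and q[measurable]: "q \<in> borel_measurable P"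
  shows "integrable (N \<Otimes>\<^sub>M P) (\<lambda>(w, v). a v * (X (p v) w - X (q v) w)\<^sup>2)"
    and "integrable P (\<lambda>v. a v * (2 * F (dist (p v) (q v))))"
    and "(\<integral>(w, v). a v * (X (p v) w - X (q v) w)\<^sup>2 \<partial>(N \<Otimes>\<^sub>M P)) = (\<integral>v. a v * (2 * F (dist (p v) (q v))) \<partial>P)"
proof -
  have XP: "(\<lambda>(v, w). X (u v) w) \<in> borel_measurable (P \<Otimes>\<^sub>M N)" if [measurable]: "u \<in> borel_measurable P" for u
  proof -
    have "(\<lambda>(v, w). (u v, w)) \<in> P \<Otimes>\<^sub>M N \<rightarrow>\<^sub>M borel \<Otimes>\<^sub>M N" by measurable
    from measurable_compose[OF this X_measurable] show ?thesis by (simp add: case_prod_unfold)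
  qed
  note [measurable] = XP[OF p, unfolded case_prod_unfold] XP[OF q, unfolded case_prod_unfold]
  have meas[measurable]: "(\<lambda>(v, w). a v * (X (p v) w - X (q v) w)\<^sup>2) \<in> borel_measurable (P \<Otimes>\<^sub>M N)"
    unfolding case_prod_unfold by measurable
  have inner: "(\<integral>w. a v * (X (p v) w - X (q v) w)\<^sup>2 \<partial>N) = a v * (2 * F (dist (p v) (q v)))" for v
    by (simp add: incr_integral)
  \<comment> \<open>F is not known to be a Borel function away from zero; measurability of its value
    at the random lag comes from its being a partial integral of a jointly measurable
    function.\<close>
  have Fm: "(\<lambda>v. a v * (2 * F (dist (p v) (q v)))) \<in> borel_measurable P"
    using N.borel_measurable_lebesgue_integral[of "\<lambda>v w. a v * (X (p v) w - X (q v) w)\<^sup>2" P] meas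
    unfolding inner by simp
  have bd: "\<bar>a v * (2 * F (dist (p v) (q v)))\<bar> \<le> C * (2 * b)" if "v \<in> space P" for v
    unfolding abs_mult using C[OF that] F_bounded[of "dist (p v) (q v)"] F_bounded[of 0]
    by (intro mult_mono) auto
  show int: "integrable P (\<lambda>v. a v * (2 * F (dist (p v) (q v))))"
    by (rule P.integrable_const_bound[of _ "C * (2 * b)"]) (use Fm bd in auto)
  have "integrable (P \<Otimes>\<^sub>M N) (\<lambda>(v, w). a v * (X (p v) w - X (q v) w)\<^sup>2)"
  proof (rule PN.Fubini_integrable[OF meas])
    have "(\<lambda>v. \<integral>w. norm (case (v, w) of (v, w) \<Rightarrow> a v * (X (p v) w - X (q v) w)\<^sup>2) \<partial>N)
        = (\<lambda>v. \<bar>a v * (2 * F (dist (p v) (q v)))\<bar>)"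
    proof
      fix v
      have "norm (case (v, w) of (v, w) \<Rightarrow> a v * (X (p v) w - X (q v) w)\<^sup>2) = \<bar>a v\<bar> * (X (p v) w - X (q v) w)\<^sup>2" for w
        by (simp add: abs_mult)
      then show "(\<integral>w. norm (case (v, w) of (v, w) \<Rightarrow> a v * (X (p v) w - X (q v) w)\<^sup>2) \<partial>N) = \<bar>a v * (2 * F (dist (p v) (q v)))\<bar>"
        using F_bounded[of "dist (p v) (q v)"] by (simp add: incr_integral abs_mult)
    qed
    with int show "integrable P (\<lambda>v. \<integral>w. norm (case (v, w) of (v, w) \<Rightarrow> a v * (X (p v) w - X (q v) w)\<^sup>2) \<partial>N)"
      by simp
    show "AE v in P. integrable N (\<lambda>w. case (v, w) of (v, w) \<Rightarrow> a v * (X (p v) w - X (q v) w)\<^sup>2)"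
      using incr_integrable by simp
  qed
  then show ip: "integrable (N \<Otimes>\<^sub>M P) (\<lambda>(w, v). a v * (X (p v) w - X (q v) w)\<^sup>2)"
    using PN.integrable_product_swap by fastforce
  show "(\<integral>(w, v). a v * (X (p v) w - X (q v) w)\<^sup>2 \<partial>(N \<Otimes>\<^sub>M P)) = (\<integral>v. a v * (2 * F (dist (p v) (q v))) \<partial>P)"
    using NP.integral_snd[OF ip] unfolding inner by simp
qed

text \<open>On the good event the coefficients of the pairs are bounded, so the exchange of
  integrals applies pair by pair; the indicator is part of the coefficient.\<close>

lemma restricted_estimator:
  fixes n :: nat and K :: "real \<Rightarrow> real" and s :: "'v \<Rightarrow> nat \<Rightarrow> real ^ 'd"
  assumes K: "is_kernel K R" and d: "2 \<le> CARD('d)" and \<kappa>: "0 < \<kappa>" and h: "0 < h"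
    and s[measurable]: "\<And>i. (\<lambda>v. s v i) \<in> borel_measurable P"
  defines "G \<equiv> {v \<in> space P. well_conditioned \<kappa> K R n (s v) h}"
  shows "integrable (N \<Otimes>\<^sub>M P) (\<lambda>(w, v). phi2_bar K n (s v) (\<lambda>i. X (s v i) w) h * indicator G v)"
    and "integrable P (\<lambda>v. curv K n (s v) h (\<lambda>i j. F (dist (s v i) (s v j))) * indicator G v)"
    and "(\<integral>(w, v). phi2_bar K n (s v) (\<lambda>i. X (s v i) w) h * indicator G v \<partial>(N \<Otimes>\<^sub>M P))
      = (\<integral>v. curv K n (s v) h (\<lambda>i j. F (dist (s v i) (s v j))) * indicator G v \<partial>P)"
proof -
  let ?I = "{(i, j). i < n \<and> j < n \<and> i \<noteq> j}"
  obtain C where C: "\<And>n (s :: nat \<Rightarrow> real ^ 'd) h p. 0 < h \<Longrightarrow> well_conditioned \<kappa> K R n s h \<Longrightarrow> \<bar>curv_coeff K n s h p\<bar> \<le> C"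
    using curv_coeff_bounded[OF K d \<kappa>] by metis
  define a where "a p v = 1 / 2 * curv_coeff K n (s v) h p * indicator G v" for p v
  have [measurable]: "G \<in> sets P" unfolding G_def by (rule well_conditioned_measurable[OF K s])
  have am: "a p \<in> borel_measurable P" for p
    unfolding a_def[abs_def] curv_coeff_def
    by (intro borel_measurable_times borel_measurable_const curv_measurable[OF K s]) auto
  \<comment> \<open>The absolute value of C also covers outcomes outside G, where the coefficient is
    zero and C might be negative.\<close>
  have ab: "\<bar>a p v\<bar> \<le> \<bar>C\<bar>" for p v
    using C[OF h, of n "s v" p] by (auto simp: a_def G_def abs_mult split: split_indicator)
  note wi = weighted_increment[OF am ab s s]
  have est: "phi2_bar K n (s v) (\<lambda>i. X (s v i) w) h * indicator G v
      = (\<Sum>p\<in>?I. a p v * (X (s v (fst p)) w - X (s v (snd p)) w)\<^sup>2)" for w v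
    unfolding phi2_bar_eq_curv curv_eq_sum case_prod_unfold a_def
    by (simp add: sum_distrib_left sum_distrib_right mult_ac)
  have cur: "curv K n (s v) h (\<lambda>i j. F (dist (s v i) (s v j))) * indicator G v
      = (\<Sum>p\<in>?I. a p v * (2 * F (dist (s v (fst p)) (s v (snd p)))))" for v
    unfolding curv_eq_sum[of K n "s v" h "\<lambda>i j. F (dist (s v i) (s v j))"] case_prod_unfold a_def
    by (simp add: sum_distrib_left sum_distrib_right mult_ac)
  show "integrable (N \<Otimes>\<^sub>M P) (\<lambda>(w, v). phi2_bar K n (s v) (\<lambda>i. X (s v i) w) h * indicator G v)"
    unfolding est case_prod_unfold
    by (rule Bochner_Integration.integrable_sum) (use wi(1) in \<open>simp add: case_prod_unfold\<close>)
  show "integrable P (\<lambda>v. curv K n (s v) h (\<lambda>i j. F (dist (s v i) (s v j))) * indicator G v)"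
    unfolding cur by (rule Bochner_Integration.integrable_sum) (rule wi(2))
  have "(\<integral>(w, v). phi2_bar K n (s v) (\<lambda>i. X (s v i) w) h * indicator G v \<partial>(N \<Otimes>\<^sub>M P))
      = (\<Sum>p\<in>?I. \<integral>(w, v). a p v * (X (s v (fst p)) w - X (s v (snd p)) w)\<^sup>2 \<partial>(N \<Otimes>\<^sub>M P))"
    unfolding est case_prod_unfold
    by (rule Bochner_Integration.integral_sum) (use wi(1) in \<open>simp add: case_prod_unfold\<close>)
  also have "\<dots> = (\<Sum>p\<in>?I. \<integral>v. a p v * (2 * F (dist (s v (fst p)) (s v (snd p)))) \<partial>P)"
    unfolding wi(3) ..
  also have "\<dots> = (\<integral>v. curv K n (s v) h (\<lambda>i j. F (dist (s v i) (s v j))) * indicator G v \<partial>P)"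
    unfolding cur by (rule Bochner_Integration.integral_sum[symmetric]) (rule wi(2))
  finally show "(\<integral>(w, v). phi2_bar K n (s v) (\<lambda>i. X (s v i) w) h * indicator G v \<partial>(N \<Otimes>\<^sub>M P))
      = (\<integral>v. curv K n (s v) h (\<lambda>i j. F (dist (s v i) (s v j))) * indicator G v \<partial>P)" .
qed

text \<open>Continuity of F is available only on \<open>{0..<\<epsilon>}\<close>. Since
  \<open>2 * step2\<close> is at most 2 R h < \<epsilon>, F may be cut off to the Borel function
  \<open>F'\<close> without changing the target.\<close>

lemma target_measurable:
  fixes K :: "real \<Rightarrow> real" and s :: "'v \<Rightarrow> nat \<Rightarrow> real ^ 'd"
  assumes K: "is_kernel K R" and h: "0 < h" "2 * R * h < \<epsilon>"
    and s[measurable]: "\<And>i. (\<lambda>v. s v i) \<in> borel_measurable P"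
  shows "(\<lambda>v. phi2 CARD('d) F (step2 K n (s v) h)) \<in> borel_measurable P"
    and "integrable P (\<lambda>v. phi2 CARD('d) F (step2 K n (s v) h))"
proof -
  note st = step2_bounds[OF K h(1), of n]
  note [measurable] = step2_measurable[OF K s]
  define F' where "F' r = (if r \<in> {0..<\<epsilon>} then F r else 0)" for r
  have [measurable]: "F' \<in> borel_measurable borel"
    unfolding F'_def[abs_def]
    by (intro borel_measurable_continuous_on_if F_continuous continuous_on_const) simp
  have eq: "F (t * step2 K n (s v) h) = F' (t * step2 K n (s v) h)" if "0 < t" "t \<le> 2" for t v
  proof -
    have "t * step2 K n (s v) h \<le> 2 * (R * h)" using st[of "s v"] that by (intro mult_mono) auto
    then show ?thesis using st[of "s v"] that h by (simp add: F'_def)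
  qed
  have s2: "sqrt 2 \<le> 2" using sqrt2_less_2 by simp
  show m: "(\<lambda>v. phi2 CARD('d) F (step2 K n (s v) h)) \<in> borel_measurable P"
    unfolding phi2_def using eq[of 1] eq[of "sqrt 2"] eq[of 2] s2 by simp
  have Fb: "\<bar>F (t * step2 K n (s v) h)\<bar> \<le> b" if "0 < t" for t v
    using F_bounded[of "t * step2 K n (s v) h"] st[of "s v"] that by simp
  define c where "c = \<bar>cd2 CARD('d)\<bar> * b + \<bar>cd3 CARD('d)\<bar> * b + \<bar>cd1 CARD('d)\<bar> * b"
  have "\<bar>phi2 CARD('d) F (step2 K n (s v) h)\<bar> \<le> c" for v
  proof -
    have "\<bar>x * F (t * step2 K n (s v) h)\<bar> \<le> \<bar>x\<bar> * b" if "0 < t" for t x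
      unfolding abs_mult using Fb[OF that] by (intro mult_left_mono) auto
    from this[of 1 "cd2 CARD('d)"] this[of "sqrt 2" "cd3 CARD('d)"] this[of 2 "cd1 CARD('d)"]
    have *: "\<bar>cd2 CARD('d) * F (step2 K n (s v) h)\<bar> \<le> \<bar>cd2 CARD('d)\<bar> * b"
      "\<bar>cd3 CARD('d) * F (sqrt 2 * step2 K n (s v) h)\<bar> \<le> \<bar>cd3 CARD('d)\<bar> * b"
      "\<bar>cd1 CARD('d) * F (2 * step2 K n (s v) h)\<bar> \<le> \<bar>cd1 CARD('d)\<bar> * b" by simp_all
    have "\<bar>x - y - z\<bar> \<le> x' + y' + z'" if "\<bar>x\<bar> \<le> x'" "\<bar>y\<bar> \<le> y'" "\<bar>z\<bar> \<le> z'" for x y z x' y' z' :: real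
      using that by linarith
    from this[OF *] show ?thesis unfolding phi2_def c_def .
  qed
  then show "integrable P (\<lambda>v. phi2 CARD('d) F (step2 K n (s v) h))"
    using m by (intro P.integrable_const_bound[of _ c]) auto
qed

end

text \<open>If A is null, the left side is an integral of a function that is zero almost everywhere
  and the right side is a quotient by 0; both are zero. The conditional expectation thus has a
  meaning even if the good event has probability zero.\<close>

lemma integral_uniform_measure:
  fixes f :: "'a \<Rightarrow> real"
  assumes M: "finite_measure M" and A[measurable]: "A \<in> sets M" and f[measurable]: "f \<in> borel_measurable M"
  shows "(\<integral>x. f x \<partial>uniform_measure M A) = (\<integral>x. f x * indicator A x \<partial>M) / measure M A"
proof -
  interpret finite_measure M by (rule M)
  show ?thesis
  proof (cases "measure M A = 0")
    case True
    then have "A \<in> null_sets M" by (intro null_setsI) (simp_all add: emeasure_eq_measure)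
    then have "AE x in M. x \<notin> A" by (rule AE_not_in)
    then have "AE x in uniform_measure M A. f x = 0" by (intro AE_uniform_measureI[OF A]) (auto elim: eventually_mono)
    then have "(\<integral>x. f x \<partial>uniform_measure M A) = 0" by (rule integral_eq_zero_AE)
    with True show ?thesis by simp
  next
    case False
    then have pos: "0 < measure M A" using measure_nonneg[of M A] by linarith
    have "uniform_measure M A = density M (\<lambda>x. ennreal (indicator A x / measure M A))"
      unfolding uniform_measure_def
      by (rule arg_cong[where f = "density M"]) (use pos in \<open>auto simp: fun_eq_iff emeasure_eq_measure divide_ennreal[symmetric] ennreal_indicator\<close>)
    then have "(\<integral>x. f x \<partial>uniform_measure M A) = (\<integral>x. (indicator A x / measure M A) * f x \<partial>M)"
      using pos by (simp add: integral_real_density)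
    also have "\<dots> = (\<integral>x. (f x * indicator A x) / measure M A \<partial>M)" by (simp add: mult.commute)
    finally show ?thesis by simp
  qed
qed

context sampled_field
begin

lemma position_integral:
  fixes g :: "'v \<Rightarrow> real"
  assumes g: "integrable P g"
  shows "integrable (N \<Otimes>\<^sub>M P) (\<lambda>(w, v). g v)" "(\<integral>(w, v). g v \<partial>(N \<Otimes>\<^sub>M P)) = (\<integral>v. g v \<partial>P)"
proof -
  have [measurable]: "g \<in> borel_measurable P" using g by simp
  have "integrable (distr (P \<Otimes>\<^sub>M N) P fst) g" unfolding N.distr_pair_fst by (rule g)
  then have "integrable (P \<Otimes>\<^sub>M N) (\<lambda>x. g (fst x))" by (rule integrable_distr[OF measurable_fst])
  from PN.integrable_product_swap[OF this]
  show i: "integrable (N \<Otimes>\<^sub>M P) (\<lambda>(w, v). g v)" by (simp add: case_prod_unfold)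
  show "(\<integral>(w, v). g v \<partial>(N \<Otimes>\<^sub>M P)) = (\<integral>v. g v \<partial>P)"
    using NP.integral_snd[OF i] by (simp add: N.prob_space)
qed

lemma estimator_measurable:
  fixes K :: "real \<Rightarrow> real" and s :: "'v \<Rightarrow> nat \<Rightarrow> real ^ 'd"
  assumes K: "is_kernel K R" and s[measurable]: "\<And>i. (\<lambda>v. s v i) \<in> borel_measurable P"
  shows "(\<lambda>(w, v). phi2_bar K n (s v) (\<lambda>i. X (s v i) w) h) \<in> borel_measurable (N \<Otimes>\<^sub>M P)"
proof -
  have "(\<lambda>z. (s (snd z) i, fst z)) \<in> N \<Otimes>\<^sub>M P \<rightarrow>\<^sub>M borel \<Otimes>\<^sub>M N" for i by measurable
  from measurable_compose[OF this X_measurable]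
  have Xm: "(\<lambda>z. X (s (snd z) i) (fst z)) \<in> borel_measurable (N \<Otimes>\<^sub>M P)" for i by simp
  have sm: "(\<lambda>z. s (snd z) i) \<in> borel_measurable (N \<Otimes>\<^sub>M P)" for i by measurable
  show ?thesis
    unfolding phi2_bar_eq_curv case_prod_unfold
    by (intro borel_measurable_times borel_measurable_const curv_measurable[OF K sm] borel_measurable_power borel_measurable_diff Xm)
qed

text \<open>Well-conditioning concerns the positions only, so the good event is the product of
  \<open>space N\<close> and \<open>G\<close>, and each integral over the product space reduces to
  one over the positions.\<close>

lemma restricted_error:
  fixes n :: nat and K :: "real \<Rightarrow> real" and s :: "'v \<Rightarrow> nat \<Rightarrow> real ^ 'd"
  assumes K: "is_kernel K R" and d: "2 \<le> CARD('d)" and \<kappa>: "0 < \<kappa>" and h: "0 < h" "2 * R * h < \<epsilon>"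
    and s: "\<And>i. (\<lambda>v. s v i) \<in> borel_measurable P"
  defines "G \<equiv> {v \<in> space P. well_conditioned \<kappa> K R n (s v) h}"
    and "A \<equiv> {(w, v) \<in> space (N \<Otimes>\<^sub>M P). well_conditioned \<kappa> K R n (s v) h}"
    and "est \<equiv> \<lambda>(w, v). phi2_bar K n (s v) (\<lambda>i. X (s v i) w) h"
    and "tgt \<equiv> \<lambda>(w, v). phi2 CARD('d) F (step2 K n (s v) h)"
  shows "A \<in> sets (N \<Otimes>\<^sub>M P)" "measure (N \<Otimes>\<^sub>M P) A = P.prob G" "G \<in> sets P"
    "est \<in> borel_measurable (N \<Otimes>\<^sub>M P)" "integrable (N \<Otimes>\<^sub>M P) tgt"
    "(\<integral>z. tgt z \<partial>(N \<Otimes>\<^sub>M P)) = (\<integral>v. phi2 CARD('d) F (step2 K n (s v) h) \<partial>P)"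
    "integrable (N \<Otimes>\<^sub>M P) (\<lambda>z. est z * indicator A z)" "integrable (N \<Otimes>\<^sub>M P) (\<lambda>z. tgt z * indicator A z)"
    "(\<integral>z. tgt z * indicator A z \<partial>(N \<Otimes>\<^sub>M P)) = (\<integral>v. phi2 CARD('d) F (step2 K n (s v) h) * indicator G v \<partial>P)"
    "(\<integral>z. (est z - tgt z) * indicator A z \<partial>(N \<Otimes>\<^sub>M P)) = (\<integral>v. curv_err K n (s v) h F * indicator G v \<partial>P)"
    "integrable P (\<lambda>v. curv_err K n (s v) h F * indicator G v)"
proof -
  show Gm[measurable]: "G \<in> sets P" unfolding G_def by (rule well_conditioned_measurable[OF K s])
  have AG: "A = space N \<times> G" by (auto simp: A_def G_def space_pair_measure)
  show Am: "A \<in> sets (N \<Otimes>\<^sub>M P)" unfolding AG by simp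
  have "emeasure (N \<Otimes>\<^sub>M P) A = emeasure P G"
    unfolding AG using P.emeasure_pair_measure_Times[of "space N" N G] by (simp add: N.emeasure_space_1)
  then show "measure (N \<Otimes>\<^sub>M P) A = P.prob G" by (simp add: measure_def)
  show "est \<in> borel_measurable (N \<Otimes>\<^sub>M P)" unfolding est_def by (rule estimator_measurable[OF K s])
  note ti = target_measurable(2)[OF K h s, of n]
  show "integrable (N \<Otimes>\<^sub>M P) tgt" "(\<integral>z. tgt z \<partial>(N \<Otimes>\<^sub>M P)) = (\<integral>v. phi2 CARD('d) F (step2 K n (s v) h) \<partial>P)"
    unfolding tgt_def using position_integral[OF ti] by simp_all
  have ind: "indicator A (w, v) = (indicator G v :: real)" if "w \<in> space N" for w v
    using that by (simp add: AG indicator_def)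
  have tiG: "integrable P (\<lambda>v. phi2 CARD('d) F (step2 K n (s v) h) * indicator G v)"
    using integrable_mult_indicator[OF Gm ti] by (simp add: mult.commute)
  have tgtA: "tgt z * indicator A z = (\<lambda>(w, v). phi2 CARD('d) F (step2 K n (s v) h) * indicator G v) z" if "z \<in> space (N \<Otimes>\<^sub>M P)" for z
    using that ind[of "fst z" "snd z"] by (simp add: tgt_def case_prod_unfold space_pair_measure mem_Times_iff)
  have estA: "est z * indicator A z = (\<lambda>(w, v). phi2_bar K n (s v) (\<lambda>i. X (s v i) w) h * indicator G v) z" if "z \<in> space (N \<Otimes>\<^sub>M P)" for z
    using that ind[of "fst z" "snd z"] by (simp add: est_def case_prod_unfold space_pair_measure mem_Times_iff)
  note re = restricted_estimator[where s = s and n = n, OF K d \<kappa> h(1) s, folded G_def]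
  have iT: "integrable (N \<Otimes>\<^sub>M P) (\<lambda>z. tgt z * indicator A z) \<longleftrightarrow> integrable (N \<Otimes>\<^sub>M P) (\<lambda>(w, v). phi2 CARD('d) F (step2 K n (s v) h) * indicator G v)"
    by (rule Bochner_Integration.integrable_cong[OF refl tgtA])
  have iE: "integrable (N \<Otimes>\<^sub>M P) (\<lambda>z. est z * indicator A z) \<longleftrightarrow> integrable (N \<Otimes>\<^sub>M P) (\<lambda>(w, v). phi2_bar K n (s v) (\<lambda>i. X (s v i) w) h * indicator G v)"
    by (rule Bochner_Integration.integrable_cong[OF refl estA])
  show eA: "integrable (N \<Otimes>\<^sub>M P) (\<lambda>z. est z * indicator A z)" unfolding iE by (rule re(1))
  show tA: "integrable (N \<Otimes>\<^sub>M P) (\<lambda>z. tgt z * indicator A z)" unfolding iT by (rule position_integral(1)[OF tiG])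
  have "(\<integral>z. tgt z * indicator A z \<partial>(N \<Otimes>\<^sub>M P)) = (\<integral>(w, v). phi2 CARD('d) F (step2 K n (s v) h) * indicator G v \<partial>(N \<Otimes>\<^sub>M P))"
    by (rule Bochner_Integration.integral_cong[OF refl tgtA])
  then show tI: "(\<integral>z. tgt z * indicator A z \<partial>(N \<Otimes>\<^sub>M P)) = (\<integral>v. phi2 CARD('d) F (step2 K n (s v) h) * indicator G v \<partial>P)"
    unfolding position_integral(2)[OF tiG] .
  have "(\<integral>z. est z * indicator A z \<partial>(N \<Otimes>\<^sub>M P)) = (\<integral>(w, v). phi2_bar K n (s v) (\<lambda>i. X (s v i) w) h * indicator G v \<partial>(N \<Otimes>\<^sub>M P))"
    by (rule Bochner_Integration.integral_cong[OF refl estA])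
  note eI = this[unfolded re(3)]
  have split: "curv_err K n (s v) h F * indicator G v
      = curv K n (s v) h (\<lambda>i j. F (dist (s v i) (s v j))) * indicator G v - phi2 CARD('d) F (step2 K n (s v) h) * indicator G v" for v
    by (simp add: curv_err_def left_diff_distrib)
  show "integrable P (\<lambda>v. curv_err K n (s v) h F * indicator G v)"
    unfolding split by (intro Bochner_Integration.integrable_diff re(2) tiG)
  have "(\<integral>z. (est z - tgt z) * indicator A z \<partial>(N \<Otimes>\<^sub>M P)) = (\<integral>z. est z * indicator A z \<partial>(N \<Otimes>\<^sub>M P)) - (\<integral>z. tgt z * indicator A z \<partial>(N \<Otimes>\<^sub>M P))"
    unfolding left_diff_distrib by (rule Bochner_Integration.integral_diff[OF eA tA])
  also have "\<dots> = (\<integral>v. curv_err K n (s v) h F * indicator G v \<partial>P)"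
    unfolding split eI tI by (rule Bochner_Integration.integral_diff[OF re(2) tiG, symmetric])
  finally show "(\<integral>z. (est z - tgt z) * indicator A z \<partial>(N \<Otimes>\<^sub>M P)) = (\<integral>v. curv_err K n (s v) h F * indicator G v \<partial>P)" .
qed

end

section \<open>Asymptotics of the bias\<close>

lemma smallo_if_le:
  fixes f g e :: "'a \<Rightarrow> real"
  assumes "(e \<longlongrightarrow> 0) F" and "\<forall>\<^sub>F x in F. \<bar>f x\<bar> \<le> e x * \<bar>g x\<bar>"
  shows "f \<in> o[F](g)"
proof (rule landau_o.smallI)
  fix c :: real assume "0 < c"
  have "\<forall>\<^sub>F x in F. e x < c" by (rule order_tendstoD(2)[OF assms(1) \<open>0 < c\<close>])
  with assms(2) show "\<forall>\<^sub>F x in F. norm (f x) \<le> c * norm (g x)"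
  proof eventually_elim
    case (elim x)
    have "e x * \<bar>g x\<bar> \<le> c * \<bar>g x\<bar>" using elim(2) by (intro mult_right_mono) auto
    with elim(1) show ?case by simp
  qed
qed

text \<open>The value x n is assigned as a whole to whichever of u n and v n is larger in absolute
  value, at the cost of a factor 2.\<close>

lemma bigo_smallo_split:
  fixes x u v :: "nat \<Rightarrow> real"
  assumes "u \<in> O(r)" "v \<in> o(r')" and le: "\<forall>\<^sub>F n in sequentially. \<bar>x n\<bar> \<le> \<bar>u n\<bar> + \<bar>v n\<bar>"
  shows "\<exists>u'\<in>O(r). \<exists>v'\<in>o(r'). \<forall>n. x n = u' n + v' n"
proof -
  define u' where "u' n = (if \<bar>v n\<bar> \<le> \<bar>u n\<bar> then x n else 0)" for n
  define v' where "v' n = (if \<bar>v n\<bar> \<le> \<bar>u n\<bar> then 0 else x n)" for n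
  have "\<forall>\<^sub>F n in sequentially. norm (u' n) \<le> 2 * norm (u n)"
    using le by eventually_elim (auto simp: u'_def)
  then have "u' \<in> O(u)" by (rule landau_o.bigI[rotated]) simp
  then have "u' \<in> O(r)" using assms(1) by (rule landau_o.big_trans)
  moreover have "\<forall>\<^sub>F n in sequentially. norm (v' n) \<le> 2 * norm (v n)"
    using le by eventually_elim (auto simp: v'_def)
  then have "v' \<in> O(v)" by (rule landau_o.bigI[rotated]) simp
  then have "v' \<in> o(r')" using assms(2) by (rule landau_o.big_small_trans)
  moreover have "x n = u' n + v' n" for n by (simp add: u'_def v'_def)
  ultimately show ?thesis by blast
qed

text \<open>
  Where \<open>h\<^sup>3 l < 1\<close> the term \<open>h\<^sup>6\<close> is absorbed by \<open>h\<^sup>2 (h / l)\<close>, so limits are needed only along the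
  indices with \<open>h\<^sup>3 l \<ge> 1\<close>.
\<close>

definition dense_regime :: "(nat \<Rightarrow> real) \<Rightarrow> (nat \<Rightarrow> real) \<Rightarrow> nat filter" where
  "dense_regime h l = inf sequentially (principal {n. 1 \<le> h n ^ 3 * l n})"

lemma dense_regime_le: "dense_regime h l \<le> sequentially"
  by (simp add: dense_regime_def)

lemma regime_split:
  fixes e h l :: "nat \<Rightarrow> real"
  assumes h: "\<And>n. 0 < h n" and l: "\<forall>\<^sub>F n in sequentially. 0 < l n"
    and big: "\<forall>\<^sub>F n in sequentially. \<bar>e n\<bar> \<le> C * h n ^ 6"
    and lim: "((\<lambda>n. e n / h n ^ 6) \<longlongrightarrow> 0) (dense_regime h l)"
  shows "\<exists>u\<in>O(\<lambda>n. (h n)\<^sup>2 * (h n / l n)). \<exists>v\<in>o(\<lambda>n. h n ^ 6). \<forall>n. e n = u n + v n"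
proof -
  let ?S = "{n. 1 \<le> h n ^ 3 * l n}"
  define D where "D = \<bar>C\<bar> + 1"
  define u where "u n = (if n \<in> ?S then 0 else e n)" for n
  define v where "v n = (if n \<in> ?S then e n else 0)" for n
  have "\<forall>\<^sub>F n in sequentially. norm (u n) \<le> D * norm ((h n)\<^sup>2 * (h n / l n))"
    using l big
  proof eventually_elim
    case (elim n)
    show ?case
    proof (cases "n \<in> ?S")
      case False
      \<comment> \<open>The one use of h^3 l < 1: it trades a factor h^3 for 1 / l, which is what
        the remainder h^2 q allows.\<close>
      have "h n ^ 6 = h n ^ 3 * (h n ^ 3 * l n) / l n" using elim(1) by (simp flip: power_add)
      also have "\<dots> \<le> h n ^ 3 * 1 / l n"
        using False elim(1) h[of n] by (intro divide_right_mono mult_left_mono) auto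
      also have "\<dots> = (h n)\<^sup>2 * (h n / l n)" by (simp add: power2_eq_square power3_eq_cube)
      finally have le: "h n ^ 6 \<le> (h n)\<^sup>2 * (h n / l n)" .
      have "\<bar>e n\<bar> \<le> D * h n ^ 6"
        using elim(2) h[of n] by (intro order_trans[OF elim(2)] mult_right_mono) (auto simp: D_def)
      also have "\<dots> \<le> D * ((h n)\<^sup>2 * (h n / l n))" by (intro mult_left_mono le) (auto simp: D_def)
      also have "\<dots> = D * norm ((h n)\<^sup>2 * (h n / l n))" using elim(1) h[of n] by simp
      finally show ?thesis using False by (simp add: u_def)
    qed (simp add: u_def D_def)
  qed
  then have "u \<in> O(\<lambda>n. (h n)\<^sup>2 * (h n / l n))" by (rule landau_o.bigI[rotated]) (simp add: D_def add_nonneg_pos)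
  moreover have "v \<in> o(\<lambda>n. h n ^ 6)"
  proof (rule landau_o.smallI)
    fix c :: real assume "0 < c"
    have "\<forall>\<^sub>F n in dense_regime h l. \<bar>e n / h n ^ 6\<bar> < c"
      using tendstoD[OF lim \<open>0 < c\<close>] by simp
    then have "\<forall>\<^sub>F n in sequentially. n \<in> ?S \<longrightarrow> \<bar>e n / h n ^ 6\<bar> < c"
      unfolding dense_regime_def eventually_inf_principal .
    then show "\<forall>\<^sub>F n in sequentially. norm (v n) \<le> c * norm (h n ^ 6)"
    proof eventually_elim
      case (elim n)
      show ?case
        using elim h[of n] \<open>0 < c\<close> by (auto simp: v_def abs_divide pos_divide_less_eq)
    qed
  qed
  moreover have "e n = u n + v n" for n by (simp add: u_def v_def)
  ultimately show ?thesis by blast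
qed

text \<open>Write x = 1 / (n^2 q^d). From h^(-3) \<le> l follows x^3 = l^(3 d) h^(-3 d) n^(-6) \<le>
  l^(4 d) n^(-6), and l^d = c^d vol makes this a multiple of (vol / n)^4 / n^2, which tends to zero
  by the infill condition.\<close>

lemma dense_regime_many_pairs:
  fixes vol l h :: "nat \<Rightarrow> real" and d :: nat
  assumes d: "0 < d" and c: "0 < c" "\<And>n. l n = c * vol n powr (1 / real d)"
    and vol: "filterlim vol at_top sequentially" and infill: "(\<lambda>n. vol n / real n) \<longlonglongrightarrow> 0"
    and h: "\<And>n. 0 < h n"
  shows "((\<lambda>n. 1 / (real n ^ 2 * (h n / l n) ^ d)) \<longlongrightarrow> 0) (dense_regime h l)"
proof -
  define x where "x n = 1 / (real n ^ 2 * (h n / l n) ^ d)" for n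
  define y where "y n = (c ^ d) ^ 4 * (vol n / real n) ^ 4 * (1 / real n)\<^sup>2" for n
  have "y \<longlonglongrightarrow> (c ^ d) ^ 4 * 0 ^ 4 * 0\<^sup>2"
    unfolding y_def by (intro tendsto_intros infill lim_1_over_n)
  then have "(\<lambda>n. root 3 (y n)) \<longlonglongrightarrow> root 3 0" by (intro tendsto_real_root) simp
  then have ylim: "((\<lambda>n. root 3 (y n)) \<longlongrightarrow> 0) (dense_regime h l)"
    using tendsto_mono[OF dense_regime_le] by fastforce
  have "\<forall>\<^sub>F n in sequentially. 1 \<le> vol n" using vol by (simp add: filterlim_at_top)
  moreover have "\<forall>\<^sub>F n in sequentially. (0 :: nat) < n" by (rule eventually_gt_at_top)
  ultimately have "\<forall>\<^sub>F n in dense_regime h l. 1 \<le> vol n \<and> 0 < n \<and> 1 \<le> h n ^ 3 * l n"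
    unfolding dense_regime_def eventually_inf_principal by eventually_elim simp
  then have "\<forall>\<^sub>F n in dense_regime h l. x n \<le> root 3 (y n)"
  proof eventually_elim
    case (elim n)
    have l0: "0 < l n" using c elim by simp
    have ld: "l n ^ d = c ^ d * vol n"
      using d elim by (simp add: c(2) power_mult_distrib powr_power)
    have n: "0 < real n" using elim by simp
    have "1 / h n ^ 3 \<le> l n" using elim h[of n] by (simp add: pos_divide_le_eq mult.commute)
    then have "(1 / h n ^ 3) ^ d \<le> l n ^ d" using h[of n] by (intro power_mono) auto
    then have hd: "1 / (h n ^ d) ^ 3 \<le> l n ^ d"
      by (simp add: power_one_over power_mult[symmetric] mult.commute)
    have "x n = l n ^ d * (1 / h n ^ d) * (1 / real n)\<^sup>2"
      by (simp add: x_def power_divide)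
    then have "x n ^ 3 = (l n ^ d) ^ 3 * (1 / (h n ^ d) ^ 3) * ((1 / real n)\<^sup>2) ^ 3"
      by (simp add: power_mult_distrib power_one_over power_divide)
    also have "\<dots> \<le> (l n ^ d) ^ 3 * (l n ^ d) * ((1 / real n)\<^sup>2) ^ 3"
      using hd l0 by (intro mult_right_mono mult_left_mono) auto
    also have "\<dots> = y n"
      unfolding y_def ld using n by (simp add: field_simps power_mult_distrib eval_nat_numeral)
    finally have le: "x n ^ 3 \<le> y n" .
    have "x n = root 3 (x n ^ 3)" by (simp add: odd_real_root_power_cancel)
    also have "\<dots> \<le> root 3 (y n)" using le by simp
    finally show ?case .
  qed
  moreover have "\<forall>\<^sub>F n in dense_regime h l. 0 \<le> x n"
  proof (rule always_eventually, rule allI)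
    fix n show "0 \<le> x n" using h[of n] c by (simp add: x_def)
  qed
  ultimately show ?thesis unfolding x_def[symmetric]
    by (intro tendsto_sandwich[OF _ _ tendsto_const ylim])
qed

section \<open>From integrals over the good event to the bias\<close>

lemma equal_up_to_tendsto_zero:
  assumes "equal_up_to x y r r'" "y \<longlonglongrightarrow> 0" "r \<longlonglongrightarrow> 0" "r' \<longlonglongrightarrow> 0"
  shows "x \<longlonglongrightarrow> 0"
proof -
  obtain u v where uv: "u \<in> O(r)" "v \<in> o(r')" "\<And>n. x n = y n + u n + v n"
    using assms(1) unfolding equal_up_to_def by blast
  have one: "f \<longlonglongrightarrow> 0 \<longleftrightarrow> f \<in> o(\<lambda>_. 1)" for f :: "nat \<Rightarrow> real"
    using smalloI_tendsto[of f "\<lambda>_. 1" sequentially] smalloD_tendsto[of f sequentially "\<lambda>_. 1"] by auto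
  have "u \<longlonglongrightarrow> 0" using landau_o.big_small_trans[OF uv(1)] assms(3) one by blast
  moreover have "v \<longlonglongrightarrow> 0" using landau_o.small_trans[OF uv(2)] assms(4) one by blast
  ultimately have "(\<lambda>n. y n + u n + v n) \<longlonglongrightarrow> 0 + 0 + 0" using assms(2) by (intro tendsto_add)
  moreover have "x = (\<lambda>n. y n + u n + v n)" using uv(3) by (rule ext)
  ultimately show ?thesis by simp
qed

text \<open>The mean of the estimator is the bias plus the mean of the target, so comparison with
  the target settles the comparison with the estimator.\<close>

lemma smallo_plus_self:
  fixes f g :: "nat \<Rightarrow> real"
  assumes "f \<in> o(g)" shows "f \<in> o(\<lambda>n. f n + g n)"
  using landau_o.small.plus_absorb1[OF assms] assms by blast

text \<open>
  \<open>I\<close> and \<open>J\<close> are the integrals of the error and of the target over the good event, whose probability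
  is \<open>p\<close>, and \<open>T\<close> is the integral of the target over the whole space.
\<close>

locale bias_estimates =
  fixes I J T p h l :: "nat \<Rightarrow> real" and C m :: real
  assumes h: "\<And>n. 0 < h n" "h \<longlonglongrightarrow> 0" and l: "\<forall>\<^sub>F n in sequentially. 0 < l n" "(\<lambda>n. h n / l n) \<longlonglongrightarrow> 0"
    and p: "\<And>n. 0 \<le> p n" "\<And>n. p n \<le> 1" and C: "0 \<le> C"
    and IJ: "\<forall>\<^sub>F n in sequentially. \<bar>I n\<bar> \<le> C * (h n)\<^sup>2 * \<bar>J n\<bar>"
    and JT: "\<forall>\<^sub>F n in sequentially. \<bar>J n\<bar> \<le> \<bar>T n\<bar>"
    and Ih: "\<forall>\<^sub>F n in sequentially. \<bar>I n\<bar> \<le> C * h n ^ 6 * p n"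
    and Im: "((\<lambda>n. I n / h n ^ 6) \<longlongrightarrow> m) (dense_regime h l)"
    and p1: "(p \<longlongrightarrow> 1) (dense_regime h l)"
begin

lemma scales: "(\<lambda>n. C * (h n)\<^sup>2) \<longlonglongrightarrow> 0" "(\<lambda>n. m * h n ^ 6) \<longlonglongrightarrow> 0" "(\<lambda>n. (h n)\<^sup>2 * (h n / l n)) \<longlonglongrightarrow> 0" "(\<lambda>n. h n ^ 6) \<longlonglongrightarrow> 0"
proof -
  have "(\<lambda>n. C * (h n)\<^sup>2) \<longlonglongrightarrow> C * 0\<^sup>2" "(\<lambda>n. m * h n ^ 6) \<longlonglongrightarrow> m * 0 ^ 6" "(\<lambda>n. (h n)\<^sup>2 * (h n / l n)) \<longlonglongrightarrow> 0\<^sup>2 * 0" "(\<lambda>n. h n ^ 6) \<longlonglongrightarrow> 0 ^ 6"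
    by (intro tendsto_intros h l)+
  then show "(\<lambda>n. C * (h n)\<^sup>2) \<longlonglongrightarrow> 0" "(\<lambda>n. m * h n ^ 6) \<longlonglongrightarrow> 0" "(\<lambda>n. (h n)\<^sup>2 * (h n / l n)) \<longlonglongrightarrow> 0" "(\<lambda>n. h n ^ 6) \<longlonglongrightarrow> 0"
    by simp_all
qed

text \<open>Because \<open>Ih\<close> carries the factor p, the quotient I / p is O(h^6) however
  unlikely the good event is, and it is 0 when p = 0. In the dense regime p tends to 1 and the
  quotient inherits the limit m. In the comparison with J / p the probability cancels.\<close>

lemma conditional_bias:
  "equal_up_to (\<lambda>n. I n / p n) (\<lambda>n. m * h n ^ 6) (\<lambda>n. (h n)\<^sup>2 * (h n / l n)) (\<lambda>n. h n ^ 6)"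
  "(\<lambda>n. I n / p n) \<in> o(\<lambda>n. J n / p n)"
proof -
  define e where "e n = I n / p n - m * h n ^ 6" for n
  have "\<exists>u\<in>O(\<lambda>n. (h n)\<^sup>2 * (h n / l n)). \<exists>v\<in>o(\<lambda>n. h n ^ 6). \<forall>n. e n = u n + v n"
  proof (rule regime_split[OF h(1) l(1)])
    show "\<forall>\<^sub>F n in sequentially. \<bar>e n\<bar> \<le> (C + \<bar>m\<bar>) * h n ^ 6"
      using Ih
    proof eventually_elim
      case (elim n)
      have "\<bar>I n / p n\<bar> \<le> C * h n ^ 6"
      proof (cases "p n = 0")
        case False
        then have "0 < p n" using p(1)[of n] by linarith
        then show ?thesis using elim by (simp add: abs_divide pos_divide_le_eq)
      qed (use C h(1)[of n] in simp)
      moreover have "\<bar>m * h n ^ 6\<bar> = \<bar>m\<bar> * h n ^ 6" using h(1)[of n] by (simp add: abs_mult)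
      ultimately show ?case unfolding e_def distrib_right by linarith
    qed
    have "((\<lambda>n. (I n / h n ^ 6) / p n - m) \<longlongrightarrow> m / 1 - m) (dense_regime h l)"
      by (intro tendsto_intros Im p1) simp
    moreover have "(I n / h n ^ 6) / p n - m = e n / h n ^ 6" for n
      using h(1)[of n] by (simp add: e_def diff_divide_distrib mult.commute)
    ultimately show "((\<lambda>n. e n / h n ^ 6) \<longlongrightarrow> 0) (dense_regime h l)" by simp
  qed
  then show "equal_up_to (\<lambda>n. I n / p n) (\<lambda>n. m * h n ^ 6) (\<lambda>n. (h n)\<^sup>2 * (h n / l n)) (\<lambda>n. h n ^ 6)"
    unfolding equal_up_to_def e_def by (force simp: algebra_simps)
  show "(\<lambda>n. I n / p n) \<in> o(\<lambda>n. J n / p n)"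
  proof (rule smallo_if_le[OF scales(1)])
    show "\<forall>\<^sub>F n in sequentially. \<bar>I n / p n\<bar> \<le> C * (h n)\<^sup>2 * \<bar>J n / p n\<bar>"
      using IJ
    proof eventually_elim
      case (elim n)
      then have "\<bar>I n\<bar> / p n \<le> (C * (h n)\<^sup>2 * \<bar>J n\<bar>) / p n" using p(1)[of n] by (intro divide_right_mono)
      then show ?case using p(1)[of n] by (simp add: abs_divide)
    qed
  qed
qed

lemma conditional_unbiased:
  "(\<lambda>n. I n / p n) \<longlonglongrightarrow> 0" "(\<lambda>n. I n / p n) \<in> o(\<lambda>n. (I n + J n) / p n)"
  using equal_up_to_tendsto_zero[OF conditional_bias(1) scales(2-4)] smallo_plus_self[OF conditional_bias(2)]
  by (simp_all add: add_divide_distrib)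

text \<open>Here \<open>b\<close> is the full bias, which differs from the integral over the good
  event by at most \<open>rest\<close>. The two halves of the negligibility condition serve separate
  ends: one protects the remainder terms of the expansion, the other the comparison with the
  target.\<close>

lemma unconditional_bias:
  fixes b rest :: "nat \<Rightarrow> real"
  assumes le: "\<forall>\<^sub>F n in sequentially. \<bar>b n - I n\<bar> \<le> rest n"
    and "rest \<in> o(T)" and eq: "equal_up_to rest (\<lambda>_. 0) (\<lambda>n. (h n)\<^sup>2 * (h n / l n)) (\<lambda>n. h n ^ 6)"
  shows "equal_up_to b (\<lambda>n. m * h n ^ 6) (\<lambda>n. (h n)\<^sup>2 * (h n / l n)) (\<lambda>n. h n ^ 6)"
    "b \<longlonglongrightarrow> 0" "b \<in> o(T)" "b \<in> o(\<lambda>n. b n + T n)"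
proof -
  have "\<exists>u\<in>O(\<lambda>n. (h n)\<^sup>2 * (h n / l n)). \<exists>v\<in>o(\<lambda>n. h n ^ 6). \<forall>n. I n - m * h n ^ 6 = u n + v n"
  proof (rule regime_split[OF h(1) l(1)])
    show "\<forall>\<^sub>F n in sequentially. \<bar>I n - m * h n ^ 6\<bar> \<le> (C + \<bar>m\<bar>) * h n ^ 6"
      using Ih
    proof eventually_elim
      case (elim n)
      have "C * h n ^ 6 * p n \<le> C * h n ^ 6 * 1" using p[of n] C h(1)[of n] by (intro mult_left_mono) auto
      moreover have "\<bar>m * h n ^ 6\<bar> = \<bar>m\<bar> * h n ^ 6" using h(1)[of n] by (simp add: abs_mult)
      ultimately show ?case unfolding distrib_right using elim by linarith
    qed
    have "((\<lambda>n. I n / h n ^ 6 - m) \<longlongrightarrow> m - m) (dense_regime h l)"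
      by (intro tendsto_intros Im)
    moreover have "I n / h n ^ 6 - m = (I n - m * h n ^ 6) / h n ^ 6" for n
      using h(1)[of n] by (simp add: diff_divide_distrib)
    ultimately show "((\<lambda>n. (I n - m * h n ^ 6) / h n ^ 6) \<longlongrightarrow> 0) (dense_regime h l)" by simp
  qed
  then obtain u1 v1 where 1: "u1 \<in> O(\<lambda>n. (h n)\<^sup>2 * (h n / l n))" "v1 \<in> o(\<lambda>n. h n ^ 6)" "\<And>n. I n - m * h n ^ 6 = u1 n + v1 n"
    by blast
  obtain u0 v0 where 0: "u0 \<in> O(\<lambda>n. (h n)\<^sup>2 * (h n / l n))" "v0 \<in> o(\<lambda>n. h n ^ 6)" "\<And>n. rest n = u0 n + v0 n"
    using eq unfolding equal_up_to_def by auto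
  have "\<forall>\<^sub>F n in sequentially. \<bar>b n - I n\<bar> \<le> \<bar>u0 n\<bar> + \<bar>v0 n\<bar>"
    using le by eventually_elim (use 0(3) in \<open>smt (verit)\<close>)
  from bigo_smallo_split[OF 0(1,2) this] obtain u2 v2 where 2: "u2 \<in> O(\<lambda>n. (h n)\<^sup>2 * (h n / l n))" "v2 \<in> o(\<lambda>n. h n ^ 6)"
    "\<And>n. b n - I n = u2 n + v2 n" by blast
  have "b n = m * h n ^ 6 + (u1 n + u2 n) + (v1 n + v2 n)" for n using 1(3)[of n] 2(3)[of n] by linarith
  then show up: "equal_up_to b (\<lambda>n. m * h n ^ 6) (\<lambda>n. (h n)\<^sup>2 * (h n / l n)) (\<lambda>n. h n ^ 6)"
    unfolding equal_up_to_def
    by (intro bexI[of _ "\<lambda>n. u1 n + u2 n"] bexI[of _ "\<lambda>n. v1 n + v2 n"] allI sum_in_bigo sum_in_smallo 1(1,2) 2(1,2))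
  show "b \<longlonglongrightarrow> 0" by (rule equal_up_to_tendsto_zero[OF up scales(2-4)])
  have "I \<in> o(T)"
  proof (rule smallo_if_le[OF scales(1)])
    show "\<forall>\<^sub>F n in sequentially. \<bar>I n\<bar> \<le> C * (h n)\<^sup>2 * \<bar>T n\<bar>"
      using IJ JT
    proof eventually_elim
      case (elim n)
      have "C * (h n)\<^sup>2 * \<bar>J n\<bar> \<le> C * (h n)\<^sup>2 * \<bar>T n\<bar>" using elim(2) C by (intro mult_left_mono) auto
      with elim(1) show ?case by linarith
    qed
  qed
  moreover have "(\<lambda>n. b n - I n) \<in> O(rest)"
    by (rule landau_o.bigI[of 1]) (use le in \<open>auto elim!: eventually_mono\<close>)
  then have "(\<lambda>n. b n - I n) \<in> o(T)" using \<open>rest \<in> o(T)\<close> by (rule landau_o.big_small_trans)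
  ultimately have "(\<lambda>n. I n + (b n - I n)) \<in> o(T)" by (rule sum_in_smallo)
  then show bT: "b \<in> o(T)" by simp
  show "b \<in> o(\<lambda>n. b n + T n)" by (rule smallo_plus_self[OF bT])
qed

end

section \<open>Lower bound for the target and transfer of limits\<close>

lemma C1_near_zero_isCont: "C1_near_zero f \<Longrightarrow> isCont f 0"
  unfolding C1_near_zero_def using has_derivative_continuous by blast

text \<open>The leading term is - (cd2 + 8 cd1) \<beta> a^4, so near zero the target has the fixed
  sign \<sigma> = - sgn \<beta>. A fixed sign excludes cancellation in integrals of the target over
  random steps.\<close>

lemma phi2_lower_bound:
  assumes d: "2 \<le> d" and F: "order6_expansion F \<alpha> \<beta> \<gamma>" and "\<beta> \<noteq> 0"
  obtains c \<delta> \<sigma> where "0 < c" "0 < \<delta>" "\<bar>\<sigma>\<bar> = 1" "\<And>a. 0 \<le> a \<Longrightarrow> a < \<delta> \<Longrightarrow> c * a ^ 4 \<le> \<sigma> * phi2 d F a"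
proof -
  note cp = cd_pos[OF d]
  define D where "D = cd2 d + 8 * cd1 d"
  define E where "E = 24 * real d * (real d + 4) * \<bar>\<gamma>\<bar> + (cd2 d + cd3 d * 8 + cd1 d * 64)"
  have "0 < D" using cp by (simp add: D_def)
  have "0 < E" unfolding E_def using cp by (intro add_nonneg_pos) auto
  obtain r0 where r0: "0 < r0" "\<And>r. 0 \<le> r \<Longrightarrow> r < r0 \<Longrightarrow> \<bar>F r - (\<alpha> * r ^ 2 + \<beta> * r ^ 4 + \<gamma> * r ^ 6)\<bar> \<le> 1 * r ^ 6"
    using F unfolding order6_expansion_def by (meson zero_less_one)
  define \<rho> where "\<rho> r = F r - (\<alpha> * r ^ 2 + \<beta> * r ^ 4 + \<gamma> * r ^ 6)" for r
  define c where "c = D * \<bar>\<beta>\<bar> / 2"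
  have "0 < c" using \<open>0 < D\<close> \<open>\<beta> \<noteq> 0\<close> by (simp add: c_def)
  \<comment> \<open>Here c is half the leading coefficient. For a < 1 and a < c / E the sixth-order
    part E a^6 uses up at most the other half; r0 / 2 keeps 2 a in the range of the
    expansion.\<close>
  define \<delta> where "\<delta> = min (r0 / 2) (min 1 (c / E))"
  have "0 < \<delta>" using r0 \<open>0 < c\<close> \<open>0 < E\<close> by (simp add: \<delta>_def)
  have "c * a ^ 4 \<le> - sgn \<beta> * phi2 d F a" if a: "0 \<le> a" "a < \<delta>" for a
  proof -
    have ar: "2 * a < r0" "a < 1" "a < c / E" using a by (auto simp: \<delta>_def)
    have s2: "sqrt 2 * a \<le> 2 * a" using sqrt2_less_2 a by (intro mult_right_mono) auto
    have s6: "(sqrt 2 * a) ^ 6 = 8 * a ^ 6" using power_mult[of "sqrt 2" 2 3] by (simp add: power_mult_distrib)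
    have "\<bar>cd2 d * \<rho> a\<bar> \<le> cd2 d * a ^ 6"
      unfolding abs_mult using cp r0(2)[of a] a ar by (simp add: \<rho>_def mult_left_mono)
    moreover have "\<bar>cd3 d * \<rho> (sqrt 2 * a)\<bar> \<le> cd3 d * (8 * a ^ 6)"
      unfolding abs_mult using cp r0(2)[of "sqrt 2 * a"] a ar s2 unfolding s6 by (simp add: \<rho>_def mult_left_mono s6)
    moreover have "\<bar>cd1 d * \<rho> (2 * a)\<bar> \<le> cd1 d * (64 * a ^ 6)"
      unfolding abs_mult using cp r0(2)[of "2 * a"] a ar by (simp add: \<rho>_def mult_left_mono power_mult_distrib)
    ultimately have "\<bar>phi2 d \<rho> a\<bar> \<le> cd2 d * a ^ 6 + cd3 d * (8 * a ^ 6) + cd1 d * (64 * a ^ 6)"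
      unfolding phi2_def by linarith
    then have r: "\<bar>phi2 d \<rho> a\<bar> \<le> (cd2 d + cd3 d * 8 + cd1 d * 64) * a ^ 6" by (simp add: algebra_simps)
    define g where "g = 24 * real d * (real d + 4) * \<gamma> * a ^ 6"
    have g: "\<bar>g\<bar> = 24 * real d * (real d + 4) * \<bar>\<gamma>\<bar> * a ^ 6" using a by (simp add: g_def abs_mult)
    have eq: "phi2 d F a = - D * \<beta> * a ^ 4 - g + phi2 d \<rho> a"
      unfolding D_def g_def by (rule phi2_expansion[where \<alpha> = \<alpha>, OF a(1)]) (simp add: \<rho>_def)
    have "- sgn \<beta> * phi2 d F a = D * (sgn \<beta> * \<beta>) * a ^ 4 + sgn \<beta> * (g - phi2 d \<rho> a)"
      unfolding eq by (simp add: algebra_simps)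
    moreover have "sgn \<beta> * \<beta> = \<bar>\<beta>\<bar>" by (simp add: abs_sgn mult.commute)
    moreover have "\<bar>sgn \<beta> * (g - phi2 d \<rho> a)\<bar> \<le> E * a ^ 6"
    proof -
      have "\<bar>sgn \<beta> * (g - phi2 d \<rho> a)\<bar> = \<bar>g - phi2 d \<rho> a\<bar>" using \<open>\<beta> \<noteq> 0\<close> by (simp add: abs_mult abs_sgn_eq)
      also have "\<dots> \<le> \<bar>g\<bar> + \<bar>phi2 d \<rho> a\<bar>" by (rule abs_triangle_ineq4)
      also have "\<dots> \<le> E * a ^ 6" using r unfolding g E_def by (simp add: distrib_right)
      finally show ?thesis .
    qed
    moreover have "E * a ^ 6 \<le> c * a ^ 4"
    proof -
      have "E * a\<^sup>2 \<le> E * a" using \<open>0 < E\<close> a ar mult_left_mono[of a 1 a] by (simp add: power2_eq_square)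
      also have "\<dots> \<le> c" using ar \<open>0 < E\<close> by (simp add: pos_less_divide_eq mult.commute)
      finally have "E * a\<^sup>2 * a ^ 4 \<le> c * a ^ 4" using a by (intro mult_right_mono) auto
      then show ?thesis by (simp add: mult.assoc flip: power_add)
    qed
    moreover have "D * \<bar>\<beta>\<bar> * a ^ 4 = 2 * (c * a ^ 4)" by (simp add: c_def)
    ultimately show ?thesis by simp
  qed
  moreover have "\<bar>- sgn \<beta>\<bar> = 1" using \<open>\<beta> \<noteq> 0\<close> by (simp add: abs_sgn_eq)
  ultimately show thesis using \<open>0 < c\<close> \<open>0 < \<delta>\<close> by (intro that[of c \<delta> "- sgn \<beta>"])
qed

text \<open>On E n the integrand is close to m, and elsewhere it differs from m by at most C + |m|,
  on a set whose probability tends to zero. Eventually E n lies in G n, so the probability of G n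
  tends to 1 too.\<close>

lemma (in prob_space) integral_limit_on_events:
  fixes e :: "nat \<Rightarrow> 'a \<Rightarrow> real"
  assumes E[measurable]: "\<And>n. E n \<in> events" and G[measurable]: "\<And>n. G n \<in> events" and E1: "((\<lambda>n. prob (E n)) \<longlongrightarrow> 1) Fl"
    and int: "\<forall>\<^sub>F n in Fl. integrable M (\<lambda>v. e n v * indicator (G n) v)"
    and bd: "\<forall>\<^sub>F n in Fl. \<forall>v\<in>G n. \<bar>e n v\<bar> \<le> C" and "0 \<le> C"
    and lim: "\<And>\<eta>. 0 < \<eta> \<Longrightarrow> \<forall>\<^sub>F n in Fl. \<forall>v\<in>E n. v \<in> G n \<and> \<bar>e n v - m\<bar> < \<eta>"
  shows "((\<lambda>n. expectation (\<lambda>v. e n v * indicator (G n) v)) \<longlongrightarrow> m) Fl" "((\<lambda>n. prob (G n)) \<longlongrightarrow> 1) Fl"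
proof -
  show "((\<lambda>n. prob (G n)) \<longlongrightarrow> 1) Fl"
  proof (rule tendsto_sandwich[OF _ _ E1 tendsto_const[of 1]])
    show "\<forall>\<^sub>F n in Fl. prob (E n) \<le> prob (G n)"
      using lim[OF zero_less_one] by eventually_elim (auto intro!: finite_measure_mono)
  qed simp
  show "((\<lambda>n. expectation (\<lambda>v. e n v * indicator (G n) v)) \<longlongrightarrow> m) Fl"
  proof (rule tendstoI)
    fix \<eta> :: real assume "0 < \<eta>"
    have "((\<lambda>n. (C + \<bar>m\<bar>) * (1 - prob (E n))) \<longlongrightarrow> (C + \<bar>m\<bar>) * (1 - 1)) Fl" by (intro tendsto_intros E1)
    then have "\<forall>\<^sub>F n in Fl. (C + \<bar>m\<bar>) * (1 - prob (E n)) < \<eta> / 2"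
      by (rule order_tendstoD) (use \<open>0 < \<eta>\<close> in simp)
    moreover have "\<forall>\<^sub>F n in Fl. \<forall>v\<in>E n. v \<in> G n \<and> \<bar>e n v - m\<bar> < \<eta> / 2" by (rule lim) (use \<open>0 < \<eta>\<close> in simp)
    ultimately show "\<forall>\<^sub>F n in Fl. dist (expectation (\<lambda>v. e n v * indicator (G n) v)) m < \<eta>"
      using int bd
    proof eventually_elim
      case (elim n)
      have "expectation (\<lambda>v. e n v * indicator (G n) v) - m = expectation (\<lambda>v. e n v * indicator (G n) v - m)"
        using elim(3) by (simp add: prob_space)
      also have "\<bar>\<dots>\<bar> \<le> expectation (\<lambda>v. \<bar>e n v * indicator (G n) v - m\<bar>)" by (rule integral_abs_bound)
      also have "\<dots> \<le> expectation (\<lambda>v. \<eta> / 2 + (C + \<bar>m\<bar>) * (1 - indicator (E n) v))"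
      proof (rule integral_mono)
        show "integrable M (\<lambda>v. \<bar>e n v * indicator (G n) v - m\<bar>)" using elim(3) by simp
        show "integrable M (\<lambda>v. \<eta> / 2 + (C + \<bar>m\<bar>) * (1 - indicator (E n) v))"
          by (intro Bochner_Integration.integrable_add integrable_mult_right Bochner_Integration.integrable_diff)
            (simp_all add: integrable_indicator_iff less_top[symmetric])
        fix v
        show "\<bar>e n v * indicator (G n) v - m\<bar> \<le> \<eta> / 2 + (C + \<bar>m\<bar>) * (1 - indicator (E n) v)"
        proof (cases "v \<in> E n")
          case True
          then have "v \<in> G n" "\<bar>e n v - m\<bar> < \<eta> / 2" using elim(2) by auto
          with True show ?thesis by simp
        next
          case False
          have "\<bar>e n v * indicator (G n) v\<bar> \<le> C" using elim(4) \<open>0 \<le> C\<close> by (auto split: split_indicator)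
          with False show ?thesis using \<open>0 < \<eta>\<close> by simp
        qed
      qed
      also have "\<dots> = \<eta> / 2 + (C + \<bar>m\<bar>) * (1 - prob (E n))"
        by (subst Bochner_Integration.integral_add)
          (simp_all add: prob_space integrable_indicator_iff less_top[symmetric])
      also have "\<dots> < \<eta>" using elim(1) by simp
      finally show ?case by (simp add: dist_real_def)
    qed
  qed
qed

text \<open>\<open>equal_up_to\<close> demands an identity for every n; finitely many exceptional
  indices can be absorbed by either remainder.\<close>

lemma equal_up_to_eventually:
  assumes "equal_up_to x y r r'" and ev: "\<forall>\<^sub>F n in sequentially. x' n = x n"
  shows "equal_up_to x' y r r'"
proof -
  obtain u v where uv: "u \<in> O(r)" "v \<in> o(r')" "\<And>n. x n = y n + u n + v n"
    using assms(1) unfolding equal_up_to_def by blast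
  have "\<forall>\<^sub>F n in sequentially. \<bar>x' n - y n\<bar> \<le> \<bar>u n\<bar> + \<bar>v n\<bar>"
    using ev by eventually_elim (simp add: uv(3) abs_triangle_ineq)
  from bigo_smallo_split[OF uv(1,2) this] obtain u' v' where "u' \<in> O(r)" "v' \<in> o(r')" "\<forall>n. x' n - y n = u' n + v' n" by blast
  moreover from this(3) have "x' n = y n + u' n + v' n" for n by (metis add.assoc add.commute diff_add_cancel)
  ultimately show ?thesis unfolding equal_up_to_def by blast
qed

lemma asymptotically_unbiased_eventually:
  assumes b: "\<forall>\<^sub>F n in sequentially. bias Q est tgt n = b n"
    and be: "\<forall>\<^sub>F n in sequentially. (\<integral>z. est n z \<partial>Q n) = e n" and bt: "\<forall>\<^sub>F n in sequentially. (\<integral>z. tgt n z \<partial>Q n) = t n"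
    and "b \<longlonglongrightarrow> 0" "b \<in> o(e)" "b \<in> o(t)"
  shows "asymptotically_unbiased Q est tgt"
proof -
  have b': "\<forall>\<^sub>F n in sequentially. b n = bias Q est tgt n" using b by eventually_elim simp
  have "bias Q est tgt \<longlonglongrightarrow> 0" using \<open>b \<longlonglongrightarrow> 0\<close> b' by (rule Lim_transform_eventually)
  moreover have "bias Q est tgt \<in> o(g)" if "b \<in> o(g')" "\<forall>\<^sub>F n in sequentially. g n = g' n" for g g'
    using that landau_o.small.in_cong[OF b, of g'] landau_o.small.cong[OF that(2)] by blast
  note this[OF assms(5) be] this[OF assms(6) bt]
  ultimately show ?thesis unfolding asymptotically_unbiased_def by simp
qed

text \<open>A squared increment expands into products of two field values, whose means are joint
  moments over lists of length two.\<close>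

lemma semivariogram_of_moments:
  assumes N0: "stationary_isotropic_field N\<^sub>0 Xlam" "is_semivariogram N\<^sub>0 Xlam F"
    and mom: "same_joint_moments N X N\<^sub>0 Xlam"
  shows "integrable N (\<lambda>w. (X p w - X q w)\<^sup>2)" "(\<integral>w. (X p w - X q w)\<^sup>2 \<partial>N) = 2 * F (dist p q)"
proof -
  have i0: "integrable N\<^sub>0 (\<lambda>w. Xlam p w * Xlam q w)" for p q
    using N0(1) unfolding stationary_isotropic_field_def by (auto intro!: integrable_prod_of_squares)
  have m: "(integrable N (\<lambda>w. X p w * X q w) \<longleftrightarrow> integrable N\<^sub>0 (\<lambda>w. Xlam p w * Xlam q w))
      \<and> (\<integral>w. X p w * X q w \<partial>N) = (\<integral>w. Xlam p w * Xlam q w \<partial>N\<^sub>0)" for p q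
    using mom[unfolded same_joint_moments_def, rule_format, of "[p, q]"] by simp
  have i: "integrable N (\<lambda>w. X p w * X q w)" for p q using m i0 by blast
  have sq: "(a - b)\<^sup>2 = a * a - 2 * (a * b) + b * b" for a b :: real by (simp add: power2_eq_square algebra_simps)
  show "integrable N (\<lambda>w. (X p w - X q w)\<^sup>2)" unfolding sq using i by simp
  have "(\<integral>w. (X p w - X q w)\<^sup>2 \<partial>N) = (\<integral>w. (Xlam p w - Xlam q w)\<^sup>2 \<partial>N\<^sub>0)"
    unfolding sq using i i0 m by simp
  then show "(\<integral>w. (X p w - X q w)\<^sup>2 \<partial>N) = 2 * F (dist p q)"
    using N0(2)[unfolded is_semivariogram_def, rule_format, of p q] by simp
qed

section \<open>The bias of the curvature constraint\<close>

theorem theorem4: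
  fixes N\<^sub>0 :: "'a measure" and Xlam :: "real ^ 'd \<Rightarrow> 'a \<Rightarrow> real" and F :: "real \<Rightarrow> real"
    and N :: "'w measure" and X :: "real ^ 'd \<Rightarrow> 'w \<Rightarrow> real"
    and P :: "'v measure" and U :: "nat \<Rightarrow> 'v \<Rightarrow> real ^ 'd"
    and \<Omega> :: "nat \<Rightarrow> (real ^ 'd) set" and vol L h q :: "nat \<Rightarrow> real"
    and K :: "real \<Rightarrow> real" and R :: real
    and f\<^sub>1 :: "real ^ 'd \<Rightarrow> real"
    and f\<^sub>2 :: "(real ^ 'd) \<times> (real ^ 'd) \<Rightarrow> real"
    and f\<^sub>3 :: "(real ^ 'd) \<times> (real ^ 'd) \<times> (real ^ 'd) \<Rightarrow> real"
    and f\<^sub>c :: "(real ^ 'd) \<times> (real ^ 'd) \<Rightarrow> real"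
    and \<psi> :: "real \<Rightarrow> real \<Rightarrow> real \<Rightarrow> real \<Rightarrow> real" and \<xi> c\<^sub>1 :: real
    and g\<^sub>1 :: "real \<Rightarrow> real" and g\<^sub>2 :: "real \<Rightarrow> real \<Rightarrow> real \<Rightarrow> real"
    and g\<^sub>3 :: "real \<Rightarrow> real \<Rightarrow> real \<Rightarrow> real ^ 'd \<Rightarrow> real ^ 'd \<Rightarrow> real ^ 'd \<Rightarrow> real"
    and B :: "nat \<Rightarrow> real" and d :: nat
  defines "d \<equiv> CARD('d)"
    and "vol \<equiv> (\<lambda>n. measure lebesgue (convex hull (\<Omega> n)))"
    and "q \<equiv> (\<lambda>n. h n / L n)"
    and "B \<equiv> Bmom K R d"
  assumes dim: "2 \<le> d"
    and "prob_space N\<^sub>0" and "stationary_isotropic_field N\<^sub>0 Xlam"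
    and "is_semivariogram N\<^sub>0 Xlam F"
    and "prob_space N" and "(\<lambda>(p, w). X p w) \<in> borel_measurable (borel \<Otimes>\<^sub>M N)"
    and "prob_space P"
    and "\<And>n. bounded (\<Omega> n)" and "filterlim vol at_top sequentially"
    and "\<exists>c>0. \<forall>n. L n = c * vol n powr (1 / real d)"
    and "\<And>i. AE v in P. \<forall>k. U i v $ k \<in> {0..1}"
    and "\<And>n i. i < n \<Longrightarrow> AE v in P. sites L U n v i \<in> \<Omega> n"
    and "is_kernel K R" and "\<And>n. 0 < h n"
    and iid: "prob_space.indep_vars P (\<lambda>_. borel) U UNIV"
            "\<And>i. distr P borel (U i) = distr P borel (U 0)"
    and density1: "\<And>x. 0 \<le> f\<^sub>1 x"
            "\<And>i j. i \<noteq> j \<Longrightarrow> distributed P lborel (\<lambda>v. U i v - U j v) (\<lambda>x. ennreal (f\<^sub>1 x))"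
            "C1_near_zero f\<^sub>1"
    and density2_3: "\<And>x. 0 \<le> f\<^sub>2 x"
            "\<And>i j k. distinct [i, j, k] \<Longrightarrow>
               distributed P lborel (\<lambda>v. (U i v - U j v, U i v - U k v)) (\<lambda>x. ennreal (f\<^sub>2 x))"
            "C1_near_zero f\<^sub>2"
            "\<And>x. 0 \<le> f\<^sub>3 x"
            "\<And>i j k l. distinct [i, j, k, l] \<Longrightarrow>
               distributed P lborel (\<lambda>v. (U i v - U j v, U i v - U k v, U i v - U l v))
                 (\<lambda>x. ennreal (f\<^sub>3 x))"
            "C1_near_zero f\<^sub>3"
    and cond_density: "\<And>i j. i \<noteq> j \<Longrightarrow>
               distributed P (distr P borel (U j) \<Otimes>\<^sub>M lborel) (\<lambda>v. (U j v, U i v - U j v))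
                 (\<lambda>y. ennreal (f\<^sub>c y))"
            "\<And>y. 0 \<le> f\<^sub>c y" "\<exists>C. \<forall>u x. f\<^sub>c (u, x) \<le> C"
    and moments: "same_joint_moments N X N\<^sub>0 Xlam"
    and F_cont: "\<exists>\<epsilon>>0. continuous_on {0..<\<epsilon>} F"
    and sq_cov: "continuous_on UNIV (\<lambda>(r, s, t, u). \<psi> r s t u)"
            "\<exists>C. \<forall>r s t u. \<bar>\<psi> r s t u\<bar> \<le> C"
            "\<And>p p'. integrable N (\<lambda>w. (X p w - X p' w) ^ 4)"
            "\<And>p\<^sub>i p\<^sub>j p\<^sub>p p\<^sub>q.
               cov N (\<lambda>w. (X p\<^sub>i w - X p\<^sub>j w)\<^sup>2) (\<lambda>w. (X p\<^sub>p w - X p\<^sub>q w)\<^sup>2)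
               = \<psi> (dist p\<^sub>i p\<^sub>p) (dist p\<^sub>j p\<^sub>q) (dist p\<^sub>i p\<^sub>q) (dist p\<^sub>j p\<^sub>p)"
    and sq_cov_expansion: "0 < \<xi>" "1 \<le> c\<^sub>1" "covariance_expansion \<psi> \<xi> c\<^sub>1 g\<^sub>1 g\<^sub>2 g\<^sub>3"
    and g3_integral: "bounded_radial_integral R g\<^sub>3"
    and bandwidth: "h \<longlonglongrightarrow> 0"
    and infill: "(\<lambda>n. vol n / real n) \<longlonglongrightarrow> 0"
    and "differentiable_near_zero 5 (even_ext F)"
    and "(deriv ^^ 5) (even_ext F) differentiable (at 0)"
  defines "est \<equiv> estimator K L U X h" and "tgt \<equiv> target K L U F h"
    and "main \<equiv> (\<lambda>n. - 24 * real d * (real d + 4) * tau F 6 * h n ^ 6 * (B 6 - B 4 powr (3/2)))"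
  shows "\<forall>\<kappa>\<in>{0<..<1}.
           (let Q = (\<lambda>n. uniform_measure (N \<Otimes>\<^sub>M P) (good_event N P \<kappa> K R L U h n)) in
              asymptotically_unbiased Q est tgt \<and>
              equal_up_to (bias Q est tgt) main (\<lambda>n. (h n)\<^sup>2 * q n) (\<lambda>n. h n ^ 6)) \<and>
           (negligible_outside (N \<Otimes>\<^sub>M P) (good_event N P \<kappa> K R L U h) est tgt
              (\<lambda>n. (h n)\<^sup>2 * q n) (\<lambda>n. h n ^ 6) \<longrightarrow>
            (let Q = (\<lambda>n. N \<Otimes>\<^sub>M P) in
              asymptotically_unbiased Q est tgt \<and>
              equal_up_to (bias Q est tgt) main (\<lambda>n. (h n)\<^sup>2 * q n) (\<lambda>n. h n ^ 6)))"
proof -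
  define M where "M = N \<Otimes>\<^sub>M P"
  define s where "s n v = sites L U n v" for n v
  define m where "m = - 24 * real d * (real d + 4) * tau F 6 * (B 6 - B 4 powr (3 / 2))"
  have K: "is_kernel K R" by fact
  have R: "0 < R" using K by (simp add: is_kernel_def)
  have d: "2 \<le> CARD('d)" using dim by (simp add: d_def)
  have h: "\<And>n. 0 < h n" by fact
  have N0: "stationary_isotropic_field N\<^sub>0 Xlam" "is_semivariogram N\<^sub>0 Xlam F" by fact+
  obtain b where b: "\<And>p q :: real ^ 'd. 0 \<le> F (dist p q) \<and> F (dist p q) \<le> b"
    using semivariogram_bounded[OF N0] by blast
  have Fb: "0 \<le> F r \<and> F r \<le> b" if "0 \<le> r" for r
    using b[of "r *\<^sub>R axis undefined 1" 0] that by (simp add: norm_axis_1)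
  obtain \<epsilon> where \<epsilon>: "0 < \<epsilon>" "continuous_on {0..<\<epsilon>} F" using F_cont by blast
  have F0: "F 0 = 0" using N0(2)[unfolded is_semivariogram_def, rule_format, of 0 0] by simp
  have F6: "order6_expansion F (tau F 2) (tau F 4) (tau F 6)"
    unfolding order6_expansion_def
    using even_taylor[OF F0 \<open>differentiable_near_zero 5 (even_ext F)\<close> \<open>(deriv ^^ 5) (even_ext F) differentiable (at 0)\<close>]
    by blast
  interpret N: prob_space N by fact
  interpret sp: sampling P U f\<^sub>1 f\<^sub>2
  proof (intro sampling.intro sampling_axioms.intro)
    show "prob_space P" by fact
    show "isCont f\<^sub>1 0" "isCont f\<^sub>2 0" using density1(3) density2_3(3) by (simp_all add: C1_near_zero_isCont)
  qed (use iid density1(1,2) density2_3(1,2) \<open>\<And>i. AE v in P. \<forall>k. U i v $ k \<in> {0..1}\<close> in auto)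
  interpret sf: sampled_field N P X F b \<epsilon>
  proof (intro sampled_field.intro sampled_field_axioms.intro)
    show "prob_space N" "prob_space P" by fact+
    show "(\<lambda>(p, w). X p w) \<in> borel_measurable (borel \<Otimes>\<^sub>M N)" by fact
  qed (use semivariogram_of_moments[OF N0 moments] Fb \<epsilon> in auto)
  have fM: "finite_measure M" unfolding M_def by (rule sf.NP.finite_measure_axioms)
  have sm: "(\<lambda>v. s n v i) \<in> borel_measurable P" for n i
    unfolding s_def sites_def by measurable
  have s_eq: "s n v = (\<lambda>i. L n *\<^sub>R U i v)" for n v by (simp add: s_def sites_def fun_eq_iff)
  have est: "est n = (\<lambda>(w, v). phi2_bar K n (s n v) (\<lambda>i. X (s n v i) w) (h n))" for n
    by (simp add: est_def estimator_def s_def)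
  have tgt: "tgt n = (\<lambda>(w, v). phi2 CARD('d) F (step2 K n (s n v) (h n)))" for n
    by (simp add: tgt_def target_def s_def)
  have main: "main = (\<lambda>n. m * h n ^ 6)" by (simp add: main_def m_def fun_eq_iff)
  obtain c where c: "0 < c" "\<And>n. L n = c * vol n powr (1 / real d)"
    using \<open>\<exists>c>0. \<forall>n. L n = c * vol n powr (1 / real d)\<close> by blast
  have d0: "0 < d" using dim by simp
  have vol: "filterlim vol at_top sequentially" by fact
  have vol1: "\<forall>\<^sub>F n in sequentially. 1 \<le> vol n" using vol by (simp add: filterlim_at_top)
  \<comment> \<open>A volume of at least 1 keeps L above c, so q = h / L tends to zero together with
    h.\<close>
  then have Lc: "\<forall>\<^sub>F n in sequentially. c \<le> L n"
    by eventually_elim (use c in \<open>simp add: ge_one_powr_ge_zero\<close>)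
  then have L0: "\<forall>\<^sub>F n in sequentially. 0 < L n" by eventually_elim (use c(1) in linarith)
  have q0: "(\<lambda>n. h n / L n) \<longlonglongrightarrow> 0"
  proof (rule tendsto_sandwich[OF _ _ tendsto_const])
    show "\<forall>\<^sub>F n in sequentially. h n / L n \<le> h n / c"
      using Lc by eventually_elim (use h c(1) in \<open>auto intro!: divide_left_mono mult_pos_pos less_imp_le[OF h]\<close>)
    show "\<forall>\<^sub>F n in sequentially. 0 \<le> h n / L n" using L0 by eventually_elim (use h in \<open>simp add: less_imp_le\<close>)
    show "(\<lambda>n. h n / c) \<longlonglongrightarrow> 0" using tendsto_divide[OF bandwidth tendsto_const, of c] c(1) by simp
  qed
  have small: "\<forall>\<^sub>F n in sequentially. h n < t" if "0 < t" for t
    by (rule order_tendstoD(2)[OF bandwidth that])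
  show ?thesis
  proof (rule ballI)
    fix \<kappa> :: real assume "\<kappa> \<in> {0<..<1}"
    then have \<kappa>: "0 < \<kappa>" "\<kappa> < 1" by auto
    define A where "A n = good_event N P \<kappa> K R L U h n" for n
    define G where "G n = {v \<in> space P. well_conditioned \<kappa> K R n (s n v) (h n)}" for n
    define e where "e n v = curv_err K n (s n v) (h n) F" for n v
    define p where "p n = sp.prob (G n)" for n
    \<comment> \<open>Both conclusions rest on these integrals: the conditional one compares I / p
      with J / p, the unconditional one compares I, up to a negligible rest, with T.\<close>
    define I where "I n = (\<integral>z. (est n z - tgt n z) * indicator (A n) z \<partial>M)" for n
    define J where "J n = (\<integral>z. tgt n z * indicator (A n) z \<partial>M)" for n
    define T where "T n = (\<integral>z. tgt n z \<partial>M)" for n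
    have A: "A n = {(w, v) \<in> space (N \<Otimes>\<^sub>M P). well_conditioned \<kappa> K R n (s n v) (h n)}" for n
      by (simp add: A_def good_event_def s_def)
    have G[measurable]: "G n \<in> sets P" for n unfolding G_def by (rule well_conditioned_measurable[OF K sm])
    have "\<forall>\<^sub>F n in sequentially. h n < \<epsilon> / (2 * R)" by (rule small) (use \<epsilon> R in simp)
    then have small\<epsilon>: "\<forall>\<^sub>F n in sequentially. 2 * R * h n < \<epsilon>" by eventually_elim (use R in \<open>simp add: field_simps\<close>)
    have red: "A n \<in> sets M" "measure M (A n) = p n" "est n \<in> borel_measurable M" "integrable M (tgt n)"
        "T n = (\<integral>v. phi2 CARD('d) F (step2 K n (s n v) (h n)) \<partial>P)"
        "integrable M (\<lambda>z. est n z * indicator (A n) z)" "integrable M (\<lambda>z. tgt n z * indicator (A n) z)"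
        "J n = (\<integral>v. phi2 CARD('d) F (step2 K n (s n v) (h n)) * indicator (G n) v \<partial>P)"
        "I n = (\<integral>v. e n v * indicator (G n) v \<partial>P)" "integrable P (\<lambda>v. e n v * indicator (G n) v)"
      if "2 * R * h n < \<epsilon>" for n
      unfolding T_def J_def I_def p_def e_def
      using sf.restricted_error[where n = n and s = "s n", OF K d \<kappa>(1) h that sm, folded A G_def est tgt M_def]
      by simp_all
    have iG: "integrable P (\<lambda>v. x * indicator (G n) v)" "(\<integral>v. x * indicator (G n) v \<partial>P) = x * p n" for x n
      by (simp_all add: p_def integrable_indicator_iff less_top[symmetric])
    obtain C1 \<delta>1 where C1: "0 < C1" "0 < \<delta>1" and err: "\<And>n (s :: nat \<Rightarrow> real ^ 'd) h. 0 < h \<Longrightarrow> h < \<delta>1 \<Longrightarrow>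
        well_conditioned \<kappa> K R n s h \<Longrightarrow> \<bar>curv_err K n s h F\<bar> \<le> C1 * h ^ 6"
      by (rule curv_err_order6[OF K d \<kappa>(1) F6]) (rule that, assumption+)
    have ebd: "\<bar>e n v\<bar> \<le> C1 * h n ^ 6" if "h n < \<delta>1" "v \<in> G n" for n v
      unfolding e_def by (rule err) (use h that in \<open>auto simp: G_def\<close>)
    have Ih: "\<forall>\<^sub>F n in sequentially. \<bar>I n\<bar> \<le> C1 * h n ^ 6 * p n"
      using small\<epsilon> small[OF C1(2)]
    proof eventually_elim
      case (elim n)
      have "\<bar>I n\<bar> \<le> (\<integral>v. \<bar>e n v * indicator (G n) v\<bar> \<partial>P)"
        unfolding red(9)[OF elim(1)] by (rule integral_abs_bound)
      also have "\<dots> \<le> (\<integral>v. C1 * h n ^ 6 * indicator (G n) v \<partial>P)"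
        by (rule integral_mono[OF _ iG(1)]) (use red(10)[OF elim(1)] ebd[OF elim(2)] in \<open>auto split: split_indicator\<close>)
      also have "\<dots> = C1 * h n ^ 6 * p n" by (rule iG(2))
      finally show ?case .
    qed
    \<comment> \<open>If \<tau>_4 = 0, then F vanishes on all lags and I = J = 0. Otherwise the
      target is bounded below by a multiple of h^4 on the good event, two orders above the
      error.\<close>
    obtain C where C: "C1 \<le> C" "\<forall>\<^sub>F n in sequentially. \<bar>I n\<bar> \<le> C * (h n)\<^sup>2 * \<bar>J n\<bar>" "\<forall>\<^sub>F n in sequentially. \<bar>J n\<bar> \<le> \<bar>T n\<bar>"
    proof (cases "tau F 4 = 0")
      case True
      obtain \<delta> where \<delta>: "0 < \<delta>" "\<And>r. 0 \<le> r \<Longrightarrow> r < \<delta> \<Longrightarrow> \<bar>F r - (tau F 2 * r ^ 2 + tau F 4 * r ^ 4 + tau F 6 * r ^ 6)\<bar> \<le> 1 * r ^ 6"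
        using F6 unfolding order6_expansion_def by (meson zero_less_one)
      have Fz: "F r = 0" if "0 \<le> r" for r
      proof (rule semivariogram_degenerate[OF N0 \<delta>(1) _ that])
        fix r assume r: "0 \<le> r" "r < \<delta>"
        have "\<bar>tau F 6 * r ^ 6\<bar> = \<bar>tau F 6\<bar> * r ^ 6" using r by (simp add: abs_mult)
        moreover have "\<bar>F r - (tau F 2 * r ^ 2 + tau F 6 * r ^ 6)\<bar> \<le> 1 * r ^ 6"
          using \<delta>(2)[OF r] True by simp
        ultimately show "\<bar>F r - tau F 2 * r ^ 2\<bar> \<le> (1 + \<bar>tau F 6\<bar>) * r ^ 6"
          unfolding distrib_right by linarith
      qed
      have st: "0 \<le> step2 K n (s n v) (h n)" for n v by (rule step2_bounds[OF K h])
      have "e n v = 0" for n v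
        unfolding e_def curv_err_def phi2_def using curv_cmult[of K n "s n v" "h n" 0 "\<lambda>_ _. 0"] Fz st by simp
      moreover have "phi2 CARD('d) F (step2 K n (s n v) (h n)) = 0" for n v
        unfolding phi2_def using Fz st by simp
      ultimately show thesis
        by (intro that[of C1]) (use small\<epsilon> red(8,9) in \<open>auto elim!: eventually_mono\<close>)
    next
      case False
      obtain c \<delta> \<sigma> where c: "0 < c" "0 < \<delta>" "\<bar>\<sigma>\<bar> = 1" and low: "\<And>a. 0 \<le> a \<Longrightarrow> a < \<delta> \<Longrightarrow> c * a ^ 4 \<le> \<sigma> * phi2 CARD('d) F a"
        by (rule phi2_lower_bound[OF d F6 False]) (rule that, assumption+)
      \<comment> \<open>Well-conditioning gives a second lag moment of at least
        \<open>b2 * h ^ 2\<close>; by Jensen the fourth is at least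
        \<open>b2\<^sup>2 * h ^ 4\<close>, whence the constant \<open>c'\<close> in the lower bound
        of the target.\<close>
      define b2 where "b2 = \<kappa> * Bmom K R CARD('d) 2"
      have b2: "0 < b2" unfolding b2_def using \<kappa> Bmom_pos[OF K, of "CARD('d)"] by simp
      define c' where "c' = c * b2\<^sup>2"
      have c': "0 < c'" using c b2 by (simp add: c'_def)
      have "\<forall>\<^sub>F n in sequentially. h n < \<delta> / R" by (rule small) (use c R in simp)
      then have ev: "\<forall>\<^sub>F n in sequentially. c' * h n ^ 4 * p n \<le> \<bar>J n\<bar> \<and> \<bar>J n\<bar> \<le> \<bar>T n\<bar>"
        using small\<epsilon>
      proof eventually_elim
        case (elim n)
        define t where "t v = phi2 CARD('d) F (step2 K n (s n v) (h n))" for v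
        have ti: "integrable P t" unfolding t_def by (rule sf.target_measurable(2)[OF K h elim(2) sm])
        have tiG: "integrable P (\<lambda>v. t v * indicator (G n) v)"
          using integrable_mult_indicator[OF G ti] by (simp add: mult.commute)
        have lower: "c * lag_mom K n (s n v) 4 (h n) \<le> \<sigma> * t v" for v
        proof -
          have "R * h n < \<delta>" using elim(1) R by (simp add: field_simps)
          then show ?thesis using low[of "step2 K n (s n v) (h n)"] step2_bounds[OF K h, of n "s n v" n] by (simp add: t_def)
        qed
        have t0: "0 \<le> \<sigma> * t v" for v
          using lower[of v] lag_mom_bounds(1)[OF K h[of n], of n "s n v" 4] c(1) by (meson mult_nonneg_nonneg less_imp_le order_trans)
        have good: "c' * h n ^ 4 \<le> \<sigma> * t v" if "v \<in> G n" for v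
        proof -
          have wc: "well_conditioned \<kappa> K R n (s n v) (h n)" using that by (simp add: G_def)
          then have "b2 * (h n)\<^sup>2 \<le> lag_mom K n (s n v) 2 (h n)" by (simp add: well_conditioned_def Let_def b2_def mult_ac)
          then have "(b2 * (h n)\<^sup>2)\<^sup>2 \<le> (lag_mom K n (s n v) 2 (h n))\<^sup>2" using b2 by (intro power_mono) auto
          also have "\<dots> \<le> lag_mom K n (s n v) 4 (h n)"
            by (rule lag_mom_square_le[OF K h]) (use wc in \<open>simp add: well_conditioned_def Let_def\<close>)
          finally have "c * (b2 * (h n)\<^sup>2)\<^sup>2 \<le> c * lag_mom K n (s n v) 4 (h n)" using c(1) by simp
          also have "c * (b2 * (h n)\<^sup>2)\<^sup>2 = c' * h n ^ 4" by (simp add: c'_def power_mult_distrib flip: power_mult)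
          finally show ?thesis using lower[of v] by linarith
        qed
        have J: "\<sigma> * J n = (\<integral>v. \<sigma> * t v * indicator (G n) v \<partial>P)"
          unfolding red(8)[OF elim(2)] t_def[symmetric] mult.assoc by simp
        have T: "\<sigma> * T n = (\<integral>v. \<sigma> * t v \<partial>P)" unfolding red(5)[OF elim(2)] t_def[symmetric] by simp
        have iJ: "integrable P (\<lambda>v. \<sigma> * t v * indicator (G n) v)" unfolding mult.assoc using tiG by simp
        have "c' * h n ^ 4 * p n = (\<integral>v. c' * h n ^ 4 * indicator (G n) v \<partial>P)" by (rule iG(2)[symmetric])
        also have "\<dots> \<le> \<sigma> * J n"
          unfolding J by (rule integral_mono[OF iG(1) iJ]) (use good in \<open>auto split: split_indicator\<close>)
        finally have 1: "c' * h n ^ 4 * p n \<le> \<sigma> * J n" .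
        \<comment> \<open>The signed target is nonnegative for every configuration, so restricting
          to the good event can only decrease its integral.\<close>
        have 2: "\<sigma> * J n \<le> \<sigma> * T n"
          unfolding J T by (rule integral_mono[OF iJ]) (use ti t0 in \<open>auto split: split_indicator\<close>)
        have "0 \<le> c' * h n ^ 4 * p n" using c' h[of n] by (simp add: p_def)
        with 1 2 have "0 \<le> \<sigma> * J n" "0 \<le> \<sigma> * T n" by linarith+
        moreover have "\<bar>\<sigma> * J n\<bar> = \<bar>J n\<bar>" "\<bar>\<sigma> * T n\<bar> = \<bar>T n\<bar>" using c(3) by (simp_all add: abs_mult)
        ultimately show ?case using 1 2 by linarith
      qed
      show thesis
      proof (rule that)
        \<comment> \<open>\<open>C1 / c'\<close> is the ratio of the bounds C1 h^6 p and c' h^4 p,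
          from which p drops out; adding C1 lets the same constant serve the bound on I.\<close>
        show "C1 \<le> C1 + C1 / c'" using C1 c' by simp
        show "\<forall>\<^sub>F n in sequentially. \<bar>J n\<bar> \<le> \<bar>T n\<bar>" using ev by eventually_elim simp
        show "\<forall>\<^sub>F n in sequentially. \<bar>I n\<bar> \<le> (C1 + C1 / c') * (h n)\<^sup>2 * \<bar>J n\<bar>"
          using ev Ih
        proof eventually_elim
          case (elim n)
          have "\<bar>I n\<bar> \<le> (C1 / c') * (h n)\<^sup>2 * (c' * h n ^ 4 * p n)"
            using elim(2) c' by (simp add: mult_ac flip: power_add)
          also have "\<dots> \<le> (C1 / c') * (h n)\<^sup>2 * \<bar>J n\<bar>"
            using elim(1) C1 c' by (intro mult_left_mono) auto
          also have "\<dots> \<le> (C1 + C1 / c') * (h n)\<^sup>2 * \<bar>J n\<bar>"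
            using C1 by (intro mult_right_mono) auto
          finally show ?case .
        qed
      qed
    qed
    let ?F = "dense_regime h L"
    have to_regime: "\<forall>\<^sub>F n in ?F. Q n" if "\<forall>\<^sub>F n in sequentially. Q n" for Q
      using that dense_regime_le by (rule filter_leD[rotated])
    have regime: "((\<lambda>n. I n / h n ^ 6) \<longlongrightarrow> m) ?F" "(p \<longlongrightarrow> 1) ?F"
    proof -
      have dense: "((\<lambda>n. 1 / (real n ^ 2 * (h n / L n) ^ CARD('d))) \<longlongrightarrow> 0) ?F"
        using dense_regime_many_pairs[OF d0 c vol infill h] by (simp add: d_def)
      obtain E where E: "\<And>n. E n \<in> sp.events" "((\<lambda>n. sp.prob (E n)) \<longlongrightarrow> 1) ?F"
        and unif: "\<And>\<eta>. 0 < \<eta> \<Longrightarrow> \<forall>\<^sub>F n in ?F. \<forall>v\<in>E n. well_conditioned \<kappa> K R n (\<lambda>i. L n *\<^sub>R U i v) (h n) \<and>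
          \<bar>curv_err K n (\<lambda>i. L n *\<^sub>R U i v) (h n) F / h n ^ 6
          - (- 24 * real CARD('d) * (real CARD('d) + 4) * tau F 6 * (Bmom K R CARD('d) 6 - Bmom K R CARD('d) 4 powr (3 / 2)))\<bar> < \<eta>"
        by (rule sp.curv_err_uniform_limit[OF K d \<kappa> F6 dense_regime_le h
              tendsto_mono[OF dense_regime_le bandwidth] to_regime[OF L0] tendsto_mono[OF dense_regime_le q0] dense])
          (rule that, assumption+)
      have m: "m = - 24 * real CARD('d) * (real CARD('d) + 4) * tau F 6 * (Bmom K R CARD('d) 6 - Bmom K R CARD('d) 4 powr (3 / 2))"
        by (simp add: m_def d_def B_def)
      have i1: "\<forall>\<^sub>F n in ?F. integrable P (\<lambda>v. (e n v / h n ^ 6) * indicator (G n) v)"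
        using to_regime[OF small\<epsilon>]
      proof eventually_elim
        case (elim n)
        then show ?case using integrable_divide[OF red(10)[OF elim], of "h n ^ 6"] by simp
      qed
      have i2: "\<forall>\<^sub>F n in ?F. \<forall>v\<in>G n. \<bar>e n v / h n ^ 6\<bar> \<le> C1"
        using to_regime[OF small[OF C1(2)]]
      proof eventually_elim
        case (elim n)
        then show ?case using ebd[OF elim] h[of n] by (simp add: abs_divide pos_divide_le_eq)
      qed
      have i3: "\<forall>\<^sub>F n in ?F. \<forall>v\<in>E n. v \<in> G n \<and> \<bar>e n v / h n ^ 6 - m\<bar> < \<eta>" if "0 < \<eta>" for \<eta>
        using unif[OF that]
      proof eventually_elim
        case (elim n)
        then show ?case using sets.sets_into_space[OF E(1)[of n]] unfolding G_def e_def s_eq m by blast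
      qed
      note lim = sp.integral_limit_on_events[OF E(1) G E(2) i1 i2 less_imp_le[OF C1(1)] i3]
      show "(p \<longlongrightarrow> 1) ?F" using lim(2) by (simp add: p_def[abs_def])
      have "\<forall>\<^sub>F n in ?F. sp.expectation (\<lambda>v. (e n v / h n ^ 6) * indicator (G n) v) = I n / h n ^ 6"
        using to_regime[OF small\<epsilon>] by eventually_elim (use red(9) in simp)
      with lim(1) show "((\<lambda>n. I n / h n ^ 6) \<longlongrightarrow> m) ?F" by (rule Lim_transform_eventually)
    qed
    interpret be: bias_estimates I J T p h L C m
    proof
      show "\<forall>\<^sub>F n in sequentially. \<bar>I n\<bar> \<le> C * h n ^ 6 * p n"
        using Ih
      proof eventually_elim
        case (elim n)
        have "C1 * h n ^ 6 * p n \<le> C * h n ^ 6 * p n"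
          using C(1) h[of n] by (intro mult_right_mono) (auto simp: p_def)
        with elim show ?case by linarith
      qed
      show "(p \<longlongrightarrow> 1) ?F" "((\<lambda>n. I n / h n ^ 6) \<longlongrightarrow> m) ?F" by (rule regime)+
      show "0 \<le> p n" "p n \<le> 1" for n by (simp_all add: p_def)
    qed (use h bandwidth L0 q0 C C1 in auto)
    have q: "q = (\<lambda>n. h n / L n)" by (simp add: q_def)
    have diff: "integrable M (\<lambda>z. (est n z - tgt n z) * indicator (A n) z)" if "2 * R * h n < \<epsilon>" for n
      using Bochner_Integration.integrable_diff[OF red(6)[OF that] red(7)[OF that]] by (simp add: left_diff_distrib)
    let ?Q = "\<lambda>n. uniform_measure M (A n)"
    have tm: "tgt n \<in> borel_measurable M" if "2 * R * h n < \<epsilon>" for n using red(4)[OF that] by simp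
    \<comment> \<open>Valid for p n = 0 as well, both sides then being zero.\<close>
    have cond: "(\<integral>z. f z \<partial>?Q n) = (\<integral>z. f z * indicator (A n) z \<partial>M) / p n"
      if "2 * R * h n < \<epsilon>" "f \<in> borel_measurable M" for f n
      using integral_uniform_measure[OF fM red(1)[OF that(1)] that(2)] red(2)[OF that(1)] by simp
    have bias: "\<forall>\<^sub>F n in sequentially. bias ?Q est tgt n = I n / p n"
      using small\<epsilon>
    proof eventually_elim
      case (elim n)
      show ?case unfolding bias_def I_def by (rule cond[OF elim]) (use red(3)[OF elim] tm[OF elim] in simp)
    qed
    have "asymptotically_unbiased ?Q est tgt"
    proof (rule asymptotically_unbiased_eventually[OF bias])
      show "\<forall>\<^sub>F n in sequentially. (\<integral>z. est n z \<partial>?Q n) = (I n + J n) / p n"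
        using small\<epsilon>
      proof eventually_elim
        case (elim n)
        have "(\<integral>z. est n z * indicator (A n) z \<partial>M) = (\<integral>z. (est n z - tgt n z) * indicator (A n) z + tgt n z * indicator (A n) z \<partial>M)"
          by (simp add: left_diff_distrib)
        also have "\<dots> = I n + J n"
          unfolding I_def J_def by (rule Bochner_Integration.integral_add[OF diff[OF elim] red(7)[OF elim]])
        finally show ?case using cond[OF elim red(3)[OF elim]] by simp
      qed
      show "\<forall>\<^sub>F n in sequentially. (\<integral>z. tgt n z \<partial>?Q n) = J n / p n"
        using small\<epsilon> by eventually_elim (use cond tm in \<open>simp add: J_def\<close>)
    qed (rule be.conditional_unbiased be.conditional_bias(2))+
    moreover have "equal_up_to (bias ?Q est tgt) main (\<lambda>n. (h n)\<^sup>2 * q n) (\<lambda>n. h n ^ 6)"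
      unfolding main q by (rule equal_up_to_eventually[OF be.conditional_bias(1) bias])
    moreover have "asymptotically_unbiased (\<lambda>n. M) est tgt \<and> equal_up_to (bias (\<lambda>n. M) est tgt) main (\<lambda>n. (h n)\<^sup>2 * q n) (\<lambda>n. h n ^ 6)"
      if neg: "negligible_outside M A est tgt (\<lambda>n. (h n)\<^sup>2 * q n) (\<lambda>n. h n ^ 6)"
    proof -
      define rest where "rest n = (\<integral>z. \<bar>est n z - tgt n z\<bar> * indicator (space M - A n) z \<partial>M)" for n
      define bM where "bM n = bias (\<lambda>n. M) est tgt n" for n
      have int: "\<forall>\<^sub>F n in sequentially. integrable M (\<lambda>z. est n z - tgt n z)" and rT: "rest \<in> o(T)"
        and rest: "equal_up_to rest (\<lambda>_. 0) (\<lambda>n. (h n)\<^sup>2 * (h n / L n)) (\<lambda>n. h n ^ 6)"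
        using neg unfolding negligible_outside_def Let_def rest_def[abs_def] T_def[abs_def] q by auto
      have "\<forall>\<^sub>F n in sequentially. \<bar>bM n - I n\<bar> \<le> rest n"
        using int small\<epsilon>
      proof eventually_elim
        case (elim n)
        have "bM n - I n = (\<integral>z. (est n z - tgt n z) - (est n z - tgt n z) * indicator (A n) z \<partial>M)"
          unfolding bM_def bias_def I_def
          by (rule Bochner_Integration.integral_diff[OF elim(1) diff[OF elim(2)], symmetric])
        also have "\<dots> = (\<integral>z. (est n z - tgt n z) * indicator (space M - A n) z \<partial>M)"
          by (rule Bochner_Integration.integral_cong) (auto split: split_indicator)
        also have "\<bar>\<dots>\<bar> \<le> (\<integral>z. \<bar>(est n z - tgt n z) * indicator (space M - A n) z\<bar> \<partial>M)" by (rule integral_abs_bound)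
        also have "\<dots> = rest n" unfolding rest_def by (simp add: abs_mult)
        finally show ?case .
      qed
      note ub = be.unconditional_bias[OF this rT rest]
      have "asymptotically_unbiased (\<lambda>n. M) est tgt"
      proof (rule asymptotically_unbiased_eventually[of _ _ _ bM "\<lambda>n. bM n + T n" T])
        show "\<forall>\<^sub>F n in sequentially. (\<integral>z. est n z \<partial>M) = bM n + T n"
          using int small\<epsilon>
        proof eventually_elim
          case (elim n)
          have "(\<integral>z. est n z \<partial>M) = (\<integral>z. (est n z - tgt n z) + tgt n z \<partial>M)" by simp
          also have "\<dots> = bM n + T n"
            unfolding bM_def bias_def T_def by (rule Bochner_Integration.integral_add[OF elim(1) red(4)[OF elim(2)]])
          finally show ?case .
        qed
        show "\<forall>\<^sub>F n in sequentially. bias (\<lambda>n. M) est tgt n = bM n" by (simp add: bM_def)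
        show "\<forall>\<^sub>F n in sequentially. (\<integral>z. tgt n z \<partial>M) = T n" by (simp add: T_def)
      qed (rule ub)+
      moreover have "bias (\<lambda>n. M) est tgt = bM" by (simp add: bM_def fun_eq_iff)
      ultimately show ?thesis unfolding main q using ub(1) by simp
    qed
    ultimately show "(let Q = (\<lambda>n. uniform_measure (N \<Otimes>\<^sub>M P) (good_event N P \<kappa> K R L U h n)) in
              asymptotically_unbiased Q est tgt \<and>
              equal_up_to (bias Q est tgt) main (\<lambda>n. (h n)\<^sup>2 * q n) (\<lambda>n. h n ^ 6)) \<and>
           (negligible_outside (N \<Otimes>\<^sub>M P) (good_event N P \<kappa> K R L U h) est tgt
              (\<lambda>n. (h n)\<^sup>2 * q n) (\<lambda>n. h n ^ 6) \<longrightarrow>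
            (let Q = (\<lambda>n. N \<Otimes>\<^sub>M P) in
              asymptotically_unbiased Q est tgt \<and>
              equal_up_to (bias Q est tgt) main (\<lambda>n. (h n)\<^sup>2 * q n) (\<lambda>n. h n ^ 6)))"
      unfolding Let_def M_def[symmetric] A_def[abs_def, symmetric] by blast
  qed
qed

end
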